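(* Every pseudospherical helicoid $S_{\mu,r}$ with parameters $\mu\in\mathbb{R}\setminus\{0,1\}$ and $r\in\mathbb{R}\setminus\{0\}$ is a helicoid of translational kind.
   Context: Helicoids. Let $\ell\subset\mathbb{R}^3$ be a line oriented by a unit vector $\vec\ell$. For $\mathfrak{p}>0$ and $\eta\in\mathbb{Z}_2=\{\pm1\}$ let $\mathrm{E}^{\ell,\mathfrak{p},\eta}_v(\mathbf{x})=\mathrm{R}^{\ell}_{2\pi v}(\mathbf{x})+\eta v\mathfrak{p}\vec\ell$, $v\in\mathbb{R}$, where $\mathrm{R}^{\ell}_{2\pi v}$ is the oriented rotation by angle $2\pi v$ around $\ell$. A helicoid with screw axis $\ell$, pitch $\mathfrak{p}$, helicity $\eta$ and profile $\widetilde\Gamma$ (a connected curve in $\mathbb{R}^3$, possibly with isolated singularities) is the set $S=\bigcup_{v\in\mathbb{R}}\mathrm{E}^{\ell,\mathfrak{p},\eta}_v(\widetilde\Gamma)$; the profile is not unique. Translational kind. Let $\mathcal{H}_\ell$ be one of the half-planes bounded by $\ell$. The helicoid $S$ is of translational kind if it has a planar profile $\Gamma\subset\mathcal{H}_\ell$ such that: (1) the full symmetry group of $\Gamma$ is a discrete nontrivial subgroup $\mathcal{T}\subset\mathbf{E}(3)$ of pure translations along the screw axis $\ell$, where $\mathbf{E}(3)$ is the group of Euclidean motions of $\mathbb{R}^3$ (this excludes the possibility of a rectilinear profile); (2) $\Gamma$ is a simple curve of $\mathcal{H}_\ell$ with only ordinary cusps as possible singular points; (3) $\Gamma\cap\ell=\emptyset$.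 Jacobian functions. For real $\mu$, $\mathrm{am}(\cdot,\mu):\mathbb{R}\to\mathbb{R}$ is the Jacobian amplitude with parameter $\mu$ (parameter $=k^2$), i.e. the solution of $\theta''=-\mu\sin\theta\cos\theta$, $\theta(0)=0$, $\theta'(0)=1$ (near $0$, the inverse of $\varphi\mapsto\int_0^\varphi(1-\mu\sin^2\theta)^{-1/2}d\theta$). Pseudospherical helicoids. Let $\phi:\mathbb{R}^2\to\mathbb{R}$ be a smooth nonconstant solution of the sine-Gordon equation $\phi_{ss}-\phi_{tt}=\sin\phi$. There is a smooth map $f_\phi:\mathbb{R}^2\to\mathbb{R}^3$, unique up to orientation-preserving rigid motions, which on the open set where $\phi\notin\pi\mathbb{Z}$ is an immersion of Gauss curvature $-1$ with first and second fundamental forms $\cos^2(\phi/2)ds^2+\sin^2(\phi/2)dt^2$ and $\cos(\phi/2)\sin(\phi/2)(ds^2-dt^2)$; precisely, there is a smooth positively oriented orthonormal frame $(e_1,e_2,e_3)$ along $f_\phi$ with $\partial_s f_\phi=\cos(\phi/2)e_1$, $\partial_t f_\phi=\sin(\phi/2)e_2$, and the second fundamental form is $-\langle df_\phi,de_3\rangle$. For $\mu\neq0,1$ and $r\neq 0$ put $$\phi_{\mu,r}(s,t)=-2\,\mathrm{am}\Big(\tfrac{\cosh r}{\sqrt{|\mu|}}s+\tfrac{\sinh r}{\sqrt{|\mu|}}t,\mu\Big)\ (\mu<0),\qquad \phi_{\mu,r}(s,t)=-2\,\mathrm{am}\Big(\tfrac{\sinh r}{\sqrt{|\mu|}}s+\tfrac{\cosh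 r}{\sqrt{|\mu|}}t,\mu\Big)\ (\mu>0,\ \mu\ne1).$$ These are (stationary traveling wave) solutions of the sine-Gordon equation. The pseudospherical helicoid with parameters $(\mu,r)$ is the image $S_{\mu,r}=f_{\phi_{\mu,r}}(\mathbb{R}^2)$, defined up to orientation-preserving rigid motions; it is a helicoid, in general with singularities.
   Formalization: In condition (1) the full symmetry group is taken to consist of orientation-preserving motions that preserve Γ as an oriented curve; read setwise the claim fails, since each such profile is also preserved by half-turns about lines orthogonal to ℓ. *)

theory Defs
  imports "HOL-Analysis.Analysis"
begin

subsection \<open>Smooth maps\<close>

(* On a finite-dimensional domain a map is C^(k+1) iff it is differentiable and each
   of its directional derivatives is C^k. *)
primrec C_k :: "nat \<Rightarrow> ('a::euclidean_space \<Rightarrow> 'b::real_normed_vector) \<Rightarrow> bool" where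
  "C_k 0 f \<longleftrightarrow> continuous_on UNIV f"
| "C_k (Suc k) f \<longleftrightarrow>
     (\<forall>x. f differentiable (at x)) \<and> (\<forall>v. C_k k (\<lambda>x. frechet_derivative f (at x) v))"

definition smooth :: "('a::euclidean_space \<Rightarrow> 'b::real_normed_vector) \<Rightarrow> bool" where
  "smooth f \<longleftrightarrow> (\<forall>k. C_k k f)"


subsection \<open>Helicoids\<close>

(* A line is given by a point c on it and the unit vector l orienting it. *)
definition axis_line :: "real^3 \<Rightarrow> real^3 \<Rightarrow> (real^3) set" where
  "axis_line c l = {c + a *\<^sub>R l |a. True}"

(* Rodrigues' formula for the oriented rotation about axis_line c l. *)
definition rotation_about :: "real^3 \<Rightarrow> real^3 \<Rightarrow> real \<Rightarrow> real^3 \<Rightarrow> real^3" where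
  "rotation_about c l \<alpha> x =
     c + cos \<alpha> *\<^sub>R (x - c) + sin \<alpha> *\<^sub>R cross3 l (x - c)
       + ((1 - cos \<alpha>) * (l \<bullet> (x - c))) *\<^sub>R l"

definition screw_motion ::
    "real^3 \<Rightarrow> real^3 \<Rightarrow> real \<Rightarrow> real \<Rightarrow> real \<Rightarrow> real^3 \<Rightarrow> real^3" where
  "screw_motion c l p \<eta> v x = rotation_about c l (2 * pi * v) x + (\<eta> * v * p) *\<^sub>R l"

definition helicoid ::
    "real^3 \<Rightarrow> real^3 \<Rightarrow> real \<Rightarrow> real \<Rightarrow> (real^3) set \<Rightarrow> (real^3) set" where
  "helicoid c l p \<eta> \<Gamma> = (\<Union>v. screw_motion c l p \<eta> v ` \<Gamma>)"

(* The half-plane bounded by axis_line c l on the side of n; n is a unit vector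
   orthogonal to l. *)
definition half_plane :: "real^3 \<Rightarrow> real^3 \<Rightarrow> real^3 \<Rightarrow> (real^3) set" where
  "half_plane c l n = {c + a *\<^sub>R l + b *\<^sub>R n |a b. b \<ge> 0}"


subsection \<open>Curves and their symmetries\<close>

definition curve_deriv :: "nat \<Rightarrow> (real \<Rightarrow> real^3) \<Rightarrow> real \<Rightarrow> real^3" where
  "curve_deriv k \<gamma> = ((\<lambda>g u. vector_derivative g (at u)) ^^ k) \<gamma>"

(* Semicubical cusp: the velocity vanishes and the second and third derivatives are
   linearly independent.  Such singular points are automatically isolated. *)
definition ordinary_cusp :: "(real \<Rightarrow> real^3) \<Rightarrow> real \<Rightarrow> bool" where
  "ordinary_cusp \<gamma> u \<longleftrightarrow>
     curve_deriv 1 \<gamma> u = 0 \<and> \<not> collinear {0, curve_deriv 2 \<gamma> u, curve_deriv 3 \<gamma> u}"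

definition simple_cuspidal_curve :: "(real \<Rightarrow> real^3) \<Rightarrow> bool" where
  "simple_cuspidal_curve \<gamma> \<longleftrightarrow>
     smooth \<gamma> \<and> inj \<gamma> \<and> (\<forall>u. curve_deriv 1 \<gamma> u = 0 \<longrightarrow> ordinary_cusp \<gamma> u)"

definition euclidean_motion :: "(real^3 \<Rightarrow> real^3) \<Rightarrow> bool" where
  "euclidean_motion g \<longleftrightarrow> (\<exists>A b. rotation_matrix A \<and> g = (\<lambda>x. A *v x + b))"

(* Symmetries of a curve as an oriented curve: a motion is a symmetry if it carries the
   curve to itself up to an orientation-preserving change of parameter.  Motions are
   orientation preserving, since otherwise the reflection in its plane would be a
   symmetry of every planar curve.  Orientation of the curve matters too: the profiles of
   pseudospherical helicoids are carried onto themselves, with reversed orientation, by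
   half-turns about lines orthogonal to the screw axis, and these are not to be counted. *)
definition curve_symmetries :: "(real \<Rightarrow> real^3) \<Rightarrow> (real^3 \<Rightarrow> real^3) set" where
  "curve_symmetries \<gamma> =
     {g. euclidean_motion g \<and> (\<exists>\<sigma>. strict_mono \<sigma> \<and> surj \<sigma> \<and> g \<circ> \<gamma> = \<gamma> \<circ> \<sigma>)}"

definition discrete_nontrivial_translation_group ::
    "real^3 \<Rightarrow> (real^3 \<Rightarrow> real^3) set \<Rightarrow> bool" where
  "discrete_nontrivial_translation_group l T \<longleftrightarrow>
     (\<exists>A::real set. 0 \<in> A \<and> (\<forall>a\<in>A. \<forall>b\<in>A. a - b \<in> A) \<and> discrete A \<and> A \<noteq> {0} \<and>
        T = (\<lambda>a x. x + a *\<^sub>R l) ` A)"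

definition helicoid_of_translational_kind :: "(real^3) set \<Rightarrow> bool" where
  "helicoid_of_translational_kind S \<longleftrightarrow>
     (\<exists>c l p \<eta> n \<gamma>. norm l = 1 \<and> p > 0 \<and> (\<eta> = 1 \<or> \<eta> = -1) \<and> norm n = 1 \<and> l \<bullet> n = 0 \<and>
        S = helicoid c l p \<eta> (range \<gamma>) \<and>
        range \<gamma> \<subseteq> half_plane c l n \<and>
        discrete_nontrivial_translation_group l (curve_symmetries \<gamma>) \<and>
        simple_cuspidal_curve \<gamma> \<and>
        range \<gamma> \<inter> axis_line c l = {})"


subsection \<open>Pseudospherical helicoids\<close>

(* \<mu> is the parameter k^2, not the modulus k. *)
definition jacobi_am :: "real \<Rightarrow> real \<Rightarrow> real" where
  "jacobi_am u \<mu> =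
     (THE \<theta>::real \<Rightarrow> real. \<theta> 0 = 0 \<and>
        (\<exists>\<omega>. \<omega> 0 = 1 \<and>
           (\<forall>x. (\<theta> has_real_derivative \<omega> x) (at x)) \<and>
           (\<forall>x. (\<omega> has_real_derivative - \<mu> * sin (\<theta> x) * cos (\<theta> x)) (at x)))) u"

definition second_fundamental_form ::
    "(real \<times> real \<Rightarrow> real^3) \<Rightarrow> (real \<times> real \<Rightarrow> real^3) \<Rightarrow> real \<times> real \<Rightarrow> real \<times> real \<Rightarrow> real" where
  "second_fundamental_form f N z v =
     - (frechet_derivative f (at z) v \<bullet> frechet_derivative N (at z) v)"

(* Points of the plane are z = (s, t).  The first fundamental form
   cos(\<phi>/2)^2 ds^2 + sin(\<phi>/2)^2 dt^2 is implied by the two conditions on the partial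
   derivatives of f. *)
definition pseudospherical_map ::
    "(real \<times> real \<Rightarrow> real) \<Rightarrow> (real \<times> real \<Rightarrow> real^3) \<Rightarrow> bool" where
  "pseudospherical_map \<phi> f \<longleftrightarrow> smooth f \<and>
     (\<exists>e1 e2 e3. smooth e1 \<and> smooth e2 \<and> smooth e3 \<and>
        (\<forall>z. norm (e1 z) = 1 \<and> norm (e2 z) = 1 \<and> norm (e3 z) = 1 \<and>
             e1 z \<bullet> e2 z = 0 \<and> e1 z \<bullet> e3 z = 0 \<and> e2 z \<bullet> e3 z = 0 \<and>
             det (vector [e1 z, e2 z, e3 z] :: real^3^3) > 0) \<and>
        (\<forall>z. frechet_derivative f (at z) (1, 0) = cos (\<phi> z / 2) *\<^sub>R e1 z \<and>
             frechet_derivative f (at z) (0, 1) = sin (\<phi> z / 2) *\<^sub>R e2 z) \<and>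
        (\<forall>z ds dt. second_fundamental_form f e3 z (ds, dt) =
             cos (\<phi> z / 2) * sin (\<phi> z / 2) * (ds\<^sup>2 - dt\<^sup>2)))"

definition traveling_wave :: "real \<Rightarrow> real \<Rightarrow> real \<times> real \<Rightarrow> real" where
  "traveling_wave \<mu> r = (\<lambda>(s, t).
     if \<mu> < 0
     then - 2 * jacobi_am (cosh r / sqrt \<bar>\<mu>\<bar> * s + sinh r / sqrt \<bar>\<mu>\<bar> * t) \<mu>
     else - 2 * jacobi_am (sinh r / sqrt \<bar>\<mu>\<bar> * s + cosh r / sqrt \<bar>\<mu>\<bar> * t) \<mu>)"

(* A relation rather than a function of \<mu> and r, because the surface is only determined
   up to orientation-preserving rigid motions. *)
definition pseudospherical_helicoid :: "real \<Rightarrow> real \<Rightarrow> (real^3) set \<Rightarrow> bool" where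
  "pseudospherical_helicoid \<mu> r S \<longleftrightarrow>
     (\<exists>f. pseudospherical_map (traveling_wave \<mu> r) f \<and> S = range f)"

end

theory Submission
  imports Defs
begin

text \<open>The sine-Gordon solution of a pseudospherical helicoid depends on \<open>(s, t)\<close> only through a phase
\<open>\<alpha> s + \<beta> t\<close>, and this makes the surface invariant under a one-parameter group of rigid
motions. Write \<open>\<theta>\<close> for the amplitude, \<open>\<omega>\<close> for its derivative, and \<open>\<epsilon> = - 1 / \<mu>\<close>; the
parameters satisfy \<open>\<alpha>\<^sup>2 - \<beta>\<^sup>2 = \<epsilon>\<close>. The second fundamental form and the equality of mixed
partial derivatives determine the derivatives of the orthonormal frame (\<open>frame_equations\<close>). Their
coefficients depend on the phase alone, so along the direction \<open>(\<beta>, - \<alpha>)\<close>, in which the phase is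
constant, the frame turns with an angular velocity \<open>\<Omega> = \<alpha> cos \<theta> e1 + \<beta> sin \<theta> e2 + \<epsilon> \<omega> e3\<close> and
the surface point moves with velocity \<open>V = \<beta> cos \<theta> e1 + \<alpha> sin \<theta> e2\<close>. The relation between
\<open>\<alpha>\<close> and \<open>\<beta>\<close> is exactly what makes \<open>\<Omega>\<close> a constant vector of space; its square length
is \<open>\<kappa>\<^sup>2 = \<alpha>\<^sup>2 + \<epsilon>\<^sup>2\<close>. Since \<open>\<Omega> \<bullet> V = \<alpha> \<beta>\<close> does not vanish for \<open>r \<noteq> 0\<close>, the
motion is a genuine screw motion about an axis parallel to \<open>\<Omega>\<close>, which advances by \<open>\<alpha> \<beta> / \<kappa>\<^sup>2\<close>
per radian. Cylindrical coordinates about that axis (\<open>surface_in_cylindrical_coordinates\<close>) then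
exhibit the surface as the helicoid of a curve in a half-plane (\<open>image_is_helicoid\<close>).

The distance \<open>\<rho>\<close> from the axis and the height \<open>\<zeta>\<close> along the profile have derivatives
\<open>\<sigma> a\<close> and \<open>\<sigma>\<^sup>2 b\<close> with \<open>\<sigma> = sin \<theta> cos \<theta>\<close>, where \<open>b\<close> has constant sign and the zeros of
\<open>\<sigma>\<close> are simple because \<open>\<mu> \<noteq> 1\<close>. Hence the height is strictly monotone, the profile is simple, and its
singular points are the zeros of \<open>\<sigma>\<close>, all of them ordinary cusps. The distance is positive
(\<open>Q_pos\<close>), so the profile misses the axis. Only \<open>sin\<^sup>2 \<theta>\<close> enters \<open>\<rho>\<close> and the derivative of \<open>\<zeta>\<close>,
and it is periodic, so some translation along the axis is a symmetry.

It remains to see that there are no symmetries but a discrete set of translations. A motion that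
preserves a bounded, periodic, monotone curve of this kind is either a translation along the axis or
a flip \<open>\<rho> \<mapsto> h - \<rho>\<close> combined with a shift of the height (\<open>planar_symmetry_cases\<close>). The limit of
\<open>(\<Delta>\<rho>)\<^sup>3 / (\<Delta>\<zeta>)\<^sup>2\<close> at a point of the curve is preserved by translations and changes sign under flips;
it vanishes at regular points and does not vanish at cusps. So symmetries map cusps to
cusps, which makes the translations discrete, and a flip would need two cusps with opposite limits.
The cusps with \<open>sin \<theta> = 0\<close> all have one limit, those with \<open>cos \<theta> = 0\<close> another one of the opposite sign,
and their absolute values agree only if \<open>(1 - \<mu>)\<^sup>3 \<alpha>\<^sup>2 = \<beta>\<^sup>2\<close>, which contradicts
\<open>\<alpha>\<^sup>2 - \<beta>\<^sup>2 = - 1 / \<mu>\<close> (\<open>cusps_not_congruent\<close>).\<close>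

section \<open>The Jacobi amplitude\<close>

definition pendulum_solution :: "real \<Rightarrow> (real \<Rightarrow> real) \<Rightarrow> (real \<Rightarrow> real) \<Rightarrow> bool" where
  "pendulum_solution \<mu> \<theta> \<omega> \<longleftrightarrow> \<theta> 0 = 0 \<and> \<omega> 0 = 1 \<and>
     (\<forall>x. (\<theta> has_real_derivative \<omega> x) (at x)) \<and>
     (\<forall>x. (\<omega> has_real_derivative - \<mu> * sin (\<theta> x) * cos (\<theta> x)) (at x))"

lemma pendulum_first_integral:
  assumes "pendulum_solution \<mu> \<theta> \<omega>"
  shows "(\<omega> x)\<^sup>2 = 1 - \<mu> * (sin (\<theta> x))\<^sup>2"
proof -
  let ?E = "\<lambda>x. (\<omega> x)\<^sup>2 + \<mu> * (sin (\<theta> x))\<^sup>2"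
  have "(?E has_real_derivative 0) (at y)" for y
    using assms unfolding pendulum_solution_def
    by (auto intro!: derivative_eq_intros simp: power2_eq_square)
  then have "?E x = ?E 0"
    by (intro DERIV_isconst_all) auto
  then show ?thesis
    using assms by (simp add: pendulum_solution_def)
qed

text \<open>The right-hand side of the pendulum equation is globally Lipschitz, which is what the uniqueness of its
solutions rests on.\<close>

lemma sin_cos_lipschitz: "\<bar>sin a * cos a - sin b * cos b\<bar> \<le> \<bar>a - b\<bar>" for a b :: real
proof -
  have "\<bar>sin (2 * a) - sin (2 * b)\<bar> \<le> \<bar>2 * a - 2 * b\<bar>"
  proof -
    have "sin (2 * a) - sin (2 * b) = 2 * (sin (a - b) * cos (a + b))"
    proof -
      have "(2 * a - 2 * b) / 2 = a - b" and "(2 * a + 2 * b) / 2 = a + b" by (simp_all add: field_simps)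
      then show ?thesis by (simp only: sin_diff_sin)
    qed
    moreover have "\<bar>sin (a - b) * cos (a + b)\<bar> \<le> \<bar>a - b\<bar> * 1"
      unfolding abs_mult by (intro mult_mono) (auto simp: abs_sin_x_le_abs_x)
    ultimately show ?thesis by simp
  qed
  then show ?thesis by (simp add: sin_double)
qed

text \<open>Gronwall's argument: the square distance \<open>E\<close> of two solutions in phase space satisfies
\<open>\<bar>E'\<bar> \<le> C E\<close> and vanishes at \<open>0\<close>. Hence \<open>E exp (- C x)\<close> is nonincreasing to the right of \<open>0\<close> and
\<open>E exp (C x)\<close> is nondecreasing to the left of it.\<close>

lemma pendulum_solution_unique:
  assumes "pendulum_solution \<mu> \<theta> \<omega>" and "pendulum_solution \<mu> \<theta>' \<omega>'"
  shows "\<theta> = \<theta>'"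
proof
  fix x
  define C where "C = 1 + \<bar>\<mu>\<bar>"
  define E where "E x = (\<theta> x - \<theta>' x)\<^sup>2 + (\<omega> x - \<omega>' x)\<^sup>2" for x
  define E' where "E' x = 2 * ((\<theta> x - \<theta>' x) * (\<omega> x - \<omega>' x)) - 2 * ((\<omega> x - \<omega>' x) * \<mu> *
      (sin (\<theta> x) * cos (\<theta> x) - sin (\<theta>' x) * cos (\<theta>' x)))" for x
  have dE: "(E has_real_derivative E' x) (at x)" for x
    using assms unfolding pendulum_solution_def E_def E'_def
    by (auto intro!: derivative_eq_intros simp: algebra_simps)
  have bound: "\<bar>E' x\<bar> \<le> C * E x" for x
  proof -
    have am_gm: "2 * \<bar>\<theta> x - \<theta>' x\<bar> * \<bar>\<omega> x - \<omega>' x\<bar> \<le> E x"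
      using sum_squares_bound[of "\<bar>\<theta> x - \<theta>' x\<bar>" "\<bar>\<omega> x - \<omega>' x\<bar>"] by (simp add: E_def)
    have "\<bar>E' x\<bar> \<le> 2 * \<bar>\<theta> x - \<theta>' x\<bar> * \<bar>\<omega> x - \<omega>' x\<bar> + 2 * \<bar>\<omega> x - \<omega>' x\<bar> * \<bar>\<mu>\<bar> *
        \<bar>sin (\<theta> x) * cos (\<theta> x) - sin (\<theta>' x) * cos (\<theta>' x)\<bar>"
      unfolding E'_def by (rule order_trans[OF abs_triangle_ineq4]) (simp add: abs_mult)
    also have "\<dots> \<le> 2 * \<bar>\<theta> x - \<theta>' x\<bar> * \<bar>\<omega> x - \<omega>' x\<bar> + 2 * \<bar>\<omega> x - \<omega>' x\<bar> * \<bar>\<mu>\<bar> * \<bar>\<theta> x - \<theta>' x\<bar>"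
      by (intro add_left_mono mult_left_mono sin_cos_lipschitz) auto
    also have "\<dots> = C * (2 * \<bar>\<theta> x - \<theta>' x\<bar> * \<bar>\<omega> x - \<omega>' x\<bar>)"
      by (simp add: C_def algebra_simps)
    also have "\<dots> \<le> C * E x"
      using am_gm by (intro mult_left_mono) (auto simp: C_def)
    finally show ?thesis .
  qed
  have E0: "E 0 = 0"
    using assms by (simp add: E_def pendulum_solution_def)
  have "E x \<le> 0"
  proof (cases "x \<ge> 0")
    case True
    have "E x * exp (- C * x) \<le> E 0 * exp (- C * 0)"
    proof (rule DERIV_nonpos_imp_nonincreasing[OF True])
      fix y
      have "((\<lambda>y. E y * exp (- C * y)) has_real_derivative (E' y - C * E y) * exp (- C * y)) (at y)"
        by (auto intro!: derivative_eq_intros dE simp: algebra_simps)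
      moreover have "(E' y - C * E y) * exp (- C * y) \<le> 0"
        using bound[of y] by (intro mult_nonpos_nonneg) auto
      ultimately show "\<exists>d. ((\<lambda>y. E y * exp (- C * y)) has_real_derivative d) (at y) \<and> d \<le> 0"
        by blast
    qed
    then show ?thesis
      using E0 by (simp add: mult_le_0_iff not_le)
  next
    case False
    then have "x \<le> 0" by simp
    then have "E x * exp (C * x) \<le> E 0 * exp (C * 0)"
    proof (rule DERIV_nonneg_imp_nondecreasing)
      fix y
      have "((\<lambda>y. E y * exp (C * y)) has_real_derivative (E' y + C * E y) * exp (C * y)) (at y)"
        by (auto intro!: derivative_eq_intros dE simp: algebra_simps)
      moreover have "(E' y + C * E y) * exp (C * y) \<ge> 0"
        using bound[of y] by (intro mult_nonneg_nonneg) auto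
      ultimately show "\<exists>d. ((\<lambda>y. E y * exp (C * y)) has_real_derivative d) (at y) \<and> 0 \<le> d"
        by blast
    qed
    then show ?thesis
      using E0 by (simp add: mult_le_0_iff not_le)
  qed
  then show "\<theta> x = \<theta>' x"
    by (simp add: E_def sum_power2_le_zero_iff)
qed

lemma jacobi_am_eq:
  assumes "pendulum_solution \<mu> \<theta> \<omega>"
  shows "jacobi_am u \<mu> = \<theta> u"
proof -
  have "(THE \<theta>::real \<Rightarrow> real. \<theta> 0 = 0 \<and>
        (\<exists>\<omega>. \<omega> 0 = 1 \<and>
           (\<forall>x. (\<theta> has_real_derivative \<omega> x) (at x)) \<and>
           (\<forall>x. (\<omega> has_real_derivative - \<mu> * sin (\<theta> x) * cos (\<theta> x)) (at x)))) = \<theta>"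
  proof (rule the_equality)
    show "\<theta> 0 = 0 \<and> (\<exists>\<omega>. \<omega> 0 = 1 \<and> (\<forall>x. (\<theta> has_real_derivative \<omega> x) (at x)) \<and>
           (\<forall>x. (\<omega> has_real_derivative - \<mu> * sin (\<theta> x) * cos (\<theta> x)) (at x)))"
      using assms unfolding pendulum_solution_def by blast
  next
    fix \<theta>' :: "real \<Rightarrow> real"
    assume "\<theta>' 0 = 0 \<and> (\<exists>\<omega>. \<omega> 0 = 1 \<and> (\<forall>x. (\<theta>' has_real_derivative \<omega> x) (at x)) \<and>
           (\<forall>x. (\<omega> has_real_derivative - \<mu> * sin (\<theta>' x) * cos (\<theta>' x)) (at x)))"
    then obtain \<omega>' where "pendulum_solution \<mu> \<theta>' \<omega>'"
      unfolding pendulum_solution_def by blast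
    then show "\<theta>' = \<theta>"
      using pendulum_solution_unique assms by blast
  qed
  then show ?thesis
    by (simp add: jacobi_am_def)
qed

lemma global_antiderivative:
  fixes g :: "real \<Rightarrow> real"
  assumes "\<And>x. isCont g x"
  obtains G where "G 0 = 0" and "\<And>x. (G has_real_derivative g x) (at x)"
proof -
  have "\<exists>F. \<forall>x::real. - \<infinity> < ereal x \<longrightarrow> ereal x < \<infinity> \<longrightarrow> (F has_vector_derivative g x) (at x)"
    by (rule einterval_antiderivative) (use assms in auto)
  then obtain F where F: "\<And>x. (F has_real_derivative g x) (at x)"
    by (auto simp: has_real_derivative_iff_has_vector_derivative)
  show ?thesis
  proof (rule that[of "\<lambda>x. F x - F 0"])
    show "((\<lambda>x. F x - F 0) has_real_derivative g x) (at x)" for x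
      by (auto intro!: derivative_eq_intros F)
  qed simp
qed

text \<open>For \<open>\<mu> < 1\<close> the energy suffices to carry the pendulum over the top. The elliptic integral is
then an increasing bijection of the real line, and its inverse solves the equation. The integrand has
period \<open>pi\<close>, which gives the quasi-period of the amplitude.\<close>

lemma rotating_pendulum_exists:
  assumes "\<mu> < 1"
  obtains \<theta> \<omega> P where "pendulum_solution \<mu> \<theta> \<omega>" and "P > 0" and "\<And>x. \<theta> (x + P) = \<theta> x + pi"
    and "\<And>x. \<omega> x = sqrt (1 - \<mu> * (sin (\<theta> x))\<^sup>2)"
proof -
  define d where "d \<phi> = 1 - \<mu> * (sin \<phi>)\<^sup>2" for \<phi> :: real
  have d_pos: "d \<phi> > 0" for \<phi>
  proof (cases "\<mu> \<ge> 0")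
    case True
    have "\<mu> * (sin \<phi>)\<^sup>2 \<le> \<mu> * 1"
      using True by (intro mult_left_mono) (auto simp: abs_square_le_1)
    then show ?thesis using assms by (simp add: d_def)
  next
    case False
    then have "\<mu> * (sin \<phi>)\<^sup>2 \<le> 0"
      by (intro mult_nonpos_nonneg) auto
    then show ?thesis by (simp add: d_def)
  qed
  have d_le: "d \<phi> \<le> 1 + \<bar>\<mu>\<bar>" for \<phi>
  proof -
    have "\<bar>\<mu> * (sin \<phi>)\<^sup>2\<bar> \<le> \<bar>\<mu>\<bar> * 1"
      unfolding abs_mult by (intro mult_left_mono) (auto simp: abs_square_le_1)
    then show ?thesis unfolding d_def by linarith
  qed
  obtain F where F0: "F 0 = 0" and dF: "\<And>\<phi>. (F has_real_derivative 1 / sqrt (d \<phi>)) (at \<phi>)"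
  proof (rule global_antiderivative)
    show "isCont (\<lambda>\<phi>. 1 / sqrt (d \<phi>)) x" for x
      using d_pos[of x] unfolding d_def by (intro continuous_intros) auto
  qed blast
  \<comment> \<open>A positive lower bound of the slope makes the elliptic integral surjective.\<close>
  define m where "m = 1 / sqrt (1 + \<bar>\<mu>\<bar>)"
  have m: "m > 0" and slope: "1 / sqrt (d \<phi>) \<ge> m" for \<phi>
    using d_pos[of \<phi>] d_le[of \<phi>] by (auto simp: m_def frac_le)
  have grow: "F y - F x \<ge> m * (y - x)" if "x \<le> y" for x y
  proof -
    have "F x - m * x \<le> F y - m * y"
    proof (rule DERIV_nonneg_imp_nondecreasing[OF that])
      fix z
      have "((\<lambda>z. F z - m * z) has_real_derivative 1 / sqrt (d z) - m) (at z)"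
        by (auto intro!: derivative_eq_intros dF)
      then show "\<exists>D. ((\<lambda>z. F z - m * z) has_real_derivative D) (at z) \<and> 0 \<le> D"
        using slope[of z] by auto
    qed
    then show ?thesis by (simp add: algebra_simps)
  qed
  have mono: "strict_mono F"
  proof (rule strict_monoI)
    fix x y :: real assume "x < y"
    then have "m * (y - x) > 0" using m by simp
    then show "F x < F y" using grow[of x y] \<open>x < y\<close> by simp
  qed
  have contF: "continuous_on UNIV F"
    using dF by (meson DERIV_isCont continuous_at_imp_continuous_on)
  have surj: "surj F"
  proof (unfold surj_def, intro allI)
    fix y
    have "\<exists>x. - (\<bar>y\<bar> / m) \<le> x \<and> x \<le> \<bar>y\<bar> / m \<and> F x = y"
    proof (rule IVT')
      show "F (- (\<bar>y\<bar> / m)) \<le> y"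
        using grow[of "- (\<bar>y\<bar> / m)" 0] m F0 by (simp add: field_simps)
      show "y \<le> F (\<bar>y\<bar> / m)"
        using grow[of 0 "\<bar>y\<bar> / m"] m F0 by (simp add: field_simps)
      show "- (\<bar>y\<bar> / m) \<le> \<bar>y\<bar> / m" using m by simp
    qed (use contF continuous_on_subset in blast)
    then show "\<exists>x. y = F x" by blast
  qed
  define \<theta> where "\<theta> = inv F"
  define \<omega> where "\<omega> x = sqrt (d (\<theta> x))" for x
  have F\<theta>: "F (\<theta> x) = x" for x
    by (simp add: \<theta>_def surj surj_f_inv_f)
  have \<theta>F: "\<theta> (F x) = x" for x
    by (simp add: \<theta>_def mono strict_mono_imp_inj_on)
  have mono\<theta>: "\<theta> x \<le> \<theta> y" if "x \<le> y" for x y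
    using that F\<theta> mono by (metis strict_mono_less_eq)
  have "continuous_on UNIV \<theta>"
  proof (rule continuous_onI_mono)
    show "open (range \<theta>)"
      using \<theta>F by (metis open_UNIV surjI)
  qed (use mono\<theta> in auto)
  then have cont\<theta>: "isCont \<theta> x" for x
    by (simp add: continuous_on_eq_continuous_at)
  have d\<theta>: "(\<theta> has_real_derivative \<omega> x) (at x)" for x
  proof -
    have "(\<theta> has_real_derivative inverse (1 / sqrt (d (\<theta> x)))) (at x)"
      by (rule DERIV_inverse_function[where a = "x - 1" and b = "x + 1", OF dF])
        (use d_pos[of "\<theta> x"] F\<theta> cont\<theta> in auto)
    then show ?thesis by (simp add: \<omega>_def)
  qed
  have \<omega>_pos: "\<omega> x > 0" for x
    using d_pos by (simp add: \<omega>_def)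
  have d\<omega>: "(\<omega> has_real_derivative - \<mu> * sin (\<theta> x) * cos (\<theta> x)) (at x)" for x
  proof -
    have "((\<lambda>x. sqrt (d (\<theta> x))) has_real_derivative
        (- \<mu> * (2 * sin (\<theta> x) * (cos (\<theta> x) * \<omega> x))) * (inverse (sqrt (d (\<theta> x))) / 2)) (at x)"
      unfolding d_def
      by (rule derivative_eq_intros d\<theta> refl | use d_pos[of "\<theta> x"] in \<open>simp add: d_def\<close>)+
    then show ?thesis
      using \<omega>_pos[of x] by (simp add: \<omega>_def[symmetric] field_simps)
  qed
  have sol: "pendulum_solution \<mu> \<theta> \<omega>"
    unfolding pendulum_solution_def
    using d\<theta> d\<omega> \<theta>F[of 0] F0 by (simp add: \<omega>_def d_def)
  have F_shift: "F (\<phi> + pi) = F \<phi> + F pi" for \<phi>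
  proof -
    have "((\<lambda>x. F (x + pi) - F x) has_real_derivative 0) (at x)" for x
    proof -
      have "((\<lambda>x. F (x + pi)) has_real_derivative 1 / sqrt (d (x + pi))) (at x)"
        using dF[of "x + pi"] by (simp add: DERIV_shift)
      then show ?thesis
        by (auto intro!: derivative_eq_intros dF simp: d_def)
    qed
    then have "F (\<phi> + pi) - F \<phi> = F (0 + pi) - F 0"
      by (intro DERIV_isconst_all) auto
    then show ?thesis by (simp add: F0)
  qed
  show ?thesis
  proof (rule that[OF sol])
    show "F pi > 0"
      using mono F0 by (metis pi_gt_zero strict_mono_less)
    show "\<theta> (x + F pi) = \<theta> x + pi" for x
      by (metis F_shift F\<theta> \<theta>F)
    show "\<omega> x = sqrt (1 - \<mu> * (sin (\<theta> x))\<^sup>2)" for x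
      by (simp add: \<omega>_def d_def)
  qed
qed

text \<open>For \<open>\<mu> > 1\<close> the pendulum swings back and forth. Jacobi's reciprocal modulus transformation reduces
it to a rotating one: if \<open>a\<close> is the amplitude with parameter \<open>1 / \<mu>\<close> and \<open>k = sqrt \<mu>\<close>, then
\<open>sin (\<theta> x) = sin (a (k x)) / k\<close> defines the amplitude with parameter \<open>\<mu>\<close>, whose derivative is
\<open>cos (a (k x))\<close>.\<close>

lemma oscillating_pendulum_exists:
  assumes "\<mu> > 1"
  obtains \<theta> \<omega> P where "pendulum_solution \<mu> \<theta> \<omega>" and "P > 0"
    and "\<And>x. (sin (\<theta> (x + P)))\<^sup>2 = (sin (\<theta> x))\<^sup>2"
proof -
  define k where "k = sqrt \<mu>"
  have k: "k > 1" and k2: "k * k = \<mu>" using assms by (auto simp: k_def)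
  obtain a \<omega> P where sol: "pendulum_solution (1 / \<mu>) a \<omega>" and P: "P > 0" "\<And>x. a (x + P) = a x + pi"
    and \<omega>: "\<And>x. \<omega> x = sqrt (1 - 1 / \<mu> * (sin (a x))\<^sup>2)"
    by (rule rotating_pendulum_exists[of "1 / \<mu>"]) (use assms in simp, rule that)
  have da: "(a has_real_derivative \<omega> x) (at x)" for x
    using sol by (simp add: pendulum_solution_def)
  define \<theta> where "\<theta> x = arcsin (sin (a (k * x)) / k)" for x
  have lt1: "\<bar>sin (a x) / k\<bar> < 1" for x
    using k le_less_trans[OF abs_sin_le_one[of "a x"] k] by (simp add: abs_divide)
  have sin\<theta>: "sin (\<theta> x) = sin (a (k * x)) / k" for x
    unfolding \<theta>_def by (rule sin_arcsin) (use lt1[of "k * x"] in linarith)+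
  have cos\<theta>: "cos (\<theta> x) = \<omega> (k * x)" for x
  proof -
    have "cos (\<theta> x) = sqrt (1 - (sin (a (k * x)) / k)\<^sup>2)"
      unfolding \<theta>_def by (rule cos_arcsin) (use lt1[of "k * x"] in linarith)+
    then show ?thesis
      by (simp add: \<omega> power_divide power2_eq_square k2)
  qed
  have cos_pos: "\<omega> x > 0" for x
  proof -
    have "(sin (a x) / k)\<^sup>2 < 1" using lt1[of x] by (simp only: abs_square_less_1)
    then show ?thesis by (simp add: \<omega> power_divide power2_eq_square k2)
  qed
  have d\<theta>: "(\<theta> has_real_derivative cos (a (k * x))) (at x)" for x
  proof -
    have dak: "((\<lambda>x. a (k * x)) has_real_derivative \<omega> (k * x) * k) (at x)"
      by (rule DERIV_chain2[OF da]) (auto intro!: derivative_eq_intros)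
    have "(\<theta> has_real_derivative inverse (sqrt (1 - (sin (a (k * x)) / k)\<^sup>2)) *
        (cos (a (k * x)) * (\<omega> (k * x) * k) / k)) (at x)"
      unfolding \<theta>_def
    proof (rule DERIV_chain2[OF DERIV_arcsin])
      show "((\<lambda>x. sin (a (k * x)) / k) has_real_derivative cos (a (k * x)) * (\<omega> (k * x) * k) / k) (at x)"
        using k by (auto intro!: derivative_eq_intros dak)
    qed (use lt1[of "k * x"] in linarith)+
    moreover have "sqrt (1 - (sin (a (k * x)) / k)\<^sup>2) = \<omega> (k * x)"
      by (simp add: \<omega> power_divide power2_eq_square k2)
    moreover have "inverse (\<omega> (k * x)) * (cos (a (k * x)) * (\<omega> (k * x) * k) / k) = cos (a (k * x))"
      using k cos_pos[of "k * x"] by (simp add: field_simps)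
    ultimately show ?thesis by simp
  qed
  have d\<omega>: "((\<lambda>x. cos (a (k * x))) has_real_derivative - \<mu> * sin (\<theta> x) * cos (\<theta> x)) (at x)" for x
  proof -
    have "((\<lambda>x. cos (a (k * x))) has_real_derivative - sin (a (k * x)) * (\<omega> (k * x) * k)) (at x)"
      by (rule DERIV_chain2[OF DERIV_cos], rule DERIV_chain2[OF da]) (auto intro!: derivative_eq_intros)
    moreover have "- sin (a (k * x)) * (\<omega> (k * x) * k) = - \<mu> * sin (\<theta> x) * cos (\<theta> x)"
      using k unfolding sin\<theta> cos\<theta> k2[symmetric] by simp
    ultimately show ?thesis by simp
  qed
  show ?thesis
  proof (rule that)
    show "pendulum_solution \<mu> \<theta> (\<lambda>x. cos (a (k * x)))"
      unfolding pendulum_solution_def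
    proof (intro conjI allI d\<theta> d\<omega>)
      have "a 0 = 0" using sol by (simp add: pendulum_solution_def)
      then show "\<theta> 0 = 0" and "cos (a (k * 0)) = 1" by (simp_all add: \<theta>_def)
    qed
    show "P / k > 0" using P k by simp
    show "(sin (\<theta> (x + P / k)))\<^sup>2 = (sin (\<theta> x))\<^sup>2" for x
    proof -
      have "k * (x + P / k) = k * x + P" using k by (simp add: field_simps)
      then have "sin (\<theta> (x + P / k)) = - sin (\<theta> x)" by (simp only: sin\<theta> P(2) sin_periodic_pi minus_divide_left)
      then show ?thesis by simp
    qed
  qed
qed

lemma pendulum_exists:
  assumes "\<mu> \<noteq> 1"
  obtains \<theta> \<omega> P where "pendulum_solution \<mu> \<theta> \<omega>" and "P > 0"
    and "\<And>x. (sin (\<theta> (x + P)))\<^sup>2 = (sin (\<theta> x))\<^sup>2"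
proof (cases "\<mu> < 1")
  case True
  then obtain \<theta> \<omega> P where *: "pendulum_solution \<mu> \<theta> \<omega>" "P > 0" "\<And>x. \<theta> (x + P) = \<theta> x + pi"
    by (rule rotating_pendulum_exists) (rule that)
  from that[OF *(1,2)] show ?thesis by (simp add: *(3))
next
  case False
  then have "\<mu> > 1" using assms by simp
  then show ?thesis by (rule oscillating_pendulum_exists) (rule that)
qed

section \<open>Planar curves with semicubical cusps\<close>

text \<open>Smoothness is proved for whole families of functions at once: the iterated derivatives of a
member stay in the family. The family has to admit scalar multiples because the directional derivative in
direction \<open>v\<close> is \<open>v\<close> times the ordinary one.\<close>

lemma smooth_if_closed_under_derivatives:
  fixes F :: "(real \<Rightarrow> 'b::real_normed_vector) set"
  assumes deriv: "\<And>g. g \<in> F \<Longrightarrow> \<exists>g'\<in>F. \<forall>x. (g has_vector_derivative g' x) (at x)"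
    and scale: "\<And>g c. g \<in> F \<Longrightarrow> (\<lambda>x. c *\<^sub>R g x) \<in> F"
    and "g \<in> F"
  shows "smooth g"
proof -
  have "C_k k g" if "g \<in> F" for k g
    using that
  proof (induction k arbitrary: g)
    case 0
    then obtain g' where "\<And>x. (g has_vector_derivative g' x) (at x)"
      using deriv by blast
    then show ?case
      by (auto intro!: continuous_at_imp_continuous_on has_vector_derivative_continuous)
  next
    case (Suc k)
    then obtain g' where g': "g' \<in> F" "\<And>x. (g has_vector_derivative g' x) (at x)"
      using deriv by blast
    have "frechet_derivative g (at x) v = v *\<^sub>R g' x" for x v
      using frechet_derivative_at[OF g'(2)[unfolded has_vector_derivative_def], of x]
      by (metis (no_types))
    moreover have "g differentiable at x" for x
      using g'(2) by (auto simp: differentiable_def has_vector_derivative_def)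
    ultimately show ?case
      using Suc.IH scale g'(1) by simp
  qed
  then show ?thesis
    using \<open>g \<in> F\<close> by (simp add: smooth_def)
qed

text \<open>If the derivatives of certain functions are polynomials in these functions, then so are all their
higher derivatives. The profile curve is handled in this way, with the sine and the cosine of the
amplitude, its derivative, and the reciprocal of \<open>sqrt Q\<close> as generators.\<close>

inductive_set generated_algebra :: "(real \<Rightarrow> real) set \<Rightarrow> (real \<Rightarrow> real) set" for G where
  gen: "g \<in> G \<Longrightarrow> g \<in> generated_algebra G"
| const: "(\<lambda>u. c) \<in> generated_algebra G"
| add: "g \<in> generated_algebra G \<Longrightarrow> h \<in> generated_algebra G \<Longrightarrow> (\<lambda>u. g u + h u) \<in> generated_algebra G"
| mult: "g \<in> generated_algebra G \<Longrightarrow> h \<in> generated_algebra G \<Longrightarrow> (\<lambda>u. g u * h u) \<in> generated_algebra G"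

lemma generated_algebra_power:
  "g \<in> generated_algebra G \<Longrightarrow> (\<lambda>u. g u ^ k) \<in> generated_algebra G"
  by (induction k) (auto intro: generated_algebra.const generated_algebra.mult)

lemma generated_algebra_deriv:
  assumes "\<And>g. g \<in> G \<Longrightarrow> \<exists>g'\<in>generated_algebra G. \<forall>u. (g has_real_derivative g' u) (at u)"
    and "g \<in> generated_algebra G"
  shows "\<exists>g'\<in>generated_algebra G. \<forall>u. (g has_real_derivative g' u) (at u)"
  using assms(2)
proof induction
  case (gen g)
  then show ?case using assms(1) by blast
next
  case (const c)
  show ?case by (rule bexI[of _ "\<lambda>u. 0"]) (auto intro: generated_algebra.const)
next
  case (add g h)
  then obtain g' h' where "g' \<in> generated_algebra G" "h' \<in> generated_algebra G"
      "\<forall>u. (g has_real_derivative g' u) (at u)" "\<forall>u. (h has_real_derivative h' u) (at u)"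
    by blast
  then show ?case
    by (intro bexI[of _ "\<lambda>u. g' u + h' u"]) (auto intro!: derivative_eq_intros generated_algebra.add)
next
  case (mult g h)
  then obtain g' h' where "g' \<in> generated_algebra G" "h' \<in> generated_algebra G"
      "\<forall>u. (g has_real_derivative g' u) (at u)" "\<forall>u. (h has_real_derivative h' u) (at u)"
    by blast
  then show ?case
    using mult.hyps
    by (intro bexI[of _ "\<lambda>u. g' u * h u + h' u * g u"])
      (auto intro!: derivative_eq_intros generated_algebra.add generated_algebra.mult)
qed

lemma smooth_planar_curve:
  assumes G: "\<And>g. g \<in> G \<Longrightarrow> \<exists>g'\<in>generated_algebra G. \<forall>u. (g has_real_derivative g' u) (at u)"
    and "f' \<in> generated_algebra G" and "g' \<in> generated_algebra G"
    and f: "\<And>u. (f has_real_derivative f' u) (at u)" and g: "\<And>u. (g has_real_derivative g' u) (at u)"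
  shows "smooth (\<lambda>u. c + f u *\<^sub>R l + g u *\<^sub>R n :: 'b::real_normed_vector)"
proof -
  let ?F = "{\<lambda>u. c + f u *\<^sub>R l + g u *\<^sub>R n | c f g.
      (\<exists>f'\<in>generated_algebra G. \<forall>u. (f has_real_derivative f' u) (at u)) \<and>
      (\<exists>g'\<in>generated_algebra G. \<forall>u. (g has_real_derivative g' u) (at u))} :: (real \<Rightarrow> 'b) set"
  show ?thesis
  proof (rule smooth_if_closed_under_derivatives[of ?F])
    fix h assume "h \<in> ?F"
    then obtain c f g f' g' where h: "h = (\<lambda>u. c + f u *\<^sub>R l + g u *\<^sub>R n)"
      and f'g': "f' \<in> generated_algebra G" "g' \<in> generated_algebra G"
      and d: "\<And>u. (f has_real_derivative f' u) (at u)" "\<And>u. (g has_real_derivative g' u) (at u)"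
      by blast
    show "\<exists>h'\<in>?F. \<forall>u. (h has_vector_derivative h' u) (at u)"
    proof (rule bexI[of _ "\<lambda>u. 0 + f' u *\<^sub>R l + g' u *\<^sub>R n"])
      show "\<forall>u. (h has_vector_derivative 0 + f' u *\<^sub>R l + g' u *\<^sub>R n) (at u)"
        unfolding h by (auto intro!: derivative_eq_intros d)
      show "(\<lambda>u. 0 + f' u *\<^sub>R l + g' u *\<^sub>R n) \<in> ?F"
        using generated_algebra_deriv[OF G f'g'(1)] generated_algebra_deriv[OF G f'g'(2)] by blast
    qed
  next
    fix h :: "real \<Rightarrow> 'b" and k :: real assume "h \<in> ?F"
    then obtain c f g f' g' where h: "h = (\<lambda>u. c + f u *\<^sub>R l + g u *\<^sub>R n)"
      and f'g': "f' \<in> generated_algebra G" "g' \<in> generated_algebra G"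
      and d: "\<And>u. (f has_real_derivative f' u) (at u)" "\<And>u. (g has_real_derivative g' u) (at u)"
      by blast
    have "(\<lambda>u. k *\<^sub>R h u) = (\<lambda>u. k *\<^sub>R c + (k * f u) *\<^sub>R l + (k * g u) *\<^sub>R n)"
      by (simp add: h scaleR_add_right)
    moreover have "\<exists>f'\<in>generated_algebra G. \<forall>u. ((\<lambda>u. k * f u) has_real_derivative f' u) (at u)"
      by (rule bexI[OF _ generated_algebra.mult[OF generated_algebra.const[of k] f'g'(1)]])
        (auto intro!: derivative_eq_intros d)
    moreover have "\<exists>g'\<in>generated_algebra G. \<forall>u. ((\<lambda>u. k * g u) has_real_derivative g' u) (at u)"
      by (rule bexI[OF _ generated_algebra.mult[OF generated_algebra.const[of k] f'g'(2)]])
        (auto intro!: derivative_eq_intros d)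
    ultimately show "(\<lambda>u. k *\<^sub>R h u) \<in> ?F"
      by (intro CollectI exI[of _ "k *\<^sub>R c"] exI[of _ "\<lambda>u. k * f u"] exI[of _ "\<lambda>u. k * g u"] conjI)
  next
    show "(\<lambda>u. c + f u *\<^sub>R l + g u *\<^sub>R n) \<in> ?F"
      using assms by blast
  qed
qed

lemma has_vector_derivative_planar:
  assumes "(f has_real_derivative f') (at u)" and "(g has_real_derivative g') (at u)"
  shows "((\<lambda>u. f u *\<^sub>R l + g u *\<^sub>R n) has_vector_derivative f' *\<^sub>R l + g' *\<^sub>R n) (at u)"
  by (auto intro!: derivative_eq_intros assms)

lemma not_collinear_triangular:
  fixes l n :: "'a::real_inner"
  assumes "norm l = 1" "norm n = 1" "l \<bullet> n = 0" and "X \<noteq> 0" and "Z \<noteq> 0"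
  shows "\<not> collinear {0, X *\<^sub>R n, Z *\<^sub>R l + Y *\<^sub>R n}"
proof
  assume "collinear {0, X *\<^sub>R n, Z *\<^sub>R l + Y *\<^sub>R n}"
  then consider "X *\<^sub>R n = 0" | "Z *\<^sub>R l + Y *\<^sub>R n = 0" | k where "Z *\<^sub>R l + Y *\<^sub>R n = k *\<^sub>R (X *\<^sub>R n)"
    unfolding collinear_lemma by blast
  moreover have "l \<bullet> l = 1" using assms(1) by (simp add: norm_eq_1)
  moreover have "n \<noteq> 0" using assms(2) by auto
  ultimately show False
  proof cases
    case 2
    then have "l \<bullet> (Z *\<^sub>R l + Y *\<^sub>R n) = 0" by simp
    then show ?thesis using assms \<open>l \<bullet> l = 1\<close> by (simp add: inner_right_distrib)
  next
    case 3
    then have "l \<bullet> (Z *\<^sub>R l + Y *\<^sub>R n) = l \<bullet> (k *\<^sub>R (X *\<^sub>R n))" by simp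
    then show ?thesis using assms \<open>l \<bullet> l = 1\<close> by (simp add: inner_right_distrib)
  qed (use assms in auto)
qed

text \<open>At a simple zero of \<open>s\<close> the radial component \<open>\<rho>\<close> vanishes to second order and the axial component
\<open>\<zeta>\<close> to third order. So the second derivative of the curve is a nonzero multiple of \<open>n\<close>, while the third one
has the nonzero component \<open>2 s'\<^sup>2 b\<close> along \<open>l\<close>.\<close>

lemma ordinary_cusp_planar:
  fixes l n c :: "real^3"
  assumes ln: "norm l = 1" "norm n = 1" "l \<bullet> n = 0"
    and d\<rho>: "\<And>u. (\<rho> has_real_derivative s u * a u) (at u)"
    and d\<zeta>: "\<And>u. (\<zeta> has_real_derivative (s u)\<^sup>2 * b u) (at u)"
    and ds: "\<And>u. (s has_real_derivative s' u) (at u)" "\<And>u. (s' has_real_derivative s'' u) (at u)"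
    and da: "\<And>u. (a has_real_derivative a' u) (at u)" "\<And>u. (a' has_real_derivative a'' u) (at u)"
    and db: "\<And>u. (b has_real_derivative b' u) (at u)" "\<And>u. (b' has_real_derivative b'' u) (at u)"
    and nz: "\<And>u. s u = 0 \<Longrightarrow> s' u \<noteq> 0" "\<And>u. s u = 0 \<Longrightarrow> a u \<noteq> 0" "\<And>u. b u \<noteq> 0"
    and crit: "curve_deriv 1 (\<lambda>u. c + \<zeta> u *\<^sub>R l + \<rho> u *\<^sub>R n) u = 0"
  shows "ordinary_cusp (\<lambda>u. c + \<zeta> u *\<^sub>R l + \<rho> u *\<^sub>R n) u"
proof -
  let ?\<gamma> = "\<lambda>u. c + \<zeta> u *\<^sub>R l + \<rho> u *\<^sub>R n"
  have 1: "curve_deriv 1 ?\<gamma> = (\<lambda>u. ((s u)\<^sup>2 * b u) *\<^sub>R l + (s u * a u) *\<^sub>R n)"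
    unfolding curve_deriv_def
    by (auto intro!: ext vector_derivative_at derivative_eq_intros d\<rho> d\<zeta>)
  have "curve_deriv 2 ?\<gamma> = (\<lambda>u. vector_derivative (curve_deriv 1 ?\<gamma>) (at u))"
    unfolding curve_deriv_def by (simp add: numeral_2_eq_2)
  also have "\<dots> = (\<lambda>u. (2 * s u * s' u * b u + (s u)\<^sup>2 * b' u) *\<^sub>R l + (s' u * a u + s u * a' u) *\<^sub>R n)"
    unfolding 1
    by (auto intro!: ext vector_derivative_at derivative_eq_intros ds da db simp: algebra_simps)
  finally have 2: "curve_deriv 2 ?\<gamma> = (\<lambda>u. (2 * s u * s' u * b u + (s u)\<^sup>2 * b' u) *\<^sub>R l + (s' u * a u + s u * a' u) *\<^sub>R n)" .
  have "curve_deriv 3 ?\<gamma> u = vector_derivative (curve_deriv 2 ?\<gamma>) (at u)" for u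
    unfolding curve_deriv_def by (simp add: numeral_2_eq_2 numeral_3_eq_3)
  also have "vector_derivative (curve_deriv 2 ?\<gamma>) (at u) =
      (2 * (s' u)\<^sup>2 * b u + s u * (2 * s'' u * b u + 4 * s' u * b' u + s u * b'' u)) *\<^sub>R l +
      (s'' u * a u + 2 * s' u * a' u + s u * a'' u) *\<^sub>R n" for u
    unfolding 2
  proof (rule vector_derivative_at)
    have "((\<lambda>u. 2 * s u * s' u * b u + (s u)\<^sup>2 * b' u) has_real_derivative
        2 * (s' u)\<^sup>2 * b u + s u * (2 * s'' u * b u + 4 * s' u * b' u + s u * b'' u)) (at u)"
      by (auto intro!: derivative_eq_intros ds da db simp: algebra_simps power2_eq_square)
    moreover have "((\<lambda>u. s' u * a u + s u * a' u) has_real_derivative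
        s'' u * a u + 2 * s' u * a' u + s u * a'' u) (at u)"
      by (auto intro!: derivative_eq_intros ds da db simp: algebra_simps)
    ultimately show "((\<lambda>u. (2 * s u * s' u * b u + (s u)\<^sup>2 * b' u) *\<^sub>R l + (s' u * a u + s u * a' u) *\<^sub>R n)
        has_vector_derivative
        (2 * (s' u)\<^sup>2 * b u + s u * (2 * s'' u * b u + 4 * s' u * b' u + s u * b'' u)) *\<^sub>R l +
        (s'' u * a u + 2 * s' u * a' u + s u * a'' u) *\<^sub>R n) (at u)"
      by (rule has_vector_derivative_planar)
  qed
  finally have 3: "curve_deriv 3 ?\<gamma> u =
      (2 * (s' u)\<^sup>2 * b u + s u * (2 * s'' u * b u + 4 * s' u * b' u + s u * b'' u)) *\<^sub>R l +
      (s'' u * a u + 2 * s' u * a' u + s u * a'' u) *\<^sub>R n" .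
  have "l \<bullet> l = 1" using ln(1) by (simp add: norm_eq_1)
  then have "(s u)\<^sup>2 * b u = l \<bullet> curve_deriv 1 ?\<gamma> u"
    using ln unfolding 1 by (simp add: inner_right_distrib)
  then have s0: "s u = 0"
    using crit nz(3)[of u] by simp
  have "\<not> collinear {0, (s' u * a u) *\<^sub>R n, (2 * (s' u)\<^sup>2 * b u) *\<^sub>R l + (s'' u * a u + 2 * s' u * a' u) *\<^sub>R n}"
    by (rule not_collinear_triangular[OF ln]) (use nz[of u] s0 in auto)
  then show ?thesis
    using crit unfolding ordinary_cusp_def 2 3 by (simp add: s0)
qed

text \<open>A semicubical cusp satisfies \<open>(\<Delta>\<rho>)\<^sup>3 \<approx> C (\<Delta>\<zeta>)\<^sup>2\<close> with a constant \<open>C\<close> that does not depend on the parametrization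
of the curve. Symmetries of the curve need only be continuous in the parameter, so
the constant is expressed as a limit of quotients and not through derivatives.\<close>

lemma cusp_ratio_limit:
  fixes \<rho> \<zeta> s a b :: "real \<Rightarrow> real"
  assumes d\<rho>: "\<And>u. (\<rho> has_real_derivative s u * a u) (at u)"
    and d\<zeta>: "\<And>u. (\<zeta> has_real_derivative (s u)\<^sup>2 * b u) (at u)"
    and ds: "(s has_real_derivative s') (at x)"
    and cont: "isCont a x" "isCont b x"
    and nz: "s x = 0" "s' \<noteq> 0" "b x \<noteq> 0"
  shows "((\<lambda>u. (\<rho> u - \<rho> x) ^ 3 / (\<zeta> u - \<zeta> x)\<^sup>2) \<longlongrightarrow> 9 * a x ^ 3 / (8 * s' * (b x)\<^sup>2)) (at x)"
proof -
  have quot: "((\<lambda>u. s u / (u - x)) \<longlongrightarrow> s') (at x)"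
    using ds nz(1) by (simp add: has_field_derivative_iff)
  have ne: "\<forall>\<^sub>F u in at x. u \<noteq> x"
    by (simp add: eventually_at_filter)
  have A: "((\<lambda>u. (\<rho> u - \<rho> x) / (u - x)\<^sup>2) \<longlongrightarrow> s' * a x / 2) (at x)"
  proof (rule lhopital)
    show "((\<lambda>u. \<rho> u - \<rho> x) \<longlongrightarrow> 0) (at x)"
      using DERIV_isCont[OF d\<rho>[of x]] by (simp add: isCont_def LIM_zero)
    show "((\<lambda>u. (u - x)\<^sup>2) \<longlongrightarrow> 0) (at x)"
      by (auto intro!: tendsto_eq_intros)
    show "\<forall>\<^sub>F u in at x. (u - x)\<^sup>2 \<noteq> 0" "\<forall>\<^sub>F u in at x. 2 * (u - x) \<noteq> 0"
      using ne by (auto elim!: eventually_mono)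
    show "\<forall>\<^sub>F u in at x. ((\<lambda>u. \<rho> u - \<rho> x) has_real_derivative s u * a u) (at u)"
      by (auto intro!: always_eventually derivative_eq_intros d\<rho>)
    show "\<forall>\<^sub>F u in at x. ((\<lambda>u. (u - x)\<^sup>2) has_real_derivative 2 * (u - x)) (at u)"
      by (auto intro!: always_eventually derivative_eq_intros)
    have "((\<lambda>u. s u / (u - x) * a u / 2) \<longlongrightarrow> s' * a x / 2) (at x)"
      using cont(1) by (intro tendsto_intros quot) (auto simp: isCont_def)
    then show "((\<lambda>u. s u * a u / (2 * (u - x))) \<longlongrightarrow> s' * a x / 2) (at x)"
      by (simp add: field_simps)
  qed
  have B: "((\<lambda>u. (\<zeta> u - \<zeta> x) / (u - x) ^ 3) \<longlongrightarrow> s'\<^sup>2 * b x / 3) (at x)"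
  proof (rule lhopital)
    show "((\<lambda>u. \<zeta> u - \<zeta> x) \<longlongrightarrow> 0) (at x)"
      using DERIV_isCont[OF d\<zeta>[of x]] by (simp add: isCont_def LIM_zero)
    show "((\<lambda>u. (u - x) ^ 3) \<longlongrightarrow> 0) (at x)"
      by (auto intro!: tendsto_eq_intros)
    show "\<forall>\<^sub>F u in at x. (u - x) ^ 3 \<noteq> 0" "\<forall>\<^sub>F u in at x. 3 * (u - x)\<^sup>2 \<noteq> 0"
      using ne by (auto elim!: eventually_mono)
    show "\<forall>\<^sub>F u in at x. ((\<lambda>u. \<zeta> u - \<zeta> x) has_real_derivative (s u)\<^sup>2 * b u) (at u)"
      by (auto intro!: always_eventually derivative_eq_intros d\<zeta>)
    show "\<forall>\<^sub>F u in at x. ((\<lambda>u. (u - x) ^ 3) has_real_derivative 3 * (u - x)\<^sup>2) (at u)"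
      by (auto intro!: always_eventually derivative_eq_intros)
    have "((\<lambda>u. (s u / (u - x))\<^sup>2 * b u / 3) \<longlongrightarrow> s'\<^sup>2 * b x / 3) (at x)"
      using cont(2) by (intro tendsto_intros quot) (auto simp: isCont_def)
    then show "((\<lambda>u. (s u)\<^sup>2 * b u / (3 * (u - x)\<^sup>2)) \<longlongrightarrow> s'\<^sup>2 * b x / 3) (at x)"
      by (simp add: field_simps)
  qed
  have "((\<lambda>u. ((\<rho> u - \<rho> x) / (u - x)\<^sup>2) ^ 3 / ((\<zeta> u - \<zeta> x) / (u - x) ^ 3)\<^sup>2) \<longlongrightarrow>
      (s' * a x / 2) ^ 3 / (s'\<^sup>2 * b x / 3)\<^sup>2) (at x)"
    using nz by (intro tendsto_intros A B) auto
  moreover have "(s' * a x / 2) ^ 3 / (s'\<^sup>2 * b x / 3)\<^sup>2 = 9 * a x ^ 3 / (8 * s' * (b x)\<^sup>2)"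
    using nz by (simp add: field_simps power2_eq_square power3_eq_cube)
  moreover have "\<forall>\<^sub>F u in at x. ((\<rho> u - \<rho> x) / (u - x)\<^sup>2) ^ 3 / ((\<zeta> u - \<zeta> x) / (u - x) ^ 3)\<^sup>2 =
      (\<rho> u - \<rho> x) ^ 3 / (\<zeta> u - \<zeta> x)\<^sup>2"
    using ne by eventually_elim (simp add: power_divide flip: power_mult)
  ultimately show ?thesis
    by (simp add: tendsto_cong)
qed

lemma regular_ratio_limit:
  fixes \<rho> \<zeta> :: "real \<Rightarrow> real"
  assumes d\<rho>: "(\<rho> has_real_derivative \<rho>') (at x)" and d\<zeta>: "(\<zeta> has_real_derivative \<zeta>') (at x)"
    and "\<zeta>' \<noteq> 0"
  shows "((\<lambda>u. (\<rho> u - \<rho> x) ^ 3 / (\<zeta> u - \<zeta> x)\<^sup>2) \<longlongrightarrow> 0) (at x)"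
proof -
  have A: "((\<lambda>u. (\<rho> u - \<rho> x) / (u - x)) \<longlongrightarrow> \<rho>') (at x)" and B: "((\<lambda>u. (\<zeta> u - \<zeta> x) / (u - x)) \<longlongrightarrow> \<zeta>') (at x)"
    using d\<rho> d\<zeta> by (simp_all add: has_field_derivative_iff)
  have C: "((\<lambda>u. \<rho> u - \<rho> x) \<longlongrightarrow> 0) (at x)"
    using DERIV_isCont[OF d\<rho>] by (simp add: isCont_def LIM_zero)
  have "((\<lambda>u. ((\<rho> u - \<rho> x) / (u - x))\<^sup>2 * (\<rho> u - \<rho> x) / ((\<zeta> u - \<zeta> x) / (u - x))\<^sup>2) \<longlongrightarrow> \<rho>'\<^sup>2 * 0 / \<zeta>'\<^sup>2) (at x)"
    using assms(3) by (intro tendsto_intros A B C) auto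
  moreover have "\<forall>\<^sub>F u in at x. u \<noteq> x"
    by (simp add: eventually_at_filter)
  then have "\<forall>\<^sub>F u in at x. ((\<rho> u - \<rho> x) / (u - x))\<^sup>2 * (\<rho> u - \<rho> x) / ((\<zeta> u - \<zeta> x) / (u - x))\<^sup>2 =
      (\<rho> u - \<rho> x) ^ 3 / (\<zeta> u - \<zeta> x)\<^sup>2"
    by eventually_elim (simp add: power_divide power2_eq_square power3_eq_cube)
  ultimately show ?thesis
    by (simp add: tendsto_cong)
qed

section \<open>Symmetries of a periodic planar curve\<close>

lemma orthonormal_triple_expand:
  fixes e1 e2 e3 x :: "real^3"
  assumes "norm e1 = 1" "norm e2 = 1" "norm e3 = 1"
    and "e1 \<bullet> e2 = 0" "e1 \<bullet> e3 = 0" "e2 \<bullet> e3 = 0"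
  shows "x = (x \<bullet> e1) *\<^sub>R e1 + (x \<bullet> e2) *\<^sub>R e2 + (x \<bullet> e3) *\<^sub>R e3"
proof -
  let ?B = "{e1, e2, e3}"
  have ii: "e1 \<bullet> e1 = 1" "e2 \<bullet> e2 = 1" "e3 \<bullet> e3 = 1"
    using assms(1-3) by (simp_all add: norm_eq_1)
  have ne: "e1 \<noteq> e2" "e1 \<noteq> e3" "e2 \<noteq> e3"
    using ii assms(4-6) by auto
  have orth: "pairwise orthogonal ?B"
    using assms(4-6) by (auto simp: pairwise_insert orthogonal_def inner_commute)
  moreover have "0 \<notin> ?B" using ii by auto
  ultimately have ind: "independent ?B"
    by (rule pairwise_orthogonal_independent)
  have "UNIV \<subseteq> span ?B"
    by (rule card_ge_dim_independent[OF _ ind]) (use ne in auto)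
  then have "(\<Sum>i\<in>?B. (x \<bullet> i) *\<^sub>R i) = x"
    by (intro orthonormal_basis_expand orth) (use assms(1-3) in auto)
  then show ?thesis
    using ne by (simp add: add.assoc)
qed

text \<open>Iterating the period and using that \<open>\<rho>\<close> is bounded shows that a symmetry maps the axis direction \<open>l\<close> to a
multiple of itself; since it preserves the orientation of the curve, it fixes \<open>l\<close>. The
curve is not contained in a line parallel to \<open>l\<close>, so \<open>n\<close> goes to \<open>n\<close> or \<open>- n\<close>. In the first case the linear
part, being a rotation, is the identity, and boundedness of \<open>\<rho>\<close> excludes a translation along \<open>n\<close>.\<close>

lemma planar_symmetry_cases:
  fixes l n c :: "real^3" and \<rho> \<zeta> :: "real \<Rightarrow> real"
  assumes ln: "norm l = 1" "norm n = 1" "l \<bullet> n = 0"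
    and mono: "\<And>u v. u < v \<Longrightarrow> 0 < d * (\<zeta> v - \<zeta> u)"
    and bounded: "\<And>u. \<bar>\<rho> u\<bar> \<le> B"
    and "P > 0" and period: "\<And>u. \<rho> (u + P) = \<rho> u" "\<And>u. \<zeta> (u + P) = \<zeta> u + Z"
    and nonconst: "\<rho> x \<noteq> \<rho> y"
    and sym: "g \<in> curve_symmetries (\<lambda>u. c + \<zeta> u *\<^sub>R l + \<rho> u *\<^sub>R n)"
  obtains (translation) a where "g = (\<lambda>x. x + a *\<^sub>R l)"
  | (flip) \<sigma> h k where "strict_mono \<sigma>" and "surj \<sigma>"
      and "\<And>u. \<rho> (\<sigma> u) = h - \<rho> u" and "\<And>u. \<zeta> (\<sigma> u) = \<zeta> u + k"
proof -
  define \<gamma> where "\<gamma> = (\<lambda>u. c + \<zeta> u *\<^sub>R l + \<rho> u *\<^sub>R n)"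
  obtain A b \<sigma> where A: "rotation_matrix A" and g: "g = (\<lambda>x. A *v x + b)"
    and \<sigma>: "strict_mono \<sigma>" "surj \<sigma>" and g\<gamma>: "\<And>u. g (\<gamma> u) = \<gamma> (\<sigma> u)"
    using sym unfolding curve_symmetries_def euclidean_motion_def \<gamma>_def[symmetric]
    by (auto simp: fun_eq_iff)
  define m where "m = cross3 l n"
  have ll: "l \<bullet> l = 1" and nn: "n \<bullet> n = 1" and nl: "n \<bullet> l = 0"
    using ln by (simp_all add: norm_eq_1 inner_commute)
  have lm: "l \<bullet> m = 0" and nm: "n \<bullet> m = 0"
    by (simp_all add: m_def dot_cross_self)
  have "norm m = 1"
    using norm_cross_dot[of l n] ln norm_ge_zero[of m] by (auto simp: m_def power2_eq_1_iff simp del: norm_ge_zero)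
  then have expand: "v = (v \<bullet> l) *\<^sub>R l + (v \<bullet> n) *\<^sub>R n + (v \<bullet> m) *\<^sub>R m" for v
    using orthonormal_triple_expand[of l n m v] ln lm nm by simp
  have orth: "orthogonal_transformation ((*v) A)"
    using A by (simp add: rotation_matrix_def orthogonal_transformation_matrix)
  have A_inner: "(A *v v) \<bullet> (A *v w) = v \<bullet> w" for v w
    using orth by (simp add: orthogonal_transformation_def)
  have diff: "(\<zeta> v - \<zeta> u) *\<^sub>R (A *v l) + (\<rho> v - \<rho> u) *\<^sub>R (A *v n) =
      (\<zeta> (\<sigma> v) - \<zeta> (\<sigma> u)) *\<^sub>R l + (\<rho> (\<sigma> v) - \<rho> (\<sigma> u)) *\<^sub>R n" for u v
  proof -
    have "A *v (\<gamma> v - \<gamma> u) = \<gamma> (\<sigma> v) - \<gamma> (\<sigma> u)"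
      unfolding g\<gamma>[symmetric] g by (simp add: matrix_vector_mult_diff_distrib)
    moreover have "\<gamma> v - \<gamma> u = (\<zeta> v - \<zeta> u) *\<^sub>R l + (\<rho> v - \<rho> u) *\<^sub>R n" for u v
      by (simp add: \<gamma>_def algebra_simps)
    ultimately show ?thesis
      by (simp add: matrix_vector_right_distrib scaleR_matrix_vector_assoc matrix_vector_mult_scaleR)
  qed
  have dl: "(\<zeta> v - \<zeta> u) * ((A *v l) \<bullet> l) + (\<rho> v - \<rho> u) * ((A *v n) \<bullet> l) = \<zeta> (\<sigma> v) - \<zeta> (\<sigma> u)" for u v
    using arg_cong[OF diff[of v u], of "\<lambda>w. w \<bullet> l"] by (simp add: inner_add_left ll nl)
  have dn: "(\<zeta> v - \<zeta> u) * ((A *v l) \<bullet> n) + (\<rho> v - \<rho> u) * ((A *v n) \<bullet> n) = \<rho> (\<sigma> v) - \<rho> (\<sigma> u)" for u v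
    using arg_cong[OF diff[of v u], of "\<lambda>w. w \<bullet> n"] by (simp add: inner_add_left ln nn)
  have dm: "(\<zeta> v - \<zeta> u) * ((A *v l) \<bullet> m) + (\<rho> v - \<rho> u) * ((A *v n) \<bullet> m) = 0" for u v
    using arg_cong[OF diff[of v u], of "\<lambda>w. w \<bullet> m"] by (simp add: inner_add_left lm nm)
  have Z: "0 < d * Z"
    using mono[of 0 P] \<open>P > 0\<close> period(2)[of 0] by simp
  then have "Z \<noteq> 0" by auto
  have iter: "\<rho> (real k * P) = \<rho> 0 \<and> \<zeta> (real k * P) = \<zeta> 0 + real k * Z" for k
  proof (induction k)
    case (Suc k)
    have "real (Suc k) * P = real k * P + P" by (simp add: algebra_simps)
    then show ?case
      unfolding \<open>real (Suc k) * P = real k * P + P\<close> period using Suc by (simp add: algebra_simps)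
  qed simp
  have bounded_multiples: "t = 0" if "\<And>k. \<bar>real k * t\<bar> \<le> 2 * B" for t
  proof (rule ccontr)
    assume "t \<noteq> 0"
    then obtain k where "2 * B < real k * \<bar>t\<bar>"
      using ex_less_of_nat_mult[of "\<bar>t\<bar>" "2 * B"] by auto
    then show False using that[of k] by (simp add: abs_mult)
  qed
  \<comment> \<open>The distance from the axis is bounded, so the image of the period vector has no component along \<open>n\<close>.\<close>
  have "Z * ((A *v l) \<bullet> n) = 0"
  proof (rule bounded_multiples)
    fix k
    have "real k * (Z * ((A *v l) \<bullet> n)) = \<rho> (\<sigma> (real k * P)) - \<rho> (\<sigma> 0)"
      using dn[of "real k * P" 0] iter[of k] by simp
    then show "\<bar>real k * (Z * ((A *v l) \<bullet> n))\<bar> \<le> 2 * B"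
      using bounded[of "\<sigma> (real k * P)"] bounded[of "\<sigma> 0"] by linarith
  qed
  then have An: "(A *v l) \<bullet> n = 0" using \<open>Z \<noteq> 0\<close> by simp
  have "(A *v l) \<bullet> m = 0"
    using dm[of P 0] period(1)[of 0] period(2)[of 0] \<open>Z \<noteq> 0\<close> by simp
  then have Al: "A *v l = ((A *v l) \<bullet> l) *\<^sub>R l"
    using expand[of "A *v l"] An by simp
  have "((A *v l) \<bullet> l)\<^sup>2 = 1"
    using A_inner[of l l] ll Al by (metis inner_scaleR_left inner_scaleR_right mult.right_neutral power2_eq_square)
  moreover have "(A *v l) \<bullet> l > 0"
  proof -
    have "\<sigma> 0 < \<sigma> P" using \<sigma>(1) \<open>P > 0\<close> by (simp add: strict_monoD)
    then have "0 < d * (Z * ((A *v l) \<bullet> l))"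
      using mono[of "\<sigma> 0" "\<sigma> P"] dl[of P 0] period(1)[of 0] period(2)[of 0] by simp
    then have "0 < (d * Z) * ((A *v l) \<bullet> l)" by (simp add: mult.assoc)
    then show ?thesis using Z by (simp only: zero_less_mult_pos)
  qed
  ultimately have "(A *v l) \<bullet> l = 1"
    by (auto simp: power2_eq_1_iff)
  then have Al: "A *v l = l" using Al by simp
  have An_l: "(A *v n) \<bullet> l = 0"
    using A_inner[of n l] Al nl by simp
  have "(A *v n) \<bullet> m = 0"
    using dm[of x y] nonconst Al lm by simp
  then have An: "A *v n = ((A *v n) \<bullet> n) *\<^sub>R n"
    using expand[of "A *v n"] An_l by simp
  have "((A *v n) \<bullet> n)\<^sup>2 = 1"
    using A_inner[of n n] nn An by (metis inner_scaleR_left inner_scaleR_right mult.right_neutral power2_eq_square)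
  then consider "(A *v n) \<bullet> n = 1" | "(A *v n) \<bullet> n = -1"
    by (auto simp: power2_eq_1_iff)
  then show ?thesis
  proof cases
    case 1
    then have An: "A *v n = n" using An by simp
    have Am: "A *v m = m"
      using cross_rotation_matrix[OF A, of l n] Al An by (simp add: m_def)
    have "A *v v = v" for v
    proof -
      have "A *v v = A *v ((v \<bullet> l) *\<^sub>R l + (v \<bullet> n) *\<^sub>R n + (v \<bullet> m) *\<^sub>R m)"
        using expand[of v] by simp
      also have "\<dots> = (v \<bullet> l) *\<^sub>R l + (v \<bullet> n) *\<^sub>R n + (v \<bullet> m) *\<^sub>R m"
        by (simp add: matrix_vector_right_distrib matrix_vector_mult_scaleR Al An Am)
      finally show ?thesis using expand[of v] by simp
    qed
    then have g: "g = (\<lambda>x. x + b)" by (simp add: g)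
    have b: "b = (\<zeta> (\<sigma> u) - \<zeta> u) *\<^sub>R l + (\<rho> (\<sigma> u) - \<rho> u) *\<^sub>R n" for u
      using g\<gamma>[of u] by (simp add: g \<gamma>_def algebra_simps)
    have bn: "\<rho> (\<sigma> u) = \<rho> u + b \<bullet> n" for u
      by (subst b[of u]) (simp add: inner_add_left ln nn)
    \<comment> \<open>Otherwise iterating the symmetry would carry the curve arbitrarily far away from the axis.\<close>
    have "b \<bullet> n = 0"
    proof (rule bounded_multiples)
      fix k
      have "\<rho> ((\<sigma> ^^ k) 0) = \<rho> 0 + real k * (b \<bullet> n)"
        by (induction k) (simp_all add: bn algebra_simps)
      then show "\<bar>real k * (b \<bullet> n)\<bar> \<le> 2 * B"
        using bounded[of "(\<sigma> ^^ k) 0"] bounded[of 0] by linarith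
    qed
    then have "\<rho> (\<sigma> 0) = \<rho> 0" using bn[of 0] by simp
    then have "b = (\<zeta> (\<sigma> 0) - \<zeta> 0) *\<^sub>R l"
      by (subst b[of 0]) simp
    then show ?thesis using g translation by simp
  next
    case 2
    show ?thesis
    proof (rule flip[OF \<sigma>])
      show "\<rho> (\<sigma> u) = (\<rho> (\<sigma> 0) + \<rho> 0) - \<rho> u" for u
        using dn[of u 0] 2 Al ln by (simp add: algebra_simps)
      show "\<zeta> (\<sigma> u) = \<zeta> u + (\<zeta> (\<sigma> 0) - \<zeta> 0)" for u
        using dl[of u 0] by (simp add: An_l Al ll)
    qed
  qed
qed

lemma strict_mono_surj_isCont:
  fixes \<sigma> :: "real \<Rightarrow> real"
  assumes "strict_mono \<sigma>" "surj \<sigma>"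
  shows "isCont \<sigma> x"
proof -
  have "continuous_on UNIV \<sigma>"
    by (rule continuous_onI_mono) (use assms in \<open>auto simp: strict_mono_less_eq\<close>)
  then show ?thesis by (simp add: continuous_on_eq_continuous_at)
qed

text \<open>The ratio limits at \<open>x\<close> and at \<open>\<sigma> x\<close> are limits of the same quotient up to the factor \<open>e\<^sup>3 = e\<close>, because \<open>\<sigma>\<close>
is continuous and injective and thus maps punctured neighbourhoods of \<open>x\<close> into punctured neighbourhoods of \<open>\<sigma> x\<close>.\<close>

lemma ratio_limit_transport:
  fixes \<rho> \<zeta> \<sigma> :: "real \<Rightarrow> real"
  assumes \<sigma>: "strict_mono \<sigma>" "surj \<sigma>" and "e = 1 \<or> e = -1"
    and \<rho>: "\<And>u. \<rho> (\<sigma> u) = h + e * \<rho> u" and \<zeta>: "\<And>u. \<zeta> (\<sigma> u) = \<zeta> u + k"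
    and L: "((\<lambda>u. (\<rho> u - \<rho> x) ^ 3 / (\<zeta> u - \<zeta> x)\<^sup>2) \<longlongrightarrow> L) (at x)"
    and L': "((\<lambda>u. (\<rho> u - \<rho> (\<sigma> x)) ^ 3 / (\<zeta> u - \<zeta> (\<sigma> x))\<^sup>2) \<longlongrightarrow> L') (at (\<sigma> x))"
  shows "L' = e * L"
proof -
  have e: "e ^ 3 = e" using assms(3) by auto
  have lim: "filterlim \<sigma> (at (\<sigma> x)) (at x)"
    using strict_mono_surj_isCont[OF \<sigma>, of x] strict_mono_eq[OF \<sigma>(1)]
    by (auto simp: filterlim_at isCont_def eventually_at_filter)
  have "((\<lambda>u. (\<rho> (\<sigma> u) - \<rho> (\<sigma> x)) ^ 3 / (\<zeta> (\<sigma> u) - \<zeta> (\<sigma> x))\<^sup>2) \<longlongrightarrow> L') (at x)"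
    by (rule filterlim_compose[OF L' lim])
  moreover have "(\<rho> (\<sigma> u) - \<rho> (\<sigma> x)) ^ 3 / (\<zeta> (\<sigma> u) - \<zeta> (\<sigma> x))\<^sup>2 =
      e * ((\<rho> u - \<rho> x) ^ 3 / (\<zeta> u - \<zeta> x)\<^sup>2)" for u
  proof -
    have "\<rho> (\<sigma> u) - \<rho> (\<sigma> x) = e * (\<rho> u - \<rho> x)" "\<zeta> (\<sigma> u) - \<zeta> (\<sigma> x) = \<zeta> u - \<zeta> x"
      by (simp_all add: \<rho> \<zeta> algebra_simps)
    then show ?thesis by (simp only: power_mult_distrib e) simp
  qed
  ultimately have "((\<lambda>u. e * ((\<rho> u - \<rho> x) ^ 3 / (\<zeta> u - \<zeta> x)\<^sup>2)) \<longlongrightarrow> L') (at x)"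
    by simp
  moreover have "((\<lambda>u. e * ((\<rho> u - \<rho> x) ^ 3 / (\<zeta> u - \<zeta> x)\<^sup>2)) \<longlongrightarrow> e * L) (at x)"
    by (intro tendsto_intros L)
  ultimately show ?thesis
    by (rule tendsto_unique[OF at_neq_bot])
qed

lemma eventually_nonzero_if_deriv_nonzero:
  fixes s :: "real \<Rightarrow> real"
  assumes ds: "(s has_real_derivative s') (at x)" and "s x = 0 \<Longrightarrow> s' \<noteq> 0"
  shows "\<forall>\<^sub>F u in at x. s u \<noteq> 0"
proof (cases "s x = 0")
  case True
  then have "((\<lambda>u. s u / (u - x)) \<longlongrightarrow> s') (at x)"
    using ds by (simp add: has_field_derivative_iff)
  then have "\<forall>\<^sub>F u in at x. s u / (u - x) \<noteq> 0"
    by (rule tendsto_imp_eventually_ne) (use True assms(2) in simp)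
  then show ?thesis by (auto elim!: eventually_mono)
next
  case False
  then show ?thesis
    using DERIV_isCont[OF ds] by (auto simp: isCont_def intro: tendsto_imp_eventually_ne)
qed

text \<open>The features of the profile of a helicoid on which its symmetries depend. The curve has a cusp at each zero of
\<open>s\<close>, the axial coordinate is monotone in the direction given by the sign of \<open>d\<close>, and \<open>a\<^sup>3 / (s' b\<^sup>2)\<close> is, up to
the factor \<open>9 / 8\<close>, the ratio limit at a cusp. By the last assumption no cusp
of the curve has the invariant of a mirror image of the cusp at \<open>0\<close>.\<close>

locale cuspidal_profile =
  fixes \<rho> \<zeta> s a b s' :: "real \<Rightarrow> real" and d P Z B :: real
  assumes d\<rho>: "\<And>u. (\<rho> has_real_derivative s u * a u) (at u)"
    and d\<zeta>: "\<And>u. (\<zeta> has_real_derivative (s u)\<^sup>2 * b u) (at u)"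
    and ds: "\<And>u. (s has_real_derivative s' u) (at u)"
    and cont: "\<And>u. isCont a u" "\<And>u. isCont b u"
    and s'_nz: "\<And>u. s u = 0 \<Longrightarrow> s' u \<noteq> 0"
    and a_nz: "\<And>u. s u = 0 \<Longrightarrow> a u \<noteq> 0"
    and b_sign: "\<And>u. 0 < d * b u"
    and P: "0 < P" and period: "\<And>u. \<rho> (u + P) = \<rho> u" "\<And>u. \<zeta> (u + P) = \<zeta> u + Z"
    and bounded: "\<And>u. \<bar>\<rho> u\<bar> \<le> B"
    and cusp: "s 0 = 0"
    and no_flip: "\<And>u. s u = 0 \<Longrightarrow> a u ^ 3 / (s' u * (b u)\<^sup>2) \<noteq> - (a 0 ^ 3 / (s' 0 * (b 0)\<^sup>2))"
begin

lemma b_nz: "b u \<noteq> 0"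
  using b_sign[of u] by auto

lemma eventually_regular: "\<forall>\<^sub>F u in at x. s u \<noteq> 0"
  by (rule eventually_nonzero_if_deriv_nonzero[OF ds s'_nz])

text \<open>The derivative of \<open>d \<zeta>\<close> is nonnegative, and it cannot vanish on an interval because the zeros of \<open>s\<close> are isolated.\<close>

lemma \<zeta>_mono: "0 < d * (\<zeta> v - \<zeta> u)" if "u < v"
proof -
  have dd: "((\<lambda>x. d * \<zeta> x) has_real_derivative d * ((s x)\<^sup>2 * b x)) (at x)" for x
    by (auto intro!: derivative_eq_intros d\<zeta>)
  have nonneg: "0 \<le> d * ((s x)\<^sup>2 * b x)" for x
  proof -
    have "0 \<le> (s x)\<^sup>2 * (d * b x)" by (rule mult_nonneg_nonneg[OF zero_le_power2 less_imp_le[OF b_sign]])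
    then show ?thesis by (simp add: mult.left_commute)
  qed
  have le: "d * \<zeta> x \<le> d * \<zeta> y" if "x \<le> y" for x y
    by (rule DERIV_nonneg_imp_nondecreasing[OF that]) (use dd nonneg in blast)
  have "d * \<zeta> u \<noteq> d * \<zeta> v"
  proof
    assume eq: "d * \<zeta> u = d * \<zeta> v"
    let ?m = "(u + v) / 2"
    have "s x = 0" if "u < x" "x < v" for x
    proof -
      have const: "d * \<zeta> y = d * \<zeta> u" if "u < y" "y < v" for y
        using le[of u y] le[of y v] that eq by linarith
      have "((\<lambda>y. d * \<zeta> u) has_real_derivative d * ((s x)\<^sup>2 * b x)) (at x)"
        by (rule has_field_derivative_transform_within_open[OF dd, of "{u<..<v}"])
          (use that const in auto)
      then have "d * ((s x)\<^sup>2 * b x) = 0"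
        using DERIV_unique DERIV_const by blast
      then show ?thesis using b_sign[of x] by auto
    qed
    then have "\<forall>\<^sub>F x in at ?m. s x = 0"
      using \<open>u < v\<close> by (intro eventually_at_in_open'[of "{u<..<v}", THEN eventually_mono]) auto
    then have "\<forall>\<^sub>F x in at ?m. False"
      using eventually_regular[of ?m] by eventually_elim simp
    then show False by simp
  qed
  then have "d * \<zeta> u < d * \<zeta> v" using le[of u v] \<open>u < v\<close> by linarith
  then show ?thesis by (simp add: right_diff_distrib)
qed

lemma cusp_ratio: "s x = 0 \<Longrightarrow>
    ((\<lambda>u. (\<rho> u - \<rho> x) ^ 3 / (\<zeta> u - \<zeta> x)\<^sup>2) \<longlongrightarrow> 9 / 8 * (a x ^ 3 / (s' x * (b x)\<^sup>2))) (at x)"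
  using cusp_ratio_limit[OF d\<rho> d\<zeta> ds cont, of x] s'_nz b_nz by (simp add: field_simps)

lemma regular_ratio: "s x \<noteq> 0 \<Longrightarrow> ((\<lambda>u. (\<rho> u - \<rho> x) ^ 3 / (\<zeta> u - \<zeta> x)\<^sup>2) \<longlongrightarrow> 0) (at x)"
  using regular_ratio_limit[OF d\<rho> d\<zeta>, of x] b_nz by simp

lemma cusp_invariant_nz: "a 0 ^ 3 / (s' 0 * (b 0)\<^sup>2) \<noteq> 0"
  using a_nz s'_nz b_nz cusp by simp

text \<open>The ratio limit is zero at regular points and nonzero at cusps, so the image of the cusp at \<open>0\<close> is again a cusp,
with the same invariant up to the sign \<open>e\<close>.\<close>

lemma cusp_to_cusp:
  assumes "strict_mono \<sigma>" "surj \<sigma>" "e = 1 \<or> e = -1"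
    and "\<And>u. \<rho> (\<sigma> u) = h + e * \<rho> u" and "\<And>u. \<zeta> (\<sigma> u) = \<zeta> u + k"
  shows "s (\<sigma> 0) = 0"
    and "a (\<sigma> 0) ^ 3 / (s' (\<sigma> 0) * (b (\<sigma> 0))\<^sup>2) = e * (a 0 ^ 3 / (s' 0 * (b 0)\<^sup>2))"
proof -
  note transport = ratio_limit_transport[OF assms cusp_ratio[OF cusp]]
  show *: "s (\<sigma> 0) = 0"
  proof (rule ccontr)
    assume "s (\<sigma> 0) \<noteq> 0"
    have cancel: "0 = e * (9 / 8 * y) \<Longrightarrow> y = 0" for y :: real using assms(3) by auto
    show False
      using cancel[OF transport[OF regular_ratio[OF \<open>s (\<sigma> 0) \<noteq> 0\<close>]]] cusp_invariant_nz by contradiction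
  qed
  show "a (\<sigma> 0) ^ 3 / (s' (\<sigma> 0) * (b (\<sigma> 0))\<^sup>2) = e * (a 0 ^ 3 / (s' 0 * (b 0)\<^sup>2))"
      proof -
    have cancel: "9 / 8 * x = e * (9 / 8 * y) \<Longrightarrow> x = e * y" for x y :: real by simp
    show ?thesis by (rule cancel[OF transport[OF cusp_ratio[OF *]]])
  qed
qed

lemma nonconstant: "\<exists>x. \<rho> x \<noteq> \<rho> 0"
proof (rule ccontr)
  assume "\<nexists>x. \<rho> x \<noteq> \<rho> 0"
  then have "\<rho> u = \<rho> 0" for u by blast
  then have "(\<lambda>u. (\<rho> u - \<rho> 0) ^ 3 / (\<zeta> u - \<zeta> 0)\<^sup>2) = (\<lambda>u. 0)"
    by (simp add: fun_eq_iff) 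
  with cusp_ratio[OF cusp]
  have "((\<lambda>u::real. 0::real) \<longlongrightarrow> 9 / 8 * (a 0 ^ 3 / (s' 0 * (b 0)\<^sup>2))) (at 0)"
    by (simp only:)
  from tendsto_unique[OF at_neq_bot this tendsto_const] show False
    using cusp_invariant_nz by simp
qed

text \<open>Flips are excluded by the invariants of the cusps. The admissible translations form a group, and it is
discrete because the cusp at \<open>0\<close> must move to another cusp, while cusps are isolated and the
height is strictly monotone.\<close>

lemma symmetries_are_translations:
  fixes l n c :: "real^3"
  assumes ln: "norm l = 1" "norm n = 1" "l \<bullet> n = 0"
  shows "discrete_nontrivial_translation_group l (curve_symmetries (\<lambda>u. c + \<zeta> u *\<^sub>R l + \<rho> u *\<^sub>R n))"
proof -
  let ?\<gamma> = "\<lambda>u. c + \<zeta> u *\<^sub>R l + \<rho> u *\<^sub>R n"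
  let ?shift = "\<lambda>t \<sigma>. strict_mono \<sigma> \<and> surj \<sigma> \<and> (\<forall>u. \<rho> (\<sigma> u) = \<rho> u) \<and> (\<forall>u. \<zeta> (\<sigma> u) = \<zeta> u + t)"
  define A where "A = {t. \<exists>\<sigma>. ?shift t \<sigma>}"
  have ll: "l \<bullet> l = 1" "n \<bullet> n = 1" "n \<bullet> l = 0"
    using ln by (simp_all add: norm_eq_1 inner_commute)
  have shift_iff: "(\<lambda>x. x + t *\<^sub>R l) \<circ> ?\<gamma> = ?\<gamma> \<circ> \<sigma> \<longleftrightarrow>
      (\<forall>u. \<rho> (\<sigma> u) = \<rho> u) \<and> (\<forall>u. \<zeta> (\<sigma> u) = \<zeta> u + t)" for t \<sigma>
  proof
    assume eq: "(\<lambda>x. x + t *\<^sub>R l) \<circ> ?\<gamma> = ?\<gamma> \<circ> \<sigma>"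
    have eq: "?\<gamma> u + t *\<^sub>R l - c = ?\<gamma> (\<sigma> u) - c" for u
      using fun_cong[OF eq, of u] by simp
    show "(\<forall>u. \<rho> (\<sigma> u) = \<rho> u) \<and> (\<forall>u. \<zeta> (\<sigma> u) = \<zeta> u + t)"
      using arg_cong[OF eq, of "\<lambda>x. x \<bullet> l"] arg_cong[OF eq, of "\<lambda>x. x \<bullet> n"] ll ln(3)
      by (simp add: inner_add_left)
  qed (auto simp: fun_eq_iff algebra_simps)
  have motion: "euclidean_motion (\<lambda>x. x + t *\<^sub>R l)" for t
    unfolding euclidean_motion_def
    by (rule exI[of _ "mat 1"]) (auto simp: rotation_matrix_def orthogonal_matrix_id)
  have "curve_symmetries ?\<gamma> = (\<lambda>t x. x + t *\<^sub>R l) ` A"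
  proof (intro equalityI subsetI)
    fix g assume g: "g \<in> curve_symmetries ?\<gamma>"
    obtain y where y: "\<rho> y \<noteq> \<rho> 0" using nonconstant by blast
    show "g \<in> (\<lambda>t x. x + t *\<^sub>R l) ` A"
    proof (rule planar_symmetry_cases[OF ln \<zeta>_mono bounded P period y g])
      fix t assume "g = (\<lambda>x. x + t *\<^sub>R l)"
      then show ?thesis
        using g shift_iff unfolding curve_symmetries_def A_def by blast
    next
      fix \<sigma> h k
      assume \<sigma>: "strict_mono \<sigma>" "surj \<sigma>" "\<And>u. \<rho> (\<sigma> u) = h - \<rho> u" "\<And>u. \<zeta> (\<sigma> u) = \<zeta> u + k"
      have "s (\<sigma> 0) = 0" "a (\<sigma> 0) ^ 3 / (s' (\<sigma> 0) * (b (\<sigma> 0))\<^sup>2) = -1 * (a 0 ^ 3 / (s' 0 * (b 0)\<^sup>2))"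
        using cusp_to_cusp[of \<sigma> "-1" h k] \<sigma> by simp_all
      then show ?thesis using no_flip by simp
    qed
  next
    fix g assume "g \<in> (\<lambda>t x. x + t *\<^sub>R l) ` A"
    then show "g \<in> curve_symmetries ?\<gamma>"
      using motion shift_iff unfolding curve_symmetries_def A_def by blast
  qed
  moreover have "0 \<in> A"
    unfolding A_def by (auto intro!: exI[of _ "\<lambda>x. x"] simp: strict_mono_def surj_def)
  moreover have diff: "x - y \<in> A" if xy: "x \<in> A" "y \<in> A" for x y
  proof -
    obtain \<sigma> \<tau> where \<sigma>: "?shift x \<sigma>" and \<tau>: "?shift y \<tau>"
      using xy by (auto simp: A_def)
    have inv: "\<tau> (inv \<tau> u) = u" for u
      using \<tau> by (simp add: surj_f_inv_f)
    have inv': "inv \<tau> (\<tau> u) = u" for u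
      using \<tau> by (simp add: strict_mono_imp_inj_on)
    have \<rho>\<zeta>: "\<rho> (inv \<tau> u) = \<rho> u" "\<zeta> (inv \<tau> u) = \<zeta> u - y" for u
    proof -
      have "\<rho> (\<tau> (inv \<tau> u)) = \<rho> (inv \<tau> u)" "\<zeta> (\<tau> (inv \<tau> u)) = \<zeta> (inv \<tau> u) + y"
        using \<tau> by blast+
      then show "\<rho> (inv \<tau> u) = \<rho> u" "\<zeta> (inv \<tau> u) = \<zeta> u - y" by (simp_all add: inv)
    qed
    have "strict_mono (inv \<tau>)"
      using \<tau> inv by (metis strict_mono_def strict_mono_less)
    then have "strict_mono (\<sigma> \<circ> inv \<tau>)"
      using \<sigma> by (simp add: strict_mono_def)
    moreover have "surj (\<sigma> \<circ> inv \<tau>)"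
    proof (rule comp_surj)
      show "surj (inv \<tau>)" using inv' by (rule surjI)
    qed (use \<sigma> in blast)
    moreover have "\<rho> ((\<sigma> \<circ> inv \<tau>) u) = \<rho> u" "\<zeta> ((\<sigma> \<circ> inv \<tau>) u) = \<zeta> u + (x - y)" for u
      using \<sigma> \<rho>\<zeta> by simp_all
    ultimately show ?thesis
      unfolding A_def by blast
  qed
  moreover have "discrete A"
  proof -
    obtain \<delta> where \<delta>: "\<delta> > 0" "\<And>u. u \<noteq> 0 \<Longrightarrow> \<bar>u\<bar> \<le> \<delta> \<Longrightarrow> s u \<noteq> 0"
      using eventually_regular[of 0] by (auto simp: eventually_at_le dist_real_def)
    have gap: "t = 0" if t: "t \<in> A" and small: "\<bar>d * t\<bar> < min (d * (\<zeta> \<delta> - \<zeta> 0)) (d * (\<zeta> 0 - \<zeta> (- \<delta>)))" for t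
    proof -
      obtain \<sigma> where \<sigma>: "?shift t \<sigma>" using t by (auto simp: A_def)
      then have zero: "s (\<sigma> 0) = 0"
        using cusp_to_cusp(1)[of \<sigma> 1 0 t] by simp
      have eq: "\<zeta> (\<sigma> 0) = \<zeta> 0 + t" using \<sigma> by blast
      have "\<not> \<delta> < \<sigma> 0"
        using \<zeta>_mono[of \<delta> "\<sigma> 0"] small eq by (auto simp: algebra_simps)
      moreover have "\<not> \<sigma> 0 < - \<delta>"
        using \<zeta>_mono[of "\<sigma> 0" "- \<delta>"] small eq by (auto simp: algebra_simps)
      ultimately have "\<bar>\<sigma> 0\<bar> \<le> \<delta>" by linarith
      then have "\<sigma> 0 = 0"
        using \<delta>(2)[of "\<sigma> 0"] zero by blast
      then show "t = 0" using eq by simp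
    qed
    define e where "e = min (d * (\<zeta> \<delta> - \<zeta> 0)) (d * (\<zeta> 0 - \<zeta> (- \<delta>))) / \<bar>d\<bar>"
    have "d \<noteq> 0" using b_sign by auto
    have "e > 0"
      using \<open>\<delta> > 0\<close> \<zeta>_mono[of 0 \<delta>] \<zeta>_mono[of "- \<delta>" 0] \<open>d \<noteq> 0\<close> by (simp add: e_def)
    have "x = y" if "x \<in> A" "y \<in> A" "dist x y < e" for x y
    proof -
      have "\<bar>d * (x - y)\<bar> < e * \<bar>d\<bar>"
        using that(3) \<open>d \<noteq> 0\<close> by (simp add: dist_real_def abs_mult mult.commute)
      then show ?thesis
        using gap[OF diff[OF that(1,2)]] \<open>d \<noteq> 0\<close> by (simp add: e_def)
    qed
    then show ?thesis
      using \<open>e > 0\<close> uniformI1 uniform_discrete_imp_discrete by blast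
  qed
  moreover have "A \<noteq> {0}"
  proof -
    have "?shift Z (\<lambda>u. u + P)"
      using period by (auto simp: strict_mono_def surj_def intro: exI[of _ "y - P" for y])
    then have "Z \<in> A" unfolding A_def by blast
    moreover have "Z \<noteq> 0"
      using \<zeta>_mono[OF P] period(2)[of 0] by auto
    ultimately show ?thesis by blast
  qed
  ultimately show ?thesis
    unfolding discrete_nontrivial_translation_group_def by blast
qed

lemma inj_profile:
  fixes l n c :: "real^3"
  assumes ln: "norm l = 1" "l \<bullet> n = 0"
  shows "inj (\<lambda>u. c + \<zeta> u *\<^sub>R l + \<rho> u *\<^sub>R n)"
proof (rule injI)
  fix u v assume "c + \<zeta> u *\<^sub>R l + \<rho> u *\<^sub>R n = c + \<zeta> v *\<^sub>R l + \<rho> v *\<^sub>R n"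
  then have "l \<bullet> (\<zeta> u *\<^sub>R l + \<rho> u *\<^sub>R n) = l \<bullet> (\<zeta> v *\<^sub>R l + \<rho> v *\<^sub>R n)"
    by (simp add: add.assoc)
  then have "\<zeta> u = \<zeta> v"
    using ln(2) ln(1)[unfolded norm_eq_1] by (simp only: inner_right_distrib inner_scaleR_right)
  then show "u = v"
    using \<zeta>_mono[of u v] \<zeta>_mono[of v u] by (cases u v rule: linorder_cases) auto
qed

end

section \<open>The profile curve\<close>

text \<open>At a zero of \<open>sin \<theta> cos \<theta>\<close> the first integral leaves \<open>\<omega>\<^sup>2 = 1\<close> or \<open>\<omega>\<^sup>2 = 1 - \<mu>\<close>, so the velocity does not vanish
for \<open>\<mu> \<noteq> 1\<close> and the zero is simple. These zeros are the cusps of the profile, and they are also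
the places where the parametrization of the surface degenerates.\<close>

lemma pendulum_nondegenerate:
  assumes "pendulum_solution \<mu> \<theta> \<omega>" and "\<mu> \<noteq> 1" and "sin (\<theta> u) * cos (\<theta> u) = 0"
  shows "\<omega> u \<noteq> 0" and "((cos (\<theta> u))\<^sup>2 - (sin (\<theta> u))\<^sup>2) * \<omega> u \<noteq> 0"
proof -
  have "(sin (\<theta> u))\<^sup>2 = 0 \<and> (cos (\<theta> u))\<^sup>2 = 1 \<or> (sin (\<theta> u))\<^sup>2 = 1 \<and> (cos (\<theta> u))\<^sup>2 = 0"
  proof (cases "sin (\<theta> u) = 0")
    case True
    then show ?thesis using sin_cos_squared_add[of "\<theta> u"] by simp
  next
    case False
    then have "cos (\<theta> u) = 0" using assms(3) by simp
    then show ?thesis using sin_cos_squared_add[of "\<theta> u"] by simp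
  qed
  moreover from this have "(\<omega> u)\<^sup>2 \<noteq> 0"
    using pendulum_first_integral[OF assms(1), of u] assms(2) by auto
  then show "\<omega> u \<noteq> 0" by simp
  ultimately show "((cos (\<theta> u))\<^sup>2 - (sin (\<theta> u))\<^sup>2) * \<omega> u \<noteq> 0" by auto
qed

text \<open>The two branches of the definition of the travelling wave differ only in the values of \<open>\<alpha>\<close> and \<open>\<beta>\<close>, which are
\<open>cosh r / sqrt \<bar>\<mu>\<bar>\<close> and \<open>sinh r / sqrt \<bar>\<mu>\<bar>\<close> for \<open>\<mu> < 0\<close> and the other way round for \<open>\<mu> > 0\<close>. In both cases they
do not vanish for \<open>r \<noteq> 0\<close>, and \<open>\<alpha>\<^sup>2 - \<beta>\<^sup>2 = - 1 / \<mu>\<close>.\<close>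

locale pendulum_wave =
  fixes \<mu> \<alpha> \<beta> :: real and \<theta> \<omega> :: "real \<Rightarrow> real"
  assumes sol: "pendulum_solution \<mu> \<theta> \<omega>" and \<mu>: "\<mu> \<noteq> 0" "\<mu> \<noteq> 1"
    and \<alpha>\<beta>: "\<alpha> \<noteq> 0" "\<beta> \<noteq> 0" "\<alpha>\<^sup>2 - \<beta>\<^sup>2 = - (1 / \<mu>)"
begin

text \<open>Here \<open>\<kappa>\<close> is the angular speed of the orthonormal frame along the direction \<open>(\<beta>, - \<alpha>)\<close>, and \<open>Q / \<kappa>\<^sup>4\<close> is the square of the distance from
the screw axis. The pair \<open>(\<rho>, \<zeta>)\<close> consists of the distance from the axis and the height along the profile.\<close>

definition "\<epsilon> = - (1 / \<mu>)"
definition "\<kappa> = sqrt (\<alpha>\<^sup>2 + \<epsilon>\<^sup>2)"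
definition "Q u = \<epsilon>\<^sup>2 * \<beta>\<^sup>2 + \<epsilon> * \<kappa>\<^sup>2 * (sin (\<theta> u))\<^sup>2"
definition "\<nu> u = 1 / sqrt (Q u)"
definition "\<rho> u = sqrt (Q u) / \<kappa>\<^sup>2"
definition "\<zeta> = (SOME G. G 0 = 0 \<and>
  (\<forall>u. (G has_real_derivative (sin (\<theta> u) * cos (\<theta> u))\<^sup>2 * (\<epsilon> * \<kappa> * (\<nu> u)\<^sup>2)) (at u)))"

lemma \<theta>_deriv: "(\<theta> has_real_derivative \<omega> u) (at u)"
  and \<omega>_deriv: "(\<omega> has_real_derivative - \<mu> * sin (\<theta> u) * cos (\<theta> u)) (at u)"
  using sol by (simp_all add: pendulum_solution_def)

lemma sin_cos_deriv:
  "((\<lambda>u. sin (\<theta> u) * cos (\<theta> u)) has_real_derivative ((cos (\<theta> u))\<^sup>2 - (sin (\<theta> u))\<^sup>2) * \<omega> u) (at u)"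
  by (auto intro!: derivative_eq_intros \<theta>_deriv simp: algebra_simps power2_eq_square)

lemma \<epsilon>_nz: "\<epsilon> \<noteq> 0" and \<mu>_\<epsilon>: "\<mu> * \<epsilon> = - 1" and \<alpha>_sq: "\<alpha>\<^sup>2 = \<beta>\<^sup>2 + \<epsilon>"
  using \<mu>(1) \<alpha>\<beta>(3) by (simp_all add: \<epsilon>_def)

lemma \<kappa>_pos: "\<kappa> > 0" and \<kappa>_sq: "\<kappa>\<^sup>2 = \<alpha>\<^sup>2 + \<epsilon>\<^sup>2"
proof -
  have "\<alpha>\<^sup>2 + \<epsilon>\<^sup>2 > 0" using \<alpha>\<beta>(1) by (simp add: add_pos_nonneg)
  then show "\<kappa> > 0" and "\<kappa>\<^sup>2 = \<alpha>\<^sup>2 + \<epsilon>\<^sup>2" by (simp_all add: \<kappa>_def)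
qed

lemma first_integral: "(\<omega> u)\<^sup>2 = 1 - \<mu> * (sin (\<theta> u))\<^sup>2"
  by (rule pendulum_first_integral[OF sol])

text \<open>Multiplying by \<open>\<mu>\<^sup>2\<close> turns \<open>Q\<close> into a combination of \<open>cos\<^sup>2 \<theta>\<close> and \<open>sin\<^sup>2 \<theta>\<close> with visible signs.\<close>

lemma Q_alt: "\<mu>\<^sup>2 * Q u = \<beta>\<^sup>2 * (cos (\<theta> u))\<^sup>2 + \<alpha>\<^sup>2 * ((1 - \<mu>) * (sin (\<theta> u))\<^sup>2)"
  unfolding Q_def using \<mu>_\<epsilon> \<alpha>_sq \<kappa>_sq sin_cos_squared_add[of "\<theta> u"] by algebra

text \<open>For \<open>\<mu> < 1\<close> both summands in \<open>Q_alt\<close> are nonnegative and do not vanish together. For \<open>\<mu> > 1\<close> the amplitude is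
confined to \<open>\<mu> sin\<^sup>2 \<theta> \<le> 1\<close>, so the negative summand is at least \<open>- \<alpha>\<^sup>2 cos\<^sup>2 \<theta>\<close>, and \<open>\<alpha>\<^sup>2 < \<beta>\<^sup>2\<close>.\<close>

lemma Q_pos: "Q u > 0"
proof -
  let ?s = "(sin (\<theta> u))\<^sup>2" and ?c = "(cos (\<theta> u))\<^sup>2"
  have sum: "?s + ?c = 1" by simp
  have "\<mu>\<^sup>2 * Q u > 0"
  proof (cases "\<mu> < 1")
    case True
    show ?thesis
    proof (cases "cos (\<theta> u) = 0")
      case True
      then have "?s = 1" using sum by simp
      then show ?thesis
        unfolding Q_alt using True \<open>\<mu> < 1\<close> \<alpha>\<beta>(1) by simp
    next
      case False
      then have "\<beta>\<^sup>2 * ?c > 0" using \<alpha>\<beta>(2) by simp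
      moreover have "\<alpha>\<^sup>2 * ((1 - \<mu>) * ?s) \<ge> 0" using True by simp
      ultimately show ?thesis unfolding Q_alt by linarith
    qed
  next
    case False
    then have gt: "\<mu> > 1" using \<mu> by simp
    have le: "\<mu> * ?s \<le> 1" using first_integral[of u] zero_le_power2[of "\<omega> u"] by linarith
    have "?c > 0"
    proof (rule ccontr)
      assume "\<not> ?c > 0"
      then have "?c = 0" by simp
      then show False using le sum gt by simp
    qed
    have "(1 - \<mu>) * ?s \<ge> - ?c" using le sum by (simp add: algebra_simps)
    then have "\<alpha>\<^sup>2 * ((1 - \<mu>) * ?s) \<ge> \<alpha>\<^sup>2 * (- ?c)" by (rule mult_left_mono) simp
    then have "\<mu>\<^sup>2 * Q u \<ge> (\<beta>\<^sup>2 - \<alpha>\<^sup>2) * ?c" unfolding Q_alt by (simp add: algebra_simps)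
    moreover have "(\<beta>\<^sup>2 - \<alpha>\<^sup>2) * ?c > 0"
    proof -
      have "\<beta>\<^sup>2 - \<alpha>\<^sup>2 = 1 / \<mu>" using \<alpha>\<beta>(3) by simp
      then show ?thesis using gt \<open>?c > 0\<close> by simp
    qed
    ultimately show ?thesis by linarith
  qed
  then show ?thesis using \<mu>(1) by (simp add: zero_less_mult_iff)
qed

lemma \<nu>_pos: "\<nu> u > 0" and \<nu>_sq: "(\<nu> u)\<^sup>2 * Q u = 1"
  using Q_pos[of u] by (simp_all add: \<nu>_def power_divide)

lemma \<rho>_eq: "\<rho> u = Q u * \<nu> u / \<kappa>\<^sup>2" and \<rho>_pos: "\<rho> u > 0"
  using Q_pos[of u] \<kappa>_pos by (simp_all add: \<rho>_def \<nu>_def real_div_sqrt)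

lemma Q_deriv: "(Q has_real_derivative 2 * \<epsilon> * \<kappa>\<^sup>2 * sin (\<theta> u) * cos (\<theta> u) * \<omega> u) (at u)"
  unfolding Q_def[abs_def] by (auto intro!: derivative_eq_intros \<theta>_deriv simp: power2_eq_square)

lemma sqrt_Q_deriv: "((\<lambda>u. sqrt (Q u)) has_real_derivative \<epsilon> * \<kappa>\<^sup>2 * sin (\<theta> u) * cos (\<theta> u) * \<omega> u * \<nu> u) (at u)"
proof -
  have deriv: "((\<lambda>u. sqrt (Q u)) has_real_derivative
      inverse (sqrt (Q u)) / 2 * (2 * \<epsilon> * \<kappa>\<^sup>2 * sin (\<theta> u) * cos (\<theta> u) * \<omega> u)) (at u)"
    by (rule DERIV_chain2[OF DERIV_real_sqrt[OF Q_pos] Q_deriv])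
  have eq: "inverse (sqrt (Q u)) / 2 * (2 * \<epsilon> * \<kappa>\<^sup>2 * sin (\<theta> u) * cos (\<theta> u) * \<omega> u) =
      \<epsilon> * \<kappa>\<^sup>2 * sin (\<theta> u) * cos (\<theta> u) * \<omega> u * \<nu> u"
    by (simp add: \<nu>_def inverse_eq_divide)
  show ?thesis by (rule DERIV_cong[OF deriv eq])
qed

lemma \<nu>_deriv: "(\<nu> has_real_derivative - \<epsilon> * \<kappa>\<^sup>2 * sin (\<theta> u) * cos (\<theta> u) * \<omega> u * \<nu> u ^ 3) (at u)"
proof -
  have deriv: "((\<lambda>u. inverse (sqrt (Q u))) has_real_derivative
      - (inverse (sqrt (Q u)) * (\<epsilon> * \<kappa>\<^sup>2 * sin (\<theta> u) * cos (\<theta> u) * \<omega> u * \<nu> u) * inverse (sqrt (Q u)))) (at u)"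
    by (rule DERIV_inverse'[OF sqrt_Q_deriv]) (use Q_pos[of u] in simp)
  have eq: "- (inverse (sqrt (Q u)) * (\<epsilon> * \<kappa>\<^sup>2 * sin (\<theta> u) * cos (\<theta> u) * \<omega> u * \<nu> u) * inverse (sqrt (Q u))) =
      - \<epsilon> * \<kappa>\<^sup>2 * sin (\<theta> u) * cos (\<theta> u) * \<omega> u * \<nu> u ^ 3"
    by (simp add: \<nu>_def inverse_eq_divide power3_eq_cube)
  have \<nu>_inv: "\<nu> = (\<lambda>u. inverse (sqrt (Q u)))"
    by (simp add: \<nu>_def fun_eq_iff inverse_eq_divide)
  show ?thesis by (rule DERIV_cong[OF deriv[folded \<nu>_inv] eq])
qed

lemma \<rho>_deriv: "(\<rho> has_real_derivative sin (\<theta> u) * cos (\<theta> u) * (\<epsilon> * \<omega> u * \<nu> u)) (at u)"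
proof -
  have "(\<rho> has_real_derivative (\<epsilon> * \<kappa>\<^sup>2 * sin (\<theta> u) * cos (\<theta> u) * \<omega> u * \<nu> u) / \<kappa>\<^sup>2) (at u)"
    unfolding \<rho>_def[abs_def] by (rule DERIV_cdivide[OF sqrt_Q_deriv])
  moreover have "(\<epsilon> * \<kappa>\<^sup>2 * sin (\<theta> u) * cos (\<theta> u) * \<omega> u * \<nu> u) / \<kappa>\<^sup>2 = sin (\<theta> u) * cos (\<theta> u) * (\<epsilon> * \<omega> u * \<nu> u)"
    using \<kappa>_pos by simp
  ultimately show ?thesis by simp
qed

lemma isCont_parts: "isCont \<theta> u" "isCont \<omega> u" "isCont \<nu> u"
  using DERIV_isCont \<theta>_deriv \<omega>_deriv \<nu>_deriv by blast+

lemma \<zeta>_0: "\<zeta> 0 = 0"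
  and \<zeta>_deriv: "(\<zeta> has_real_derivative (sin (\<theta> u) * cos (\<theta> u))\<^sup>2 * (\<epsilon> * \<kappa> * (\<nu> u)\<^sup>2)) (at u)"
proof -
  have "isCont (\<lambda>u. (sin (\<theta> u) * cos (\<theta> u))\<^sup>2 * (\<epsilon> * \<kappa> * (\<nu> u)\<^sup>2)) u" for u
    by (intro continuous_intros isCont_parts isCont_sin' isCont_cos')
  then have "\<exists>G. G 0 = 0 \<and>
      (\<forall>u. (G has_real_derivative (sin (\<theta> u) * cos (\<theta> u))\<^sup>2 * (\<epsilon> * \<kappa> * (\<nu> u)\<^sup>2)) (at u))"
    using global_antiderivative[of "\<lambda>u. (sin (\<theta> u) * cos (\<theta> u))\<^sup>2 * (\<epsilon> * \<kappa> * (\<nu> u)\<^sup>2)"] by blast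
  from someI_ex[OF this] show "\<zeta> 0 = 0"
    and "(\<zeta> has_real_derivative (sin (\<theta> u) * cos (\<theta> u))\<^sup>2 * (\<epsilon> * \<kappa> * (\<nu> u)\<^sup>2)) (at u)"
    unfolding \<zeta>_def by blast+
qed

text \<open>The cusps at \<open>cos \<theta> = 0\<close> are not congruent to those at \<open>sin \<theta> = 0\<close>. After clearing denominators, congruence would
mean \<open>(1 - \<mu>)\<^sup>3 \<alpha>\<^sup>2 = \<beta>\<^sup>2\<close>, but for \<open>\<mu> < 0\<close> the left-hand side is too large, and for \<open>0 < \<mu> < 1\<close> it is too small.\<close>

lemma cusps_not_congruent: "(1 - \<mu>)\<^sup>2 * (\<epsilon>\<^sup>2 * \<beta>\<^sup>2 + \<epsilon> * \<kappa>\<^sup>2) \<noteq> \<epsilon>\<^sup>2 * \<beta>\<^sup>2" if "\<mu> < 1"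
proof
  assume "(1 - \<mu>)\<^sup>2 * (\<epsilon>\<^sup>2 * \<beta>\<^sup>2 + \<epsilon> * \<kappa>\<^sup>2) = \<epsilon>\<^sup>2 * \<beta>\<^sup>2"
  then have eq: "(1 - \<mu>) ^ 3 * \<alpha>\<^sup>2 = \<beta>\<^sup>2"
    using \<mu>_\<epsilon> \<alpha>_sq \<kappa>_sq by algebra
  show False
  proof (cases "\<mu> < 0")
    case True
    then have "\<beta>\<^sup>2 < \<alpha>\<^sup>2" using \<alpha>_sq by (simp add: \<epsilon>_def)
    also have "1 * \<alpha>\<^sup>2 \<le> (1 - \<mu>) ^ 3 * \<alpha>\<^sup>2"
      using True by (intro mult_right_mono one_le_power) auto
    finally show False using eq by simp
  next
    case False
    then have "0 < \<mu>" using \<mu>(1) by simp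
    then have "\<alpha>\<^sup>2 < \<beta>\<^sup>2" using \<alpha>_sq by (simp add: \<epsilon>_def)
    moreover have "(1 - \<mu>) ^ 3 * \<alpha>\<^sup>2 \<le> 1 * \<alpha>\<^sup>2"
      using \<open>0 < \<mu>\<close> that by (intro mult_right_mono power_le_one) auto
    ultimately show False using eq by simp
  qed
qed

abbreviation "cusp_invariant u \<equiv>
  (\<epsilon> * \<omega> u * \<nu> u) ^ 3 / (((cos (\<theta> u))\<^sup>2 - (sin (\<theta> u))\<^sup>2) * \<omega> u * (\<epsilon> * \<kappa> * (\<nu> u)\<^sup>2)\<^sup>2)"

lemma cusp_invariant_at_cusp:
  assumes "sin (\<theta> u) * cos (\<theta> u) = 0"
  shows "cusp_invariant u = \<epsilon> / \<kappa>\<^sup>2 * ((\<omega> u)\<^sup>2 / (((cos (\<theta> u))\<^sup>2 - (sin (\<theta> u))\<^sup>2) * \<nu> u))"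
  using pendulum_nondegenerate[OF sol \<mu>(2) assms] \<nu>_pos[of u] \<kappa>_pos \<epsilon>_nz
  by (simp add: field_simps power2_eq_square power3_eq_cube)

text \<open>The invariant of a cusp has the sign of \<open>\<epsilon> (cos\<^sup>2 \<theta> - sin\<^sup>2 \<theta>)\<close>, so only a cusp with \<open>cos \<theta> = 0\<close> could be the mirror
image of the one at \<open>0\<close>. Such a cusp exists only for \<open>\<mu> < 1\<close>, and then its size differs.\<close>

lemma no_flip:
  assumes cusp: "sin (\<theta> u) * cos (\<theta> u) = 0"
  shows "cusp_invariant u \<noteq> - cusp_invariant 0"
proof
  assume eq: "cusp_invariant u = - cusp_invariant 0"
  have \<theta>0: "\<theta> 0 = 0" and \<omega>0: "\<omega> 0 = 1" using sol by (simp_all add: pendulum_solution_def)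
  have "\<epsilon> / \<kappa>\<^sup>2 * ((\<omega> u)\<^sup>2 / (((cos (\<theta> u))\<^sup>2 - (sin (\<theta> u))\<^sup>2) * \<nu> u)) = \<epsilon> / \<kappa>\<^sup>2 * (- (1 / \<nu> 0))"
    using eq cusp_invariant_at_cusp[OF cusp] cusp_invariant_at_cusp[of 0] \<theta>0 \<omega>0 by simp
  then have eq: "(\<omega> u)\<^sup>2 / (((cos (\<theta> u))\<^sup>2 - (sin (\<theta> u))\<^sup>2) * \<nu> u) = - (1 / \<nu> 0)"
    using \<epsilon>_nz \<kappa>_pos by (simp only: mult_cancel_left) auto
  show False
  proof (cases "sin (\<theta> u) = 0")
    case True
    then have "(cos (\<theta> u))\<^sup>2 = 1" using sin_cos_squared_add[of "\<theta> u"] by simp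
    then have "(\<omega> u)\<^sup>2 / (((cos (\<theta> u))\<^sup>2 - (sin (\<theta> u))\<^sup>2) * \<nu> u) = 1 / \<nu> u"
      using first_integral[of u] True by simp
    moreover have "1 / \<nu> u > 0" "1 / \<nu> 0 > 0" using \<nu>_pos by simp_all
    ultimately show False using eq by linarith
  next
    case False
    then have cos0: "cos (\<theta> u) = 0" using cusp by simp
    then have sin1: "(sin (\<theta> u))\<^sup>2 = 1" using sin_cos_squared_add[of "\<theta> u"] by simp
    then have \<omega>2: "(\<omega> u)\<^sup>2 = 1 - \<mu>" using first_integral[of u] by simp
    then have "1 - \<mu> \<ge> 0" by (metis zero_le_power2)
    then have "\<mu> < 1" using \<mu>(2) by simp
    have "(1 - \<mu>) * \<nu> 0 = \<nu> u"
      using eq \<nu>_pos[of u] \<nu>_pos[of 0] by (simp add: cos0 sin1 \<omega>2 field_simps)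
    then have "((1 - \<mu>) * \<nu> 0)\<^sup>2 * Q u = (\<nu> 0)\<^sup>2 * Q 0"
      by (simp add: \<nu>_sq)
    then have "(\<nu> 0)\<^sup>2 * ((1 - \<mu>)\<^sup>2 * Q u) = (\<nu> 0)\<^sup>2 * Q 0"
      by (simp only: power_mult_distrib mult_ac)
    then have "(1 - \<mu>)\<^sup>2 * Q u = Q 0"
      using \<nu>_pos[of 0] by (simp only: mult_cancel_left) auto
    then show False
      using cusps_not_congruent[OF \<open>\<mu> < 1\<close>] by (simp add: Q_def sin1 \<theta>0)
  qed
qed

lemma \<rho>_bounded: "\<bar>\<rho> u\<bar> \<le> sqrt (\<epsilon>\<^sup>2 * \<beta>\<^sup>2 + \<bar>\<epsilon>\<bar> * \<kappa>\<^sup>2) / \<kappa>\<^sup>2"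
proof -
  have "\<bar>\<epsilon> * (sin (\<theta> u))\<^sup>2\<bar> \<le> \<bar>\<epsilon>\<bar> * 1"
    unfolding abs_mult by (intro mult_left_mono) (auto simp: abs_square_le_1)
  then have "\<epsilon> * (sin (\<theta> u))\<^sup>2 \<le> \<bar>\<epsilon>\<bar> * 1" by linarith
  then have "\<epsilon> * (sin (\<theta> u))\<^sup>2 * \<kappa>\<^sup>2 \<le> \<bar>\<epsilon>\<bar> * 1 * \<kappa>\<^sup>2"
    by (rule mult_right_mono) simp
  then have "Q u \<le> \<epsilon>\<^sup>2 * \<beta>\<^sup>2 + \<bar>\<epsilon>\<bar> * \<kappa>\<^sup>2"
    by (simp add: Q_def algebra_simps)
  then show ?thesis
    unfolding \<rho>_def using Q_pos[of u] by (simp add: divide_right_mono)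
qed

lemma cuspidal_profile:
  assumes "P > 0" and period: "\<And>u. (sin (\<theta> (u + P)))\<^sup>2 = (sin (\<theta> u))\<^sup>2"
  shows "cuspidal_profile \<rho> \<zeta> (\<lambda>u. sin (\<theta> u) * cos (\<theta> u)) (\<lambda>u. \<epsilon> * \<omega> u * \<nu> u) (\<lambda>u. \<epsilon> * \<kappa> * (\<nu> u)\<^sup>2)
    (\<lambda>u. ((cos (\<theta> u))\<^sup>2 - (sin (\<theta> u))\<^sup>2) * \<omega> u) \<epsilon> P (\<zeta> P) (sqrt (\<epsilon>\<^sup>2 * \<beta>\<^sup>2 + \<bar>\<epsilon>\<bar> * \<kappa>\<^sup>2) / \<kappa>\<^sup>2)"
proof
  have Q_period: "Q (u + P) = Q u" for u
    by (simp add: Q_def period)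
  show "\<rho> (u + P) = \<rho> u" for u
    by (simp add: \<rho>_def Q_period)
  show "\<zeta> (u + P) = \<zeta> u + \<zeta> P" for u
  proof -
    have slope: "(sin (\<theta> (u + P)) * cos (\<theta> (u + P)))\<^sup>2 * (\<epsilon> * \<kappa> * (\<nu> (u + P))\<^sup>2) =
        (sin (\<theta> u) * cos (\<theta> u))\<^sup>2 * (\<epsilon> * \<kappa> * (\<nu> u)\<^sup>2)" for u
      by (simp add: power_mult_distrib cos_squared_eq period \<nu>_def Q_period)
    have "((\<lambda>u. \<zeta> (u + P) - \<zeta> u) has_real_derivative 0) (at u)" for u
    proof -
      have "((\<lambda>u. \<zeta> (u + P)) has_real_derivative (sin (\<theta> u) * cos (\<theta> u))\<^sup>2 * (\<epsilon> * \<kappa> * (\<nu> u)\<^sup>2)) (at u)"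
        using \<zeta>_deriv[of "u + P"] unfolding slope DERIV_shift .
      from DERIV_diff[OF this \<zeta>_deriv[of u]] show ?thesis by simp
    qed
    then have "\<zeta> (u + P) - \<zeta> u = \<zeta> (0 + P) - \<zeta> 0"
      by (intro DERIV_isconst_all) auto
    then show ?thesis by (simp add: \<zeta>_0)
  qed
  show "0 < \<epsilon> * (\<epsilon> * \<kappa> * (\<nu> u)\<^sup>2)" for u
  proof -
    have "0 < \<epsilon>\<^sup>2 * (\<kappa> * (\<nu> u)\<^sup>2)"
      using \<epsilon>_nz \<kappa>_pos \<nu>_pos[of u] by simp
    then show ?thesis by (simp add: power2_eq_square mult.assoc)
  qed
  show "sin (\<theta> 0) * cos (\<theta> 0) = 0"
    using sol by (simp add: pendulum_solution_def)
  show "isCont (\<lambda>u. \<epsilon> * \<omega> u * \<nu> u) u" "isCont (\<lambda>u. \<epsilon> * \<kappa> * (\<nu> u)\<^sup>2) u" for u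
    by (intro continuous_intros isCont_parts)+
  show "\<epsilon> * \<omega> u * \<nu> u \<noteq> 0" if "sin (\<theta> u) * cos (\<theta> u) = 0" for u
    using pendulum_nondegenerate(1)[OF sol \<mu>(2) that] \<epsilon>_nz \<nu>_pos[of u] by simp
qed (rule \<rho>_deriv \<zeta>_deriv sin_cos_deriv pendulum_nondegenerate(2)[OF sol \<mu>(2)] no_flip \<rho>_bounded assms; assumption)+

definition "coefficients = {\<lambda>u. sin (\<theta> u), \<lambda>u. cos (\<theta> u), \<omega>, \<nu>}"

lemma coefficients_in_algebra:
  "(\<lambda>u. sin (\<theta> u)) \<in> generated_algebra coefficients" "(\<lambda>u. cos (\<theta> u)) \<in> generated_algebra coefficients"
  "(\<lambda>u. \<omega> u) \<in> generated_algebra coefficients" "(\<lambda>u. \<nu> u) \<in> generated_algebra coefficients"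
  by (auto simp: coefficients_def intro: generated_algebra.gen)

lemmas algebra_intros = coefficients_in_algebra generated_algebra.const generated_algebra.mult
  generated_algebra.add generated_algebra_power

lemma coefficients_deriv:
  assumes "g \<in> coefficients"
  shows "\<exists>g'\<in>generated_algebra coefficients. \<forall>u. (g has_real_derivative g' u) (at u)"
proof -
  have trig: "\<forall>u. ((\<lambda>u. sin (\<theta> u)) has_real_derivative cos (\<theta> u) * \<omega> u) (at u)"
    "\<forall>u. ((\<lambda>u. cos (\<theta> u)) has_real_derivative (-1) * (sin (\<theta> u) * \<omega> u)) (at u)"
    by (auto intro!: derivative_eq_intros \<theta>_deriv)
  have other: "\<forall>u. (\<omega> has_real_derivative - \<mu> * sin (\<theta> u) * cos (\<theta> u)) (at u)"
    "\<forall>u. (\<nu> has_real_derivative - \<epsilon> * \<kappa>\<^sup>2 * sin (\<theta> u) * cos (\<theta> u) * \<omega> u * \<nu> u ^ 3) (at u)"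
    using \<omega>_deriv \<nu>_deriv by blast+
  have mem: "(\<lambda>u. cos (\<theta> u) * \<omega> u) \<in> generated_algebra coefficients"
    "(\<lambda>u. (-1) * (sin (\<theta> u) * \<omega> u)) \<in> generated_algebra coefficients"
    "(\<lambda>u. - \<mu> * sin (\<theta> u) * cos (\<theta> u)) \<in> generated_algebra coefficients"
    "(\<lambda>u. - \<epsilon> * \<kappa>\<^sup>2 * sin (\<theta> u) * cos (\<theta> u) * \<omega> u * \<nu> u ^ 3) \<in> generated_algebra coefficients"
    by (intro algebra_intros)+
  have bexI: "\<forall>u. (g has_real_derivative g' u) (at u) \<Longrightarrow> g' \<in> A \<Longrightarrow>
      \<exists>g'\<in>A. \<forall>u. (g has_real_derivative g' u) (at u)" for g g' :: "real \<Rightarrow> real" and A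
    by blast
  consider "g = (\<lambda>u. sin (\<theta> u))" | "g = (\<lambda>u. cos (\<theta> u))" | "g = \<omega>" | "g = \<nu>"
    using assms unfolding coefficients_def by blast
  then show ?thesis
    using bexI[OF trig(1) mem(1)] bexI[OF trig(2) mem(2)] bexI[OF other(1) mem(3)] bexI[OF other(2) mem(4)]
    by cases simp_all
qed

lemma two_derivatives:
  assumes "g \<in> generated_algebra coefficients"
  obtains g' g'' where "\<And>u. (g has_real_derivative g' u) (at u)" "\<And>u. (g' has_real_derivative g'' u) (at u)"
  using generated_algebra_deriv[OF coefficients_deriv] assms by metis

lemma simple_cuspidal_profile:
  fixes l n c :: "real^3"
  assumes "P > 0" and period: "\<And>u. (sin (\<theta> (u + P)))\<^sup>2 = (sin (\<theta> u))\<^sup>2"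
    and ln: "norm l = 1" "norm n = 1" "l \<bullet> n = 0"
  shows "simple_cuspidal_curve (\<lambda>u. c + \<zeta> u *\<^sub>R l + \<rho> u *\<^sub>R n)"
proof -
  interpret cuspidal_profile \<rho> \<zeta> "\<lambda>u. sin (\<theta> u) * cos (\<theta> u)" "\<lambda>u. \<epsilon> * \<omega> u * \<nu> u" "\<lambda>u. \<epsilon> * \<kappa> * (\<nu> u)\<^sup>2"
    "\<lambda>u. ((cos (\<theta> u))\<^sup>2 - (sin (\<theta> u))\<^sup>2) * \<omega> u" \<epsilon> P "\<zeta> P" "sqrt (\<epsilon>\<^sup>2 * \<beta>\<^sup>2 + \<bar>\<epsilon>\<bar> * \<kappa>\<^sup>2) / \<kappa>\<^sup>2"
    by (rule cuspidal_profile[OF assms(1,2)])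
  have "(\<lambda>u. ((cos (\<theta> u))\<^sup>2 + (-1) * (sin (\<theta> u))\<^sup>2) * \<omega> u) \<in> generated_algebra coefficients"
    by (intro algebra_intros)
  then have alg: "(\<lambda>u. ((cos (\<theta> u))\<^sup>2 - (sin (\<theta> u))\<^sup>2) * \<omega> u) \<in> generated_algebra coefficients"
    "(\<lambda>u. \<epsilon> * \<omega> u * \<nu> u) \<in> generated_algebra coefficients"
    "(\<lambda>u. \<epsilon> * \<kappa> * (\<nu> u)\<^sup>2) \<in> generated_algebra coefficients"
    by (simp, intro algebra_intros, intro algebra_intros)
  obtain s'' s''' where s: "\<And>u. ((\<lambda>u. ((cos (\<theta> u))\<^sup>2 - (sin (\<theta> u))\<^sup>2) * \<omega> u) has_real_derivative s'' u) (at u)"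
      "\<And>u. (s'' has_real_derivative s''' u) (at u)"
    using two_derivatives[OF alg(1)] by blast
  obtain a' a'' where a: "\<And>u. ((\<lambda>u. \<epsilon> * \<omega> u * \<nu> u) has_real_derivative a' u) (at u)"
      "\<And>u. (a' has_real_derivative a'' u) (at u)"
    using two_derivatives[OF alg(2)] by blast
  obtain b' b'' where b: "\<And>u. ((\<lambda>u. \<epsilon> * \<kappa> * (\<nu> u)\<^sup>2) has_real_derivative b' u) (at u)"
      "\<And>u. (b' has_real_derivative b'' u) (at u)"
    using two_derivatives[OF alg(3)] by blast
  have "smooth (\<lambda>u. c + \<zeta> u *\<^sub>R l + \<rho> u *\<^sub>R n)"
    by (rule smooth_planar_curve[OF coefficients_deriv _ _ \<zeta>_deriv \<rho>_deriv]) (assumption | intro algebra_intros)+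
  moreover have "inj (\<lambda>u. c + \<zeta> u *\<^sub>R l + \<rho> u *\<^sub>R n)"
    by (rule inj_profile[OF ln(1,3)])
  moreover have "ordinary_cusp (\<lambda>u. c + \<zeta> u *\<^sub>R l + \<rho> u *\<^sub>R n) u"
    if "curve_deriv 1 (\<lambda>u. c + \<zeta> u *\<^sub>R l + \<rho> u *\<^sub>R n) u = 0" for u
    by (rule ordinary_cusp_planar[OF ln \<rho>_deriv \<zeta>_deriv sin_cos_deriv s(1) a b s'_nz a_nz b_nz that])
  ultimately show ?thesis
    unfolding simple_cuspidal_curve_def by blast
qed

lemma profile_symmetries:
  fixes l n c :: "real^3"
  assumes "P > 0" and period: "\<And>u. (sin (\<theta> (u + P)))\<^sup>2 = (sin (\<theta> u))\<^sup>2"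
    and ln: "norm l = 1" "norm n = 1" "l \<bullet> n = 0"
  shows "discrete_nontrivial_translation_group l (curve_symmetries (\<lambda>u. c + \<zeta> u *\<^sub>R l + \<rho> u *\<^sub>R n))"
proof -
  interpret cuspidal_profile \<rho> \<zeta> "\<lambda>u. sin (\<theta> u) * cos (\<theta> u)" "\<lambda>u. \<epsilon> * \<omega> u * \<nu> u" "\<lambda>u. \<epsilon> * \<kappa> * (\<nu> u)\<^sup>2"
    "\<lambda>u. ((cos (\<theta> u))\<^sup>2 - (sin (\<theta> u))\<^sup>2) * \<omega> u" \<epsilon> P "\<zeta> P" "sqrt (\<epsilon>\<^sup>2 * \<beta>\<^sup>2 + \<bar>\<epsilon>\<bar> * \<kappa>\<^sup>2) / \<kappa>\<^sup>2"
    by (rule cuspidal_profile[OF assms(1,2)])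
  show ?thesis by (rule symmetries_are_translations[OF ln])
qed

end

section \<open>The frame equations\<close>

lemma smooth_directional_derivative:
  "smooth f \<Longrightarrow> smooth (\<lambda>z. frechet_derivative f (at z) v)"
  unfolding smooth_def using C_k.simps(2) by blast

lemma smooth_has_derivative:
  "smooth f \<Longrightarrow> (f has_derivative frechet_derivative f (at z)) (at z)"
  unfolding smooth_def frechet_derivative_works[symmetric] using C_k.simps(2) by blast

lemma smooth_continuous: "smooth f \<Longrightarrow> continuous_on S f"
  unfolding smooth_def using C_k.simps(1) continuous_on_subset by blast

lemma smooth_along_line:
  assumes "smooth f"
  shows "((\<lambda>x. f (z + x *\<^sub>R v)) has_vector_derivative frechet_derivative f (at (z + x *\<^sub>R v)) v) (at x within S)"
proof -
  have "((\<lambda>x. z + x *\<^sub>R v) has_vector_derivative v) (at x within S)"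
    by (auto intro!: derivative_eq_intros)
  then show ?thesis
    using vector_derivative_diff_chain_within[OF _ has_derivative_at_withinI[OF smooth_has_derivative[OF assms]]]
    by (auto simp: o_def)
qed

lemma frechet_derivative_pair:
  assumes "smooth g"
  shows "frechet_derivative g (at z) (p, q) =
    p *\<^sub>R frechet_derivative g (at z) (1::real, 0::real) + q *\<^sub>R frechet_derivative g (at z) (0, 1)"
proof -
  have lin: "linear (frechet_derivative g (at z))"
    using smooth_has_derivative[OF assms] by (rule has_derivative_linear)
  have "(p, q) = p *\<^sub>R (1, 0) + q *\<^sub>R (0, 1)" by simp
  then show ?thesis by (metis linear_add[OF lin] linear_scale[OF lin])
qed

text \<open>Differentiating under the integral sign gives \<open>D\<^sub>v f (z + h w) - D\<^sub>v f z\<close> as the integral of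
\<open>D\<^sub>v D\<^sub>w f (z + y w)\<close> over \<open>0 \<le> y \<le> h\<close>; now differentiate with respect to \<open>h\<close> at \<open>0\<close>.\<close>

lemma directional_derivatives_commute:
  fixes f :: "'a::euclidean_space \<Rightarrow> 'b::euclidean_space"
  assumes f: "smooth f"
  shows "frechet_derivative (\<lambda>z. frechet_derivative f (at z) v) (at z) w =
         frechet_derivative (\<lambda>z. frechet_derivative f (at z) w) (at z) v"
proof -
  define Dv where "Dv z = frechet_derivative f (at z) v" for z
  define Dw where "Dw z = frechet_derivative f (at z) w" for z
  define Dvw where "Dvw z = frechet_derivative Dw (at z) v" for z
  have smooth: "smooth Dv" "smooth Dw" "smooth Dvw"
    using smooth_directional_derivative[OF f] smooth_directional_derivative[of Dw v]
    by (simp_all add: Dv_def[abs_def] Dw_def[abs_def] Dvw_def[abs_def])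
  have ftc: "((\<lambda>y. Dw (z + x *\<^sub>R v + y *\<^sub>R w)) has_integral f (z + x *\<^sub>R v + h *\<^sub>R w) - f (z + x *\<^sub>R v)) (cbox 0 h)"
    if "0 \<le> h" for x h
    using fundamental_theorem_of_calculus[OF that, of "\<lambda>y. f (z + x *\<^sub>R v + y *\<^sub>R w)"]
      smooth_along_line[OF f, of "z + x *\<^sub>R v" w] by (simp add: Dw_def)
  have increment: "Dv (z + h *\<^sub>R w) - Dv z = integral {0..h} (\<lambda>y. Dvw (z + y *\<^sub>R w))" if "0 \<le> h" for h
  proof -
    have "((\<lambda>x. integral (cbox 0 h) (\<lambda>y. Dw (z + x *\<^sub>R v + y *\<^sub>R w))) has_vector_derivative
        integral (cbox 0 h) (\<lambda>y. Dvw (z + 0 *\<^sub>R v + y *\<^sub>R w))) (at 0 within UNIV)"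
    proof (rule leibniz_rule_vector_derivative)
      show "((\<lambda>x. Dw (z + x *\<^sub>R v + y *\<^sub>R w)) has_vector_derivative Dvw (z + x *\<^sub>R v + y *\<^sub>R w)) (at x within UNIV)" for x y
        using smooth_along_line[OF smooth(2), of "z + y *\<^sub>R w" v x UNIV]
        by (simp add: Dvw_def add.commute add.left_commute)
      show "(\<lambda>y. Dw (z + x *\<^sub>R v + y *\<^sub>R w)) integrable_on cbox 0 h" for x
        using ftc[OF that] by blast
      have "continuous_on (UNIV \<times> cbox 0 h) (\<lambda>p. Dvw (z + fst p *\<^sub>R v + snd p *\<^sub>R w))"
        by (rule continuous_on_compose2[OF smooth_continuous[OF smooth(3), of UNIV]])
          (auto intro!: continuous_intros)
      then show "continuous_on (UNIV \<times> cbox 0 h) (\<lambda>(x, y). Dvw (z + x *\<^sub>R v + y *\<^sub>R w))"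
        by (simp add: split_beta)
    qed auto
    moreover have "integral (cbox 0 h) (\<lambda>y. Dw (z + x *\<^sub>R v + y *\<^sub>R w)) = f (z + x *\<^sub>R v + h *\<^sub>R w) - f (z + x *\<^sub>R v)" for x
      by (rule integral_unique[OF ftc[OF that]])
    ultimately have 1: "((\<lambda>x. f (z + x *\<^sub>R v + h *\<^sub>R w) - f (z + x *\<^sub>R v)) has_vector_derivative
        integral {0..h} (\<lambda>y. Dvw (z + y *\<^sub>R w))) (at 0)"
      by simp
    have "((\<lambda>x. f (z + h *\<^sub>R w + x *\<^sub>R v) - f (z + x *\<^sub>R v)) has_vector_derivative
        Dv (z + h *\<^sub>R w + 0 *\<^sub>R v) - Dv (z + 0 *\<^sub>R v)) (at 0)"
      unfolding Dv_def by (intro has_vector_derivative_diff smooth_along_line f)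
    then have 2: "((\<lambda>x. f (z + x *\<^sub>R v + h *\<^sub>R w) - f (z + x *\<^sub>R v)) has_vector_derivative
        Dv (z + h *\<^sub>R w) - Dv z) (at 0)"
      by (simp add: add.commute add.left_commute)
    show ?thesis by (rule vector_derivative_unique_at[OF 2 1])
  qed
  have "((\<lambda>h. integral {0..h} (\<lambda>y. Dvw (z + y *\<^sub>R w))) has_vector_derivative Dvw (z + 0 *\<^sub>R w)) (at 0 within {0..1})"
  proof (rule integral_has_vector_derivative)
    show "continuous_on {0..1} (\<lambda>y. Dvw (z + y *\<^sub>R w))"
      by (rule continuous_on_compose2[OF smooth_continuous[OF smooth(3), of UNIV]])
        (auto intro!: continuous_intros)
  qed simp
  then have "((\<lambda>h. Dv (z + h *\<^sub>R w) - Dv z) has_vector_derivative Dvw z) (at 0 within {0..1})"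
    unfolding scaleR_zero_left add_0_right
  proof (rule has_vector_derivative_transform[rotated 2])
    show "Dv (z + h *\<^sub>R w) - Dv z = integral {0..h} (\<lambda>y. Dvw (z + y *\<^sub>R w))" if "h \<in> {0..1}" for h
      using that by (intro increment) simp
  qed simp
  moreover have "((\<lambda>h. Dv (z + h *\<^sub>R w) - Dv z) has_vector_derivative frechet_derivative Dv (at (z + 0 *\<^sub>R w)) w - 0) (at 0 within {0..1})"
    by (intro has_vector_derivative_diff smooth_along_line smooth) (auto intro: derivative_eq_intros)
  ultimately have "frechet_derivative Dv (at z) w = Dvw z"
    using vector_derivative_unique_within_closed_interval[of 0 1 0] by simp
  then show ?thesis
    unfolding Dvw_def Dv_def[abs_def] Dw_def[abs_def] .
qed

lemma inner_constant_derivative: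
  fixes f g :: "'a::euclidean_space \<Rightarrow> 'b::real_inner"
  assumes "smooth f" "smooth g" and const: "\<And>z. f z \<bullet> g z = k"
  shows "frechet_derivative f (at z) v \<bullet> g z + f z \<bullet> frechet_derivative g (at z) v = 0"
proof -
  have "((\<lambda>z. f z \<bullet> g z) has_derivative
      (\<lambda>v. f z \<bullet> frechet_derivative g (at z) v + frechet_derivative f (at z) v \<bullet> g z)) (at z)"
    using assms by (intro has_derivative_inner smooth_has_derivative)
  moreover have "((\<lambda>z. f z \<bullet> g z) has_derivative (\<lambda>v. 0)) (at z)"
    by (simp add: const)
  ultimately have "(\<lambda>v. f z \<bullet> frechet_derivative g (at z) v + frechet_derivative f (at z) v \<bullet> g z) = (\<lambda>v. 0)"
    by (rule has_derivative_unique)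
  then show ?thesis by (metis add.commute)
qed

lemma positive_orthonormal_cross:
  fixes e1 e2 e3 :: "real^3"
  assumes on: "norm e1 = 1" "norm e2 = 1" "norm e3 = 1"
      "e1 \<bullet> e2 = 0" "e1 \<bullet> e3 = 0" "e2 \<bullet> e3 = 0"
    and det: "det (vector [e1, e2, e3] :: real^3^3) > 0"
  shows "cross3 e2 e3 = e1" and "cross3 e3 e1 = e2" and "cross3 e1 e2 = e3"
proof -
  have ii: "e1 \<bullet> e1 = 1" "e2 \<bullet> e2 = 1" "e3 \<bullet> e3 = 1"
    using on(1-3) by (simp_all add: norm_eq_1)
  have "cross3 e2 e3 = (cross3 e2 e3 \<bullet> e1) *\<^sub>R e1"
    using orthonormal_triple_expand[OF on, of "cross3 e2 e3"] by (simp add: dot_cross_self)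
  moreover have pos: "cross3 e2 e3 \<bullet> e1 > 0"
    using det by (simp add: inner_commute dot_cross_det)
  moreover have "(norm (cross3 e2 e3))\<^sup>2 = 1"
    using norm_cross_dot[of e2 e3] on by simp
  then have "norm (cross3 e2 e3) = 1"
    using norm_ge_zero[of "cross3 e2 e3"] by (auto simp: power2_eq_1_iff simp del: norm_ge_zero)
  ultimately have "\<bar>cross3 e2 e3 \<bullet> e1\<bar> = 1"
    using on(1) by (metis mult.right_neutral norm_scaleR)
  then have 1: "cross3 e2 e3 = e1"
    using \<open>cross3 e2 e3 = (cross3 e2 e3 \<bullet> e1) *\<^sub>R e1\<close> pos by simp
  then show "cross3 e2 e3 = e1" .
  have "cross3 (cross3 e2 e3) e2 = e3"
    using on ii unfolding cross3_def inner_vec_def sum_3 vec_eq_iff by (simp add: forall_3) algebra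
  then show "cross3 e1 e2 = e3" by (simp add: 1)
  have "cross3 e3 (cross3 e2 e3) = e2"
    using on ii unfolding cross3_def inner_vec_def sum_3 vec_eq_iff by (simp add: forall_3) algebra
  then show "cross3 e3 e1 = e2" by (simp add: 1)
qed

text \<open>The half-angle \<open>\<phi> / 2\<close> equals \<open>- \<theta>\<close>, which explains the signs in the conditions on \<open>f\<close>.\<close>

locale pseudospherical_frame = pendulum_wave +
  fixes f e1 e2 e3 :: "real \<times> real \<Rightarrow> real^3"
  assumes smooth: "smooth f" "smooth e1" "smooth e2" "smooth e3"
    and on: "\<And>z. norm (e1 z) = 1" "\<And>z. norm (e2 z) = 1" "\<And>z. norm (e3 z) = 1"
      "\<And>z. e1 z \<bullet> e2 z = 0" "\<And>z. e1 z \<bullet> e3 z = 0" "\<And>z. e2 z \<bullet> e3 z = 0"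
    and pos: "\<And>z. det (vector [e1 z, e2 z, e3 z] :: real^3^3) > 0"
    and f_s: "\<And>z. frechet_derivative f (at z) (1, 0) = cos (\<theta> (\<alpha> * fst z + \<beta> * snd z)) *\<^sub>R e1 z"
    and f_t: "\<And>z. frechet_derivative f (at z) (0, 1) = - sin (\<theta> (\<alpha> * fst z + \<beta> * snd z)) *\<^sub>R e2 z"
    and II: "\<And>z p q. second_fundamental_form f e3 z (p, q) =
      - cos (\<theta> (\<alpha> * fst z + \<beta> * snd z)) * sin (\<theta> (\<alpha> * fst z + \<beta> * snd z)) * (p\<^sup>2 - q\<^sup>2)"
begin

definition phase where "phase z = \<alpha> * fst z + \<beta> * snd z" for z

lemma phase_line_deriv: "((\<lambda>x. phase (z + x *\<^sub>R v)) has_real_derivative phase v) (at x)"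
proof -
  have "(\<lambda>x. phase (z + x *\<^sub>R v)) = (\<lambda>x. phase z + x * phase v)"
    by (simp add: phase_def algebra_simps)
  then show ?thesis by (auto intro!: derivative_eq_intros)
qed

text \<open>The first fundamental form degenerates where \<open>sin \<theta> cos \<theta> = 0\<close>. Along the direction \<open>(1, 0)\<close> such points are
isolated, so an identity between continuous functions that holds elsewhere holds everywhere.\<close>

lemma cancel_degenerate:
  fixes g :: "real \<times> real \<Rightarrow> real"
  assumes cont: "continuous_on UNIV g" and zero: "\<And>z. sin (\<theta> (phase z)) * cos (\<theta> (phase z)) * g z = 0"
  shows "g z = 0"
proof -
  let ?k = "\<lambda>u. sin (\<theta> u) * cos (\<theta> u)"
  let ?line = "\<lambda>x::real. z + x *\<^sub>R (1, 0)"
  have "((\<lambda>x. ?k (phase (?line x))) has_real_derivative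
      ((cos (\<theta> (phase (?line 0))))\<^sup>2 - (sin (\<theta> (phase (?line 0))))\<^sup>2) * \<omega> (phase (?line 0)) * \<alpha>) (at 0)"
    using DERIV_chain2[OF sin_cos_deriv phase_line_deriv[of z "(1, 0)" 0]]
    by (simp add: phase_def)
  then have "\<forall>\<^sub>F x in at 0. ?k (phase (?line x)) \<noteq> 0"
    by (rule eventually_nonzero_if_deriv_nonzero)
      (use pendulum_nondegenerate(2)[OF sol \<mu>(2)] \<alpha>\<beta>(1) in simp)
  then have "\<forall>\<^sub>F x in at 0. g (?line x) = 0"
  proof (rule eventually_mono)
    show "g (?line x) = 0" if "?k (phase (?line x)) \<noteq> 0" for x
      using zero[of "?line x"] that by (simp only: mult_eq_0_iff) blast
  qed
  then have "((\<lambda>x. g (?line x)) \<longlongrightarrow> 0) (at 0)"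
    by (rule tendsto_eventually)
  moreover have "continuous_on UNIV (\<lambda>x. g (?line x))"
    by (rule continuous_on_compose2[OF cont]) (auto intro!: continuous_intros)
  then have "isCont (\<lambda>x. g (?line x)) 0"
    by (simp only: continuous_on_eq_continuous_at[OF open_UNIV]) blast
  then have "((\<lambda>x. g (?line x)) \<longlongrightarrow> g z) (at 0)"
    by (simp only: isCont_def scaleR_zero_left add_0_right)
  ultimately show ?thesis
    using tendsto_unique[OF at_neq_bot] by blast
qed

lemma cancel_sin:
  fixes g :: "real \<times> real \<Rightarrow> real"
  assumes "continuous_on UNIV g" and zero: "\<And>z. sin (\<theta> (phase z)) * g z = 0"
  shows "g z = 0"
proof (rule cancel_degenerate[OF assms(1)])
  show "sin (\<theta> (phase z)) * cos (\<theta> (phase z)) * g z = 0" for z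
    using zero[of z] by auto
qed

lemma cancel_cos:
  fixes g :: "real \<times> real \<Rightarrow> real"
  assumes "continuous_on UNIV g" and zero: "\<And>z. cos (\<theta> (phase z)) * g z = 0"
  shows "g z = 0"
proof (rule cancel_degenerate[OF assms(1)])
  show "sin (\<theta> (phase z)) * cos (\<theta> (phase z)) * g z = 0" for z
    using zero[of z] by auto
qed

lemma deriv_f_s: "frechet_derivative (\<lambda>z. frechet_derivative f (at z) (1, 0)) (at z) v =
    cos (\<theta> (phase z)) *\<^sub>R frechet_derivative e1 (at z) v - (sin (\<theta> (phase z)) * \<omega> (phase z) * phase v) *\<^sub>R e1 z"
proof -
  let ?line = "\<lambda>x::real. z + x *\<^sub>R v"
  have "((\<lambda>x. cos (\<theta> (phase (?line x)))) has_real_derivative - sin (\<theta> (phase (?line 0))) * (\<omega> (phase (?line 0)) * phase v)) (at 0)"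
    by (intro DERIV_chain2[OF DERIV_cos] DERIV_chain2[OF \<theta>_deriv] phase_line_deriv)
  from has_vector_derivative_scaleR[OF this smooth_along_line[OF smooth(2), of z v 0]]
  have "((\<lambda>x. cos (\<theta> (phase (?line x))) *\<^sub>R e1 (?line x)) has_vector_derivative
      cos (\<theta> (phase z)) *\<^sub>R frechet_derivative e1 (at z) v - (sin (\<theta> (phase z)) * \<omega> (phase z) * phase v) *\<^sub>R e1 z) (at 0)"
    by (simp add: mult.assoc)
  from vector_derivative_unique_at[OF smooth_along_line[OF smooth_directional_derivative[OF smooth(1), of "(1, 0)"], of z v 0] this[unfolded phase_def f_s[symmetric]]]
  show ?thesis by (simp add: phase_def)
qed

lemma deriv_f_t: "frechet_derivative (\<lambda>z. frechet_derivative f (at z) (0, 1)) (at z) v =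
    - sin (\<theta> (phase z)) *\<^sub>R frechet_derivative e2 (at z) v - (cos (\<theta> (phase z)) * \<omega> (phase z) * phase v) *\<^sub>R e2 z"
proof -
  let ?line = "\<lambda>x::real. z + x *\<^sub>R v"
  have "((\<lambda>x. - sin (\<theta> (phase (?line x)))) has_real_derivative - (cos (\<theta> (phase (?line 0))) * (\<omega> (phase (?line 0)) * phase v))) (at 0)"
    by (intro DERIV_minus DERIV_chain2[OF DERIV_sin] DERIV_chain2[OF \<theta>_deriv] phase_line_deriv)
  from has_vector_derivative_scaleR[OF this smooth_along_line[OF smooth(3), of z v 0]]
  have "((\<lambda>x. - sin (\<theta> (phase (?line x))) *\<^sub>R e2 (?line x)) has_vector_derivative
      - sin (\<theta> (phase z)) *\<^sub>R frechet_derivative e2 (at z) v - (cos (\<theta> (phase z)) * \<omega> (phase z) * phase v) *\<^sub>R e2 z) (at 0)"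
    by (simp add: mult.assoc)
  from vector_derivative_unique_at[OF smooth_along_line[OF smooth_directional_derivative[OF smooth(1), of "(0, 1)"], of z v 0] this[unfolded phase_def f_t[symmetric]]]
  show ?thesis by (simp add: phase_def)
qed

lemma frame_inner:
  "e1 z \<bullet> e1 z = 1" "e2 z \<bullet> e2 z = 1" "e3 z \<bullet> e3 z = 1" "e2 z \<bullet> e1 z = 0" "e3 z \<bullet> e1 z = 0" "e3 z \<bullet> e2 z = 0"
  "e1 z \<bullet> e2 z = 0" "e1 z \<bullet> e3 z = 0" "e2 z \<bullet> e3 z = 0"
  using on by (simp_all add: norm_eq_1 inner_commute)

lemma continuous_coefficient:
  assumes "smooth g" "smooth h"
  shows "continuous_on UNIV (\<lambda>z. frechet_derivative g (at z) v \<bullet> h z)"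
  by (intro continuous_on_inner smooth_continuous smooth_directional_derivative assms)

lemma continuous_pendulum:
  "continuous_on UNIV (\<lambda>z. sin (\<theta> (phase z)))" "continuous_on UNIV (\<lambda>z. cos (\<theta> (phase z)))" "continuous_on UNIV (\<lambda>z. \<omega> (phase z))"
proof -
  have phase: "continuous_on UNIV phase" unfolding phase_def[abs_def] by (intro continuous_intros)
  have "continuous_on UNIV \<theta>" "continuous_on UNIV \<omega>"
    by (auto intro!: continuous_at_imp_continuous_on DERIV_isCont[OF \<theta>_deriv] DERIV_isCont[OF \<omega>_deriv])
  then have "continuous_on UNIV (\<lambda>z. \<theta> (phase z))" and "continuous_on UNIV (\<lambda>z. \<omega> (phase z))"
    using continuous_on_compose2[OF _ phase] by auto
  then show "continuous_on UNIV (\<lambda>z. sin (\<theta> (phase z)))" "continuous_on UNIV (\<lambda>z. cos (\<theta> (phase z)))" "continuous_on UNIV (\<lambda>z. \<omega> (phase z))"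
    by (auto intro: continuous_on_sin continuous_on_cos)
qed

text \<open>Evaluating the quadratic form on \<open>(1, 0)\<close>, \<open>(0, 1)\<close> and \<open>(1, 1)\<close> gives three relations between the derivatives of the normal
and the tangent frame. The third one is the vanishing of the mixed coefficient.\<close>

lemma second_form:
  "frechet_derivative e3 (at z) (1, 0) \<bullet> e1 z = sin (\<theta> (phase z))"
  "frechet_derivative e3 (at z) (0, 1) \<bullet> e2 z = cos (\<theta> (phase z))"
  "cos (\<theta> (phase z)) * (frechet_derivative e3 (at z) (0, 1) \<bullet> e1 z) =
   sin (\<theta> (phase z)) * (frechet_derivative e3 (at z) (1, 0) \<bullet> e2 z)"
proof -
  have form: "(p * cos (\<theta> (phase z)) * (p * (frechet_derivative e3 (at z) (1, 0) \<bullet> e1 z) + q * (frechet_derivative e3 (at z) (0, 1) \<bullet> e1 z)) -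
      q * sin (\<theta> (phase z)) * (p * (frechet_derivative e3 (at z) (1, 0) \<bullet> e2 z) + q * (frechet_derivative e3 (at z) (0, 1) \<bullet> e2 z)))
      = cos (\<theta> (phase z)) * sin (\<theta> (phase z)) * (p\<^sup>2 - q\<^sup>2)" for z p q
    using II[of z p q] unfolding second_fundamental_form_def frechet_derivative_pair[OF smooth(1), of z p q] frechet_derivative_pair[OF smooth(4), of z p q] f_s f_t phase_def[symmetric]
    by (simp add: inner_add_left inner_add_right inner_commute algebra_simps)
  have 1: "cos (\<theta> (phase z)) * (frechet_derivative e3 (at z) (1, 0) \<bullet> e1 z - sin (\<theta> (phase z))) = 0" for z
    using form[of 1 z 0] by (simp add: algebra_simps)
  have "frechet_derivative e3 (at z) (1, 0) \<bullet> e1 z - sin (\<theta> (phase z)) = 0"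
  proof (rule cancel_cos[where g = "\<lambda>z. frechet_derivative e3 (at z) (1, 0) \<bullet> e1 z - sin (\<theta> (phase z))"])
    show "continuous_on UNIV (\<lambda>z. frechet_derivative e3 (at z) (1, 0) \<bullet> e1 z - sin (\<theta> (phase z)))"
      by (intro continuous_on_diff continuous_on_add continuous_on_mult continuous_on_const
        continuous_coefficient continuous_pendulum smooth)
  qed (rule 1)
  then show "frechet_derivative e3 (at z) (1, 0) \<bullet> e1 z = sin (\<theta> (phase z))" by simp
  have 2: "sin (\<theta> (phase z)) * (frechet_derivative e3 (at z) (0, 1) \<bullet> e2 z - cos (\<theta> (phase z))) = 0" for z
    using form[of 0 z 1] by (simp add: algebra_simps)
  have "frechet_derivative e3 (at z) (0, 1) \<bullet> e2 z - cos (\<theta> (phase z)) = 0"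
  proof (rule cancel_sin[where g = "\<lambda>z. frechet_derivative e3 (at z) (0, 1) \<bullet> e2 z - cos (\<theta> (phase z))"])
    show "continuous_on UNIV (\<lambda>z. frechet_derivative e3 (at z) (0, 1) \<bullet> e2 z - cos (\<theta> (phase z)))"
      by (intro continuous_on_diff continuous_on_add continuous_on_mult continuous_on_const
        continuous_coefficient continuous_pendulum smooth)
  qed (rule 2)
  then show "frechet_derivative e3 (at z) (0, 1) \<bullet> e2 z = cos (\<theta> (phase z))" by simp
  show "cos (\<theta> (phase z)) * (frechet_derivative e3 (at z) (0, 1) \<bullet> e1 z) =
      sin (\<theta> (phase z)) * (frechet_derivative e3 (at z) (1, 0) \<bullet> e2 z)"
    proof -
    have "cos (\<theta> (phase z)) * (frechet_derivative e3 (at z) (1, 0) \<bullet> e1 z + frechet_derivative e3 (at z) (0, 1) \<bullet> e1 z) -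
      sin (\<theta> (phase z)) * (frechet_derivative e3 (at z) (1, 0) \<bullet> e2 z + frechet_derivative e3 (at z) (0, 1) \<bullet> e2 z) = 0"
      using form[of 1 z 1] by simp
    then show ?thesis using 1[of z] 2[of z] by algebra
  qed
qed

text \<open>The equality \<open>\<partial>\<^sub>t \<partial>\<^sub>s f = \<partial>\<^sub>s \<partial>\<^sub>t f\<close> has three components in the frame. The normal one is the symmetry of the second
fundamental form; together with \<open>second_form\<close> it shows that both of its mixed coefficients vanish. The
tangential components give the connection form of the metric.\<close>

lemma connection_form:
  "frechet_derivative e3 (at z) (0, 1) \<bullet> e1 z = 0"
  "frechet_derivative e3 (at z) (1, 0) \<bullet> e2 z = 0"
  "frechet_derivative e2 (at z) (1, 0) \<bullet> e1 z = \<beta> * \<omega> (phase z)"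
  "frechet_derivative e1 (at z) (0, 1) \<bullet> e2 z = - (\<alpha> * \<omega> (phase z))"
proof -
  have compat: "cos (\<theta> (phase z)) *\<^sub>R frechet_derivative e1 (at z) (0, 1) - (sin (\<theta> (phase z)) * \<omega> (phase z) * \<beta>) *\<^sub>R e1 z =
      - sin (\<theta> (phase z)) *\<^sub>R frechet_derivative e2 (at z) (1, 0) - (cos (\<theta> (phase z)) * \<omega> (phase z) * \<alpha>) *\<^sub>R e2 z" for z
    using directional_derivatives_commute[OF smooth(1), of "(1, 0)" z "(0, 1)"]
    unfolding deriv_f_s deriv_f_t by (simp add: phase_def)
  have n13: "frechet_derivative e1 (at z) v \<bullet> e3 z = - (frechet_derivative e3 (at z) v \<bullet> e1 z)" for z v
    using inner_constant_derivative[OF smooth(2,4) on(5), of z v] by (simp add: inner_commute)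
  have n23: "frechet_derivative e2 (at z) v \<bullet> e3 z = - (frechet_derivative e3 (at z) v \<bullet> e2 z)" for z v
    using inner_constant_derivative[OF smooth(3,4) on(6), of z v] by (simp add: inner_commute)
  have n11: "frechet_derivative e1 (at z) v \<bullet> e1 z = 0" "frechet_derivative e2 (at z) v \<bullet> e2 z = 0" for z v
    using inner_constant_derivative[OF smooth(2,2) frame_inner(1), of z v]
      inner_constant_derivative[OF smooth(3,3) frame_inner(2), of z v] by (simp_all add: inner_commute)
  have c3: "cos (\<theta> (phase z)) * (frechet_derivative e3 (at z) (0, 1) \<bullet> e1 z) =
      - (sin (\<theta> (phase z)) * (frechet_derivative e3 (at z) (1, 0) \<bullet> e2 z))" for z
    using arg_cong[OF compat[of z], of "\<lambda>w. w \<bullet> e3 z"]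
    by (simp add: inner_diff_left frame_inner n13 n23)
  have c1: "sin (\<theta> (phase z)) * (frechet_derivative e2 (at z) (1, 0) \<bullet> e1 z - \<beta> * \<omega> (phase z)) = 0" for z
    using arg_cong[OF compat[of z], of "\<lambda>w. w \<bullet> e1 z"]
    by (auto simp: inner_diff_left frame_inner n11 algebra_simps)
  have c2: "cos (\<theta> (phase z)) * (frechet_derivative e1 (at z) (0, 1) \<bullet> e2 z + \<alpha> * \<omega> (phase z)) = 0" for z
    using arg_cong[OF compat[of z], of "\<lambda>w. w \<bullet> e2 z"]
    by (auto simp: inner_diff_left frame_inner n11 algebra_simps)
  have zero: "cos (\<theta> (phase z)) * (frechet_derivative e3 (at z) (0, 1) \<bullet> e1 z) = 0" "sin (\<theta> (phase z)) * (frechet_derivative e3 (at z) (1, 0) \<bullet> e2 z) = 0" for z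
    using c3[of z] second_form(3)[of z] by linarith+
  show "frechet_derivative e3 (at z) (0, 1) \<bullet> e1 z = 0"
    by (rule cancel_cos[OF continuous_coefficient[OF smooth(4,2)] zero(1)])
  show "frechet_derivative e3 (at z) (1, 0) \<bullet> e2 z = 0"
    by (rule cancel_sin[OF continuous_coefficient[OF smooth(4,3)] zero(2)])
  have "frechet_derivative e2 (at z) (1, 0) \<bullet> e1 z - \<beta> * \<omega> (phase z) = 0"
  proof (rule cancel_sin[where g = "\<lambda>z. frechet_derivative e2 (at z) (1, 0) \<bullet> e1 z - \<beta> * \<omega> (phase z)"])
    show "continuous_on UNIV (\<lambda>z. frechet_derivative e2 (at z) (1, 0) \<bullet> e1 z - \<beta> * \<omega> (phase z))"
      by (intro continuous_on_diff continuous_on_add continuous_on_mult continuous_on_const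
        continuous_coefficient continuous_pendulum smooth)
  qed (rule c1)
  then show "frechet_derivative e2 (at z) (1, 0) \<bullet> e1 z = \<beta> * \<omega> (phase z)" by simp
  have "frechet_derivative e1 (at z) (0, 1) \<bullet> e2 z + \<alpha> * \<omega> (phase z) = 0"
  proof (rule cancel_cos[where g = "\<lambda>z. frechet_derivative e1 (at z) (0, 1) \<bullet> e2 z + \<alpha> * \<omega> (phase z)"])
    show "continuous_on UNIV (\<lambda>z. frechet_derivative e1 (at z) (0, 1) \<bullet> e2 z + \<alpha> * \<omega> (phase z))"
      by (intro continuous_on_diff continuous_on_add continuous_on_mult continuous_on_const
        continuous_coefficient continuous_pendulum smooth)
  qed (rule c2)
  then show "frechet_derivative e1 (at z) (0, 1) \<bullet> e2 z = - (\<alpha> * \<omega> (phase z))" by simp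
qed

text \<open>The derivative of a frame vector has no component along itself, and the components along two different frame vectors are
skew-symmetric. So the coefficients found above determine all the others.\<close>

lemma frame_equations:
  "frechet_derivative f (at z) (p, q) = (p * cos (\<theta> (phase z))) *\<^sub>R e1 z + (- q * sin (\<theta> (phase z))) *\<^sub>R e2 z"
  "frechet_derivative e1 (at z) (p, q) = (- (\<beta> * p + \<alpha> * q) * \<omega> (phase z)) *\<^sub>R e2 z + (- p * sin (\<theta> (phase z))) *\<^sub>R e3 z"
  "frechet_derivative e2 (at z) (p, q) = ((\<beta> * p + \<alpha> * q) * \<omega> (phase z)) *\<^sub>R e1 z + (- q * cos (\<theta> (phase z))) *\<^sub>R e3 z"
  "frechet_derivative e3 (at z) (p, q) = (p * sin (\<theta> (phase z))) *\<^sub>R e1 z + (q * cos (\<theta> (phase z))) *\<^sub>R e2 z"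
proof -
  note expand = orthonormal_triple_expand[OF on(1) on(2) on(3) on(4) on(5) on(6)]
  note n = inner_constant_derivative[OF smooth(2,2) frame_inner(1)] inner_constant_derivative[OF smooth(3,3) frame_inner(2)]
    inner_constant_derivative[OF smooth(4,4) frame_inner(3)] inner_constant_derivative[OF smooth(2,3) on(4)]
    inner_constant_derivative[OF smooth(2,4) on(5)] inner_constant_derivative[OF smooth(3,4) on(6)]
  have n1: "frechet_derivative e1 (at z) v \<bullet> e1 z = 0" "frechet_derivative e2 (at z) v \<bullet> e2 z = 0"
      "frechet_derivative e3 (at z) v \<bullet> e3 z = 0" for v
    using n(1)[of z v] n(2)[of z v] n(3)[of z v] by (simp_all add: inner_commute)
  have n2: "frechet_derivative e1 (at z) v \<bullet> e2 z = - (frechet_derivative e2 (at z) v \<bullet> e1 z)"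
      "frechet_derivative e1 (at z) v \<bullet> e3 z = - (frechet_derivative e3 (at z) v \<bullet> e1 z)"
      "frechet_derivative e2 (at z) v \<bullet> e3 z = - (frechet_derivative e3 (at z) v \<bullet> e2 z)" for v
    using n(4)[of z v] n(5)[of z v] n(6)[of z v] by (simp_all add: inner_commute)
  have e2_t: "frechet_derivative e2 (at z) (0, 1) \<bullet> e1 z = \<alpha> * \<omega> (phase z)"
    using n2(1)[of "(0, 1)"] connection_form(4)[of z] by simp
  note coeffs = n1 n2 e2_t connection_form second_form(1,2)
  show "frechet_derivative f (at z) (p, q) = (p * cos (\<theta> (phase z))) *\<^sub>R e1 z + (- q * sin (\<theta> (phase z))) *\<^sub>R e2 z"
    unfolding frechet_derivative_pair[OF smooth(1), of z p q] f_s f_t phase_def by simp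
  have "frechet_derivative e1 (at z) (1, 0) = (- (\<beta> * \<omega> (phase z))) *\<^sub>R e2 z + (- sin (\<theta> (phase z))) *\<^sub>R e3 z"
    "frechet_derivative e1 (at z) (0, 1) = (- (\<alpha> * \<omega> (phase z))) *\<^sub>R e2 z"
    using expand[of "frechet_derivative e1 (at z) (1, 0)" z] expand[of "frechet_derivative e1 (at z) (0, 1)" z]
    by (simp_all add: n1 n2(2,3) n2(1)[of "(1, 0)"] connection_form second_form(1,2))
  then show "frechet_derivative e1 (at z) (p, q) = (- (\<beta> * p + \<alpha> * q) * \<omega> (phase z)) *\<^sub>R e2 z + (- p * sin (\<theta> (phase z))) *\<^sub>R e3 z"
    unfolding frechet_derivative_pair[OF smooth(2), of z p q] by (simp only:) (simp add: algebra_simps)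
  have "frechet_derivative e2 (at z) (1, 0) = (\<beta> * \<omega> (phase z)) *\<^sub>R e1 z"
    "frechet_derivative e2 (at z) (0, 1) = (\<alpha> * \<omega> (phase z)) *\<^sub>R e1 z + (- cos (\<theta> (phase z))) *\<^sub>R e3 z"
    using expand[of "frechet_derivative e2 (at z) (1, 0)" z] expand[of "frechet_derivative e2 (at z) (0, 1)" z]
    by (simp_all add: n1 n2(2,3) e2_t connection_form second_form(1,2))
  then show "frechet_derivative e2 (at z) (p, q) = ((\<beta> * p + \<alpha> * q) * \<omega> (phase z)) *\<^sub>R e1 z + (- q * cos (\<theta> (phase z))) *\<^sub>R e3 z"
    unfolding frechet_derivative_pair[OF smooth(3), of z p q] by (simp only:) (simp add: algebra_simps)
  have "frechet_derivative e3 (at z) (1, 0) = sin (\<theta> (phase z)) *\<^sub>R e1 z"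
    "frechet_derivative e3 (at z) (0, 1) = cos (\<theta> (phase z)) *\<^sub>R e2 z"
    using expand[of "frechet_derivative e3 (at z) (1, 0)" z] expand[of "frechet_derivative e3 (at z) (0, 1)" z]
    by (simp_all add: n1 connection_form second_form(1,2))
  then show "frechet_derivative e3 (at z) (p, q) = (p * sin (\<theta> (phase z))) *\<^sub>R e1 z + (q * cos (\<theta> (phase z))) *\<^sub>R e2 z"
    unfolding frechet_derivative_pair[OF smooth(4), of z p q] by (simp only:) (simp add: algebra_simps)
qed

end

section \<open>The screw axis\<close>

lemma constant_if_constant_along_lines:
  fixes y :: "real \<times> real \<Rightarrow> 'b::real_normed_vector"
  assumes "\<And>p q x. ((\<lambda>x. y (x *\<^sub>R (p, q))) has_vector_derivative 0) (at x)"
  shows "y z = y 0"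
proof -
  obtain p q where z: "z = (p, q)" by fastforce
  have "(\<lambda>x. y (x *\<^sub>R (p, q))) 1 = (\<lambda>x. y (x *\<^sub>R (p, q))) 0"
    by (rule has_derivative_zero_unique[of UNIV])
      (use assms[of p q] in \<open>auto simp: has_vector_derivative_def\<close>)
  then show ?thesis by (simp add: z zero_prod_def)
qed

context pseudospherical_frame
begin

text \<open>The vectors that describe the screw motion have coordinates in the moving frame which depend on the
phase alone. Derivatives and products are therefore computed on triples of coordinates.\<close>

definition frame_vector :: "real \<times> real \<times> real \<Rightarrow> real \<times> real \<Rightarrow> real^3" where
  "frame_vector a z = fst a *\<^sub>R e1 z + fst (snd a) *\<^sub>R e2 z + snd (snd a) *\<^sub>R e3 z"

lemma frame_vector_inner: "frame_vector (a1, a2, a3) z \<bullet> frame_vector (b1, b2, b3) z = a1 * b1 + a2 * b2 + a3 * b3"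
  by (simp add: frame_vector_def inner_add_left inner_add_right frame_inner)

lemma frame_vector_cross: "cross3 (frame_vector (a1, a2, a3) z) (frame_vector (b1, b2, b3) z) =
    frame_vector (a2 * b3 - a3 * b2, a3 * b1 - a1 * b3, a1 * b2 - a2 * b1) z"
proof -
  note cr = positive_orthonormal_cross[OF on(1) on(2) on(3) on(4) on(5) on(6) pos, of z]
  note cr' = cross_skew[of "e3 z" "e2 z"] cross_skew[of "e1 z" "e3 z"] cross_skew[of "e2 z" "e1 z"]
  show ?thesis
    unfolding frame_vector_def
    by (simp add: cross_add_left cross_add_right cross_mult_left cross_mult_right cr cr'
        algebra_simps)
qed

text \<open>Constancy in the plane is tested along lines through the origin, with \<open>(p, q)\<close> as the direction. All derivatives are linear in
\<open>(p, q)\<close>, so the two partial derivatives are treated together.\<close>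

lemma frame_vector_deriv:
  assumes "(a1 has_real_derivative a1') (at x)" "(a2 has_real_derivative a2') (at x)" "(a3 has_real_derivative a3') (at x)"
    and "v = x *\<^sub>R (p, q)"
  shows "((\<lambda>x. frame_vector (a1 x, a2 x, a3 x) (x *\<^sub>R (p, q))) has_vector_derivative
    frame_vector (a1' + (\<beta> * p + \<alpha> * q) * \<omega> (phase v) * a2 x + p * sin (\<theta> (phase v)) * a3 x,
          a2' - (\<beta> * p + \<alpha> * q) * \<omega> (phase v) * a1 x + q * cos (\<theta> (phase v)) * a3 x,
          a3' - p * sin (\<theta> (phase v)) * a1 x - q * cos (\<theta> (phase v)) * a2 x) v) (at x)"
proof -
  have e: "((\<lambda>x. e (x *\<^sub>R (p, q))) has_vector_derivative frechet_derivative e (at v) (p, q)) (at x)"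
    if "smooth e" for e :: "real \<times> real \<Rightarrow> real^3"
    using smooth_along_line[OF that, of 0 "(p, q)" x UNIV] by (simp add: assms(4))
  have scale: "((\<lambda>x. a x *\<^sub>R e (x *\<^sub>R (p, q))) has_vector_derivative
      a x *\<^sub>R frechet_derivative e (at v) (p, q) + a' *\<^sub>R e v) (at x)"
    if "(a has_real_derivative a') (at x)" "smooth e" for a a' and e :: "real \<times> real \<Rightarrow> real^3"
    using has_vector_derivative_scaleR[OF that(1) e[OF that(2)]] by (simp add: assms(4))
  have "((\<lambda>x. a1 x *\<^sub>R e1 (x *\<^sub>R (p, q)) + a2 x *\<^sub>R e2 (x *\<^sub>R (p, q)) + a3 x *\<^sub>R e3 (x *\<^sub>R (p, q))) has_vector_derivative
      (a1 x *\<^sub>R frechet_derivative e1 (at v) (p, q) + a1' *\<^sub>R e1 v) +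
      (a2 x *\<^sub>R frechet_derivative e2 (at v) (p, q) + a2' *\<^sub>R e2 v) +
      (a3 x *\<^sub>R frechet_derivative e3 (at v) (p, q) + a3' *\<^sub>R e3 v)) (at x)"
    by (intro has_vector_derivative_add scale assms smooth)
  then show ?thesis
    unfolding frame_vector_def frame_equations by (simp add: algebra_simps)
qed

lemma line_deriv:
  assumes "\<And>u. (g has_real_derivative g' u) (at u)" and "v = x *\<^sub>R (p, q)"
  shows "((\<lambda>x. g (phase (x *\<^sub>R (p, q)))) has_real_derivative g' (phase v) * (\<alpha> * p + \<beta> * q)) (at x)"
  using DERIV_chain2[OF assms(1) phase_line_deriv[of 0 "(p, q)" x]] assms(2) by (simp add: phase_def)

lemma trig_deriv: "((\<lambda>u. sin (\<theta> u)) has_real_derivative cos (\<theta> u) * \<omega> u) (at u)"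
    "((\<lambda>u. cos (\<theta> u)) has_real_derivative - (sin (\<theta> u) * \<omega> u)) (at u)"
  by (auto intro!: derivative_eq_intros \<theta>_deriv)

text \<open>The angular velocity of the screw motion, divided by its length \<open>\<kappa>\<close>. With \<open>V = \<beta> cos \<theta> e1 + \<alpha> sin \<theta> e2\<close> the
velocity of the surface point under the screw motion, the axis passes through \<open>f + (\<Omega> \<times> V) / \<kappa>\<^sup>2\<close>, so the unit vector pointing from
the axis to \<open>f\<close> is \<open>- (\<Omega> \<times> V) / sqrt Q\<close>; this is the vector \<open>radial\<close> below. The third vector
\<open>azimuthal\<close> completes the cylindrical frame.\<close>

definition "screw_axis z = frame_vector (\<alpha> * cos (\<theta> (phase z)) / \<kappa>, \<beta> * sin (\<theta> (phase z)) / \<kappa>, \<epsilon> * \<omega> (phase z) / \<kappa>) z"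

definition "radial z = frame_vector (\<epsilon> * \<alpha> * (\<nu> (phase z) * \<omega> (phase z) * sin (\<theta> (phase z))),
  - \<epsilon> * \<beta> * (\<nu> (phase z) * \<omega> (phase z) * cos (\<theta> (phase z))), - \<epsilon> * (\<nu> (phase z) * sin (\<theta> (phase z)) * cos (\<theta> (phase z)))) z"

definition "azimuthal z = frame_vector (\<epsilon>\<^sup>2 * \<beta> * \<nu> (phase z) * cos (\<theta> (phase z)) / \<kappa>,
  \<epsilon> * \<alpha> * (1 + \<epsilon>) * \<nu> (phase z) * sin (\<theta> (phase z)) / \<kappa>, - \<epsilon> * \<alpha> * \<beta> * \<nu> (phase z) * \<omega> (phase z) / \<kappa>) z"

text \<open>Up to the factor \<open>\<kappa>\<close>, the rate at which the surface point turns about the axis in the direction \<open>(p, q)\<close>. It equals \<open>1\<close>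
for the direction \<open>(\<beta>, - \<alpha>)\<close> of the screw motion.\<close>

definition "turning u p q =
  (\<beta> * p * \<epsilon>\<^sup>2 * (cos (\<theta> u))\<^sup>2 - q * \<alpha> * (\<epsilon> + \<epsilon>\<^sup>2) * (sin (\<theta> u))\<^sup>2) * (\<nu> u)\<^sup>2"

lemma constant_relations: "\<mu> * \<epsilon> = - 1" "\<alpha>\<^sup>2 = \<beta>\<^sup>2 + \<epsilon>" "\<kappa>\<^sup>2 = \<alpha>\<^sup>2 + \<epsilon>\<^sup>2"
  by (fact \<mu>_\<epsilon> \<alpha>_sq \<kappa>_sq)+

lemma pendulum_relations:
  "(sin (\<theta> u))\<^sup>2 + (cos (\<theta> u))\<^sup>2 = 1" "(\<omega> u)\<^sup>2 = 1 - \<mu> * (sin (\<theta> u))\<^sup>2"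
  "(\<nu> u)\<^sup>2 * (\<epsilon>\<^sup>2 * \<beta>\<^sup>2 + \<epsilon> * \<kappa>\<^sup>2 * (sin (\<theta> u))\<^sup>2) = 1"
  using first_integral[of u] \<nu>_sq[of u] by (simp_all add: Q_def)

lemma axis_norm: "norm (screw_axis z) = 1"
proof -
  have "(\<alpha> * cos (\<theta> (phase z)))\<^sup>2 + (\<beta> * sin (\<theta> (phase z)))\<^sup>2 + (\<epsilon> * \<omega> (phase z))\<^sup>2 = \<kappa>\<^sup>2"
    using constant_relations pendulum_relations[of "phase z"] by algebra
  then have "screw_axis z \<bullet> screw_axis z = 1"
    using \<kappa>_pos by (simp add: screw_axis_def frame_vector_inner field_simps power2_eq_square)
  then show ?thesis by (simp add: norm_eq_1)
qed

lemma radial_norm: "norm (radial z) = 1"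
proof -
  have "radial z \<bullet> radial z = 1"
    unfolding radial_def frame_vector_inner using constant_relations pendulum_relations[of "phase z"] by algebra
  then show ?thesis by (simp add: norm_eq_1)
qed

lemma axis_radial: "screw_axis z \<bullet> radial z = 0"
proof -
  have "(\<alpha> * cos (\<theta> (phase z))) * (\<epsilon> * \<alpha> * (\<nu> (phase z) * \<omega> (phase z) * sin (\<theta> (phase z)))) +
      (\<beta> * sin (\<theta> (phase z))) * (- \<epsilon> * \<beta> * (\<nu> (phase z) * \<omega> (phase z) * cos (\<theta> (phase z)))) +
      (\<epsilon> * \<omega> (phase z)) * (- \<epsilon> * (\<nu> (phase z) * sin (\<theta> (phase z)) * cos (\<theta> (phase z)))) = 0"
    using constant_relations pendulum_relations[of "phase z"] by algebra
  then show ?thesis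
    unfolding screw_axis_def radial_def frame_vector_inner times_divide_eq_left add_divide_distrib[symmetric] by simp
qed

lemma axis_cross_radial: "cross3 (screw_axis z) (radial z) = azimuthal z"
proof -
  define s c w v where "s = sin (\<theta> (phase z))" and "c = cos (\<theta> (phase z))" and "w = \<omega> (phase z)" and "v = \<nu> (phase z)"
  note rel = constant_relations pendulum_relations[of "phase z", folded s_def c_def w_def v_def]
  have "(\<beta> * s) * (- \<epsilon> * (v * s * c)) - (\<epsilon> * w) * (- \<epsilon> * \<beta> * (v * w * c)) = \<epsilon>\<^sup>2 * \<beta> * v * c"
    "(\<epsilon> * w) * (\<epsilon> * \<alpha> * (v * w * s)) - (\<alpha> * c) * (- \<epsilon> * (v * s * c)) = \<epsilon> * \<alpha> * (1 + \<epsilon>) * v * s"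
    "(\<alpha> * c) * (- \<epsilon> * \<beta> * (v * w * c)) - (\<beta> * s) * (\<epsilon> * \<alpha> * (v * w * s)) = - \<epsilon> * \<alpha> * \<beta> * v * w"
    using rel by algebra+
  then show ?thesis
    unfolding screw_axis_def radial_def azimuthal_def frame_vector_cross s_def[symmetric] c_def[symmetric] w_def[symmetric] v_def[symmetric]
    by (simp only: times_divide_eq_left times_divide_eq_right diff_divide_distrib[symmetric])
qed

text \<open>In the moving frame, each component of the derivative of the angular velocity is a multiple of \<open>\<alpha>\<^sup>2 - \<beta>\<^sup>2 - \<epsilon>\<close> or of
\<open>\<mu> \<epsilon> + 1\<close>.\<close>

lemma axis_constant: "screw_axis z = screw_axis 0"
proof (rule constant_if_constant_along_lines)
  fix p q x :: real
  obtain v where v: "v = x *\<^sub>R (p, q)" by blast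
  define s c w where "s = sin (\<theta> (phase v))" and "c = cos (\<theta> (phase v))" and "w = \<omega> (phase v)"
  note rel = constant_relations pendulum_relations[of "phase v", folded s_def c_def w_def]
  have "((\<lambda>x. screw_axis (x *\<^sub>R (p, q))) has_vector_derivative
     frame_vector (\<alpha> * (- (s * w) * (\<alpha> * p + \<beta> * q)) / \<kappa> + (\<beta> * p + \<alpha> * q) * w * (\<beta> * s / \<kappa>) + p * s * (\<epsilon> * w / \<kappa>),
           \<beta> * (c * w * (\<alpha> * p + \<beta> * q)) / \<kappa> - (\<beta> * p + \<alpha> * q) * w * (\<alpha> * c / \<kappa>) + q * c * (\<epsilon> * w / \<kappa>),
           \<epsilon> * (- \<mu> * s * c * (\<alpha> * p + \<beta> * q)) / \<kappa> - p * s * (\<alpha> * c / \<kappa>) - q * c * (\<beta> * s / \<kappa>)) v) (at x)"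
    unfolding screw_axis_def
    using frame_vector_deriv[OF DERIV_cdivide[OF DERIV_cmult[OF line_deriv[OF trig_deriv(2) v]]]
        DERIV_cdivide[OF DERIV_cmult[OF line_deriv[OF trig_deriv(1) v]]]
        DERIV_cdivide[OF DERIV_cmult[OF line_deriv[OF \<omega>_deriv v]]] v,
        of \<alpha> \<kappa> \<beta> \<kappa> \<epsilon> \<kappa>]
    by (simp only: v[symmetric] s_def c_def w_def)
  moreover have "\<alpha> * (- (s * w) * (\<alpha> * p + \<beta> * q)) + (\<beta> * p + \<alpha> * q) * w * (\<beta> * s) + p * s * (\<epsilon> * w) = 0"
    "\<beta> * (c * w * (\<alpha> * p + \<beta> * q)) - (\<beta> * p + \<alpha> * q) * w * (\<alpha> * c) + q * c * (\<epsilon> * w) = 0"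
    "\<epsilon> * (- \<mu> * s * c * (\<alpha> * p + \<beta> * q)) - p * s * (\<alpha> * c) - q * c * (\<beta> * s) = 0"
    using rel by algebra+
  ultimately show "((\<lambda>x. screw_axis (x *\<^sub>R (p, q))) has_vector_derivative 0) (at x)"
    by (simp only: times_divide_eq_left times_divide_eq_right diff_divide_distrib[symmetric] add_divide_distrib[symmetric])
      (simp add: frame_vector_def)
qed

lemma scaleR_frame_vector: "t *\<^sub>R frame_vector (a1, a2, a3) z = frame_vector (t * a1, t * a2, t * a3) z"
  by (simp add: frame_vector_def scaleR_add_right)

text \<open>The cylindrical frame turns about the fixed axis. The components of the derivative agree with those of the right-hand side modulo the
polynomial relations between the sine, the cosine, \<open>\<omega>\<close> and \<open>\<nu>\<close>.\<close>

lemma radial_deriv: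
  assumes v: "v = x *\<^sub>R (p, q)"
  shows "((\<lambda>x. radial (x *\<^sub>R (p, q))) has_vector_derivative (\<kappa> * turning (phase v) p q) *\<^sub>R azimuthal v) (at x)"
proof -
  define s c w n where "s = sin (\<theta> (phase v))" and "c = cos (\<theta> (phase v))" and "w = \<omega> (phase v)" and "n = \<nu> (phase v)"
  define D where "D = \<alpha> * p + \<beta> * q"
  define n' where "n' = - \<epsilon> * \<kappa>\<^sup>2 * s * c * w * n ^ 3"
  note rel = constant_relations pendulum_relations[of "phase v", folded s_def c_def w_def n_def]
  have ders: "((\<lambda>x. \<nu> (phase (x *\<^sub>R (p, q))) * \<omega> (phase (x *\<^sub>R (p, q))) * sin (\<theta> (phase (x *\<^sub>R (p, q))))) has_real_derivative
        (n' * w * s + n * (- \<mu> * s * c) * s + n * w * (c * w)) * D) (at x)"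
    "((\<lambda>x. \<nu> (phase (x *\<^sub>R (p, q))) * \<omega> (phase (x *\<^sub>R (p, q))) * cos (\<theta> (phase (x *\<^sub>R (p, q))))) has_real_derivative
        (n' * w * c + n * (- \<mu> * s * c) * c - n * w * (s * w)) * D) (at x)"
    "((\<lambda>x. \<nu> (phase (x *\<^sub>R (p, q))) * sin (\<theta> (phase (x *\<^sub>R (p, q)))) * cos (\<theta> (phase (x *\<^sub>R (p, q))))) has_real_derivative
        (n' * s * c + n * (c * w) * c - n * s * (s * w)) * D) (at x)"
  proof -
    have "((\<lambda>u. \<nu> u * \<omega> u * sin (\<theta> u)) has_real_derivative
        (- \<epsilon> * \<kappa>\<^sup>2 * sin (\<theta> u) * cos (\<theta> u) * \<omega> u * \<nu> u ^ 3) * \<omega> u * sin (\<theta> u) +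
        \<nu> u * (- \<mu> * sin (\<theta> u) * cos (\<theta> u)) * sin (\<theta> u) + \<nu> u * \<omega> u * (cos (\<theta> u) * \<omega> u)) (at u)" for u
      by (rule DERIV_cong[OF DERIV_mult[OF DERIV_mult[OF \<nu>_deriv \<omega>_deriv] trig_deriv(1)]]) (simp add: algebra_simps)
    from line_deriv[OF this v] show "((\<lambda>x. \<nu> (phase (x *\<^sub>R (p, q))) * \<omega> (phase (x *\<^sub>R (p, q))) * sin (\<theta> (phase (x *\<^sub>R (p, q))))) has_real_derivative
        (n' * w * s + n * (- \<mu> * s * c) * s + n * w * (c * w)) * D) (at x)"
      by (simp only: s_def c_def w_def n_def n'_def D_def)
    have "((\<lambda>u. \<nu> u * \<omega> u * cos (\<theta> u)) has_real_derivative
        (- \<epsilon> * \<kappa>\<^sup>2 * sin (\<theta> u) * cos (\<theta> u) * \<omega> u * \<nu> u ^ 3) * \<omega> u * cos (\<theta> u) +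
        \<nu> u * (- \<mu> * sin (\<theta> u) * cos (\<theta> u)) * cos (\<theta> u) - \<nu> u * \<omega> u * (sin (\<theta> u) * \<omega> u)) (at u)" for u
      by (rule DERIV_cong[OF DERIV_mult[OF DERIV_mult[OF \<nu>_deriv \<omega>_deriv] trig_deriv(2)]]) (simp add: algebra_simps)
    from line_deriv[OF this v] show "((\<lambda>x. \<nu> (phase (x *\<^sub>R (p, q))) * \<omega> (phase (x *\<^sub>R (p, q))) * cos (\<theta> (phase (x *\<^sub>R (p, q))))) has_real_derivative
        (n' * w * c + n * (- \<mu> * s * c) * c - n * w * (s * w)) * D) (at x)"
      by (simp only: s_def c_def w_def n_def n'_def D_def)
    have "((\<lambda>u. \<nu> u * sin (\<theta> u) * cos (\<theta> u)) has_real_derivative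
        (- \<epsilon> * \<kappa>\<^sup>2 * sin (\<theta> u) * cos (\<theta> u) * \<omega> u * \<nu> u ^ 3) * sin (\<theta> u) * cos (\<theta> u) +
        \<nu> u * (cos (\<theta> u) * \<omega> u) * cos (\<theta> u) - \<nu> u * sin (\<theta> u) * (sin (\<theta> u) * \<omega> u)) (at u)" for u
      by (rule DERIV_cong[OF DERIV_mult[OF DERIV_mult[OF \<nu>_deriv trig_deriv(1)] trig_deriv(2)]]) (simp add: algebra_simps)
    from line_deriv[OF this v] show "((\<lambda>x. \<nu> (phase (x *\<^sub>R (p, q))) * sin (\<theta> (phase (x *\<^sub>R (p, q)))) * cos (\<theta> (phase (x *\<^sub>R (p, q))))) has_real_derivative
        (n' * s * c + n * (c * w) * c - n * s * (s * w)) * D) (at x)"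
      by (simp only: s_def c_def w_def n_def n'_def D_def)
  qed
  define t where "t = (\<beta> * p * \<epsilon>\<^sup>2 * c\<^sup>2 - q * \<alpha> * (\<epsilon> + \<epsilon>\<^sup>2) * s\<^sup>2) * n\<^sup>2"
  have coeffs: "\<epsilon> * \<alpha> * ((n' * w * s + n * (- \<mu> * s * c) * s + n * w * (c * w)) * D) +
      (\<beta> * p + \<alpha> * q) * w * (- \<epsilon> * \<beta> * (n * w * c)) + p * s * (- \<epsilon> * (n * s * c)) = t * (\<epsilon>\<^sup>2 * \<beta> * n * c)"
    "- \<epsilon> * \<beta> * ((n' * w * c + n * (- \<mu> * s * c) * c - n * w * (s * w)) * D) -
      (\<beta> * p + \<alpha> * q) * w * (\<epsilon> * \<alpha> * (n * w * s)) + q * c * (- \<epsilon> * (n * s * c)) = t * (\<epsilon> * \<alpha> * (1 + \<epsilon>) * n * s)"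
    "- \<epsilon> * ((n' * s * c + n * (c * w) * c - n * s * (s * w)) * D) -
      p * s * (\<epsilon> * \<alpha> * (n * w * s)) - q * c * (- \<epsilon> * \<beta> * (n * w * c)) = t * (- \<epsilon> * \<alpha> * \<beta> * n * w)"
    unfolding t_def n'_def D_def using rel by algebra+
  have "((\<lambda>x. radial (x *\<^sub>R (p, q))) has_vector_derivative
      frame_vector (t * (\<epsilon>\<^sup>2 * \<beta> * n * c), t * (\<epsilon> * \<alpha> * (1 + \<epsilon>) * n * s), t * (- \<epsilon> * \<alpha> * \<beta> * n * w)) v) (at x)"
    unfolding radial_def
    using frame_vector_deriv[OF DERIV_cmult[OF ders(1), of "\<epsilon> * \<alpha>"] DERIV_cmult[OF ders(2), of "- \<epsilon> * \<beta>"] DERIV_cmult[OF ders(3), of "- \<epsilon>"] v]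
    by (simp only: coeffs v[symmetric] s_def[symmetric] c_def[symmetric] w_def[symmetric] n_def[symmetric])
  moreover have "(\<kappa> * turning (phase v) p q) *\<^sub>R azimuthal v =
      frame_vector (t * (\<epsilon>\<^sup>2 * \<beta> * n * c), t * (\<epsilon> * \<alpha> * (1 + \<epsilon>) * n * s), t * (- \<epsilon> * \<alpha> * \<beta> * n * w)) v"
    unfolding azimuthal_def turning_def s_def[symmetric] c_def[symmetric] w_def[symmetric] n_def[symmetric] t_def[symmetric] scaleR_frame_vector
    using \<kappa>_pos by (simp add: mult.assoc)
  ultimately show ?thesis by simp
qed

text \<open>The polar angle is a function \<open>\<Psi>\<close> of the phase plus a linear function of \<open>t\<close>. The linear term \<open>- \<kappa> t / \<alpha>\<close> grows at the rate
\<open>\<kappa>\<close> along \<open>(\<beta>, - \<alpha>)\<close>, as it must, and \<open>\<Psi>\<close> is the antiderivative that makes the total rate of change equal to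
\<open>\<kappa>\<close> times \<open>turning\<close>.\<close>

definition "\<Psi> = (SOME G. \<forall>u. (G has_real_derivative \<kappa> * \<beta> * \<epsilon>\<^sup>2 * (cos (\<theta> u))\<^sup>2 * (\<nu> u)\<^sup>2 / \<alpha>) (at u))"

lemma \<Psi>_deriv: "(\<Psi> has_real_derivative \<kappa> * \<beta> * \<epsilon>\<^sup>2 * (cos (\<theta> u))\<^sup>2 * (\<nu> u)\<^sup>2 / \<alpha>) (at u)"
proof -
  have "isCont (\<lambda>u. \<kappa> * \<beta> * \<epsilon>\<^sup>2 * (cos (\<theta> u))\<^sup>2 * (\<nu> u)\<^sup>2 / \<alpha>) u" for u
    by (intro continuous_intros isCont_parts isCont_cos') (use \<alpha>\<beta>(1) in simp)
  then have "\<exists>G. \<forall>u. (G has_real_derivative \<kappa> * \<beta> * \<epsilon>\<^sup>2 * (cos (\<theta> u))\<^sup>2 * (\<nu> u)\<^sup>2 / \<alpha>) (at u)"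
    using global_antiderivative[of "\<lambda>u. \<kappa> * \<beta> * \<epsilon>\<^sup>2 * (cos (\<theta> u))\<^sup>2 * (\<nu> u)\<^sup>2 / \<alpha>"] by blast
  from someI_ex[OF this] show ?thesis unfolding \<Psi>_def by blast
qed

definition "angle z = \<Psi> (phase z) - \<kappa> * snd z / \<alpha>"

lemma angle_deriv:
  assumes v: "v = x *\<^sub>R (p, q)"
  shows "((\<lambda>x. angle (x *\<^sub>R (p, q))) has_real_derivative \<kappa> * turning (phase v) p q) (at x)"
proof -
  define s c n where "s = sin (\<theta> (phase v))" and "c = cos (\<theta> (phase v))" and "n = \<nu> (phase v)"
  note rel = constant_relations pendulum_relations[of "phase v", folded s_def c_def n_def]
  have "((\<lambda>x. angle (x *\<^sub>R (p, q))) has_real_derivative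
      \<kappa> * \<beta> * \<epsilon>\<^sup>2 * c\<^sup>2 * n\<^sup>2 / \<alpha> * (\<alpha> * p + \<beta> * q) - \<kappa> * q / \<alpha>) (at x)"
    unfolding angle_def c_def n_def
    by (rule DERIV_diff[OF line_deriv[OF \<Psi>_deriv v]]) (use \<alpha>\<beta>(1) in \<open>auto intro!: derivative_eq_intros\<close>)
  moreover have "\<kappa> * \<beta> * \<epsilon>\<^sup>2 * c\<^sup>2 * n\<^sup>2 * (\<alpha> * p + \<beta> * q) - \<kappa> * q =
      \<alpha> * (\<kappa> * ((\<beta> * p * \<epsilon>\<^sup>2 * c\<^sup>2 - q * \<alpha> * (\<epsilon> + \<epsilon>\<^sup>2) * s\<^sup>2) * n\<^sup>2))"
    using rel by algebra
  then have "\<kappa> * \<beta> * \<epsilon>\<^sup>2 * c\<^sup>2 * n\<^sup>2 / \<alpha> * (\<alpha> * p + \<beta> * q) - \<kappa> * q / \<alpha> = \<kappa> * turning (phase v) p q"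
    unfolding turning_def s_def[symmetric] c_def[symmetric] n_def[symmetric]
    using \<alpha>\<beta>(1) by (simp only: times_divide_eq_left diff_divide_distrib[symmetric]) simp
  ultimately show ?thesis by simp
qed

lemma azimuthal_eq: "azimuthal z = cross3 (screw_axis 0) (radial z)"
  by (metis axis_cross_radial axis_constant)

lemma axis_cross_azimuthal: "cross3 (screw_axis 0) (azimuthal z) = - radial z"
proof -
  have "screw_axis 0 \<bullet> radial z = 0" "screw_axis 0 \<bullet> screw_axis 0 = 1"
    using axis_radial[of z] axis_norm[of 0] axis_constant[of z] by (simp_all add: norm_eq_1)
  then show ?thesis by (simp add: azimuthal_eq Lagrange)
qed

lemma azimuthal_deriv:
  assumes v: "v = x *\<^sub>R (p, q)"
  shows "((\<lambda>x. azimuthal (x *\<^sub>R (p, q))) has_vector_derivative - (\<kappa> * turning (phase v) p q) *\<^sub>R radial v) (at x)"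
proof -
  have "bounded_linear (cross3 (screw_axis 0))"
    using bilinear_cross unfolding bilinear_def by (simp add: linear_conv_bounded_linear)
  from bounded_linear.has_vector_derivative[OF this radial_deriv[OF v]]
  show ?thesis
    by (simp add: azimuthal_eq[symmetric] cross_mult_right axis_cross_azimuthal)
qed

text \<open>The radial direction turned back by the polar angle; it spans, together with the axis, the half-plane of the profile.\<close>

definition "reference z = cos (angle z) *\<^sub>R radial z - sin (angle z) *\<^sub>R azimuthal z"

lemma reference_constant: "reference z = reference 0"
proof (rule constant_if_constant_along_lines)
  fix p q x :: real
  obtain v where v: "v = x *\<^sub>R (p, q)" by blast
  define t where "t = \<kappa> * turning (phase v) p q"
  have ders: "((\<lambda>x. cos (angle (x *\<^sub>R (p, q)))) has_real_derivative - sin (angle v) * t) (at x)"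
    "((\<lambda>x. sin (angle (x *\<^sub>R (p, q)))) has_real_derivative cos (angle v) * t) (at x)"
    using DERIV_chain2[OF DERIV_cos angle_deriv[OF v]] DERIV_chain2[OF DERIV_sin angle_deriv[OF v]]
    by (simp_all only: v t_def)
  have "((\<lambda>x. reference (x *\<^sub>R (p, q))) has_vector_derivative
      (cos (angle v) *\<^sub>R t *\<^sub>R azimuthal v + (- sin (angle v) * t) *\<^sub>R radial v) -
      (sin (angle v) *\<^sub>R (- t) *\<^sub>R radial v + (cos (angle v) * t) *\<^sub>R azimuthal v)) (at x)"
    unfolding reference_def
    using has_vector_derivative_diff[OF has_vector_derivative_scaleR[OF ders(1) radial_deriv[OF v]]
        has_vector_derivative_scaleR[OF ders(2) azimuthal_deriv[OF v]]]
    by (simp only: v[symmetric] t_def)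
  then show "((\<lambda>x. reference (x *\<^sub>R (p, q))) has_vector_derivative 0) (at x)"
    by (simp add: mult.commute)
qed

text \<open>The advance along the axis per radian, with the sign of the helicity.\<close>

definition "pitch = \<alpha> * \<beta> / \<kappa>\<^sup>2"

text \<open>What is left of \<open>f\<close> when its height along the axis and its radial part are removed, namely a point of the axis.\<close>

definition "centre z = f z - (\<zeta> (phase z) + pitch * angle z) *\<^sub>R screw_axis z - \<rho> (phase z) *\<^sub>R radial z"

text \<open>In the frame \<open>(e1, e2, e3)\<close> the derivative of \<open>centre\<close> has three components, and \<open>\<kappa>\<^sup>2\<close> times each of them is a polynomial in the
sine, the cosine, \<open>\<omega>\<close> and \<open>\<nu>\<close>. These polynomials vanish modulo the relations in \<open>constant_relations\<close> and
\<open>pendulum_relations\<close>.\<close>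

lemma centre_constant: "centre z = centre 0"
proof (rule constant_if_constant_along_lines)
  fix p q x :: real
  obtain v where v: "v = x *\<^sub>R (p, q)" by blast
  define s c w n where "s = sin (\<theta> (phase v))" and "c = cos (\<theta> (phase v))" and "w = \<omega> (phase v)" and "n = \<nu> (phase v)"
  define D where "D = \<alpha> * p + \<beta> * q"
  define t where "t = (\<beta> * p * \<epsilon>\<^sup>2 * c\<^sup>2 - q * \<alpha> * (\<epsilon> + \<epsilon>\<^sup>2) * s\<^sup>2) * n\<^sup>2"
  define A where "A = \<kappa>\<^sup>2 * \<epsilon> * s\<^sup>2 * c\<^sup>2 * n\<^sup>2 * D + \<alpha> * \<beta> * t"
  define B where "B = s * c * (\<epsilon> * w * n) * D"
  note rel = constant_relations pendulum_relations[of "phase v", folded s_def c_def w_def n_def]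
  have turning: "turning (phase v) p q = t"
    by (simp add: turning_def t_def s_def c_def n_def)
  have f: "((\<lambda>x. f (x *\<^sub>R (p, q))) has_vector_derivative frame_vector (p * c, - q * s, 0) v) (at x)"
    using smooth_along_line[OF smooth(1), of 0 "(p, q)" x UNIV]
    by (simp only: add_0_left v[symmetric] frame_equations s_def[symmetric] c_def[symmetric] frame_vector_def fst_conv snd_conv scaleR_zero_left add_0_right)
  have height: "((\<lambda>x. \<zeta> (phase (x *\<^sub>R (p, q))) + pitch * angle (x *\<^sub>R (p, q))) has_real_derivative
      (s * c)\<^sup>2 * (\<epsilon> * \<kappa> * n\<^sup>2) * D + pitch * (\<kappa> * t)) (at x)"
    using DERIV_add[OF line_deriv[OF \<zeta>_deriv v] DERIV_cmult[OF angle_deriv[OF v], of pitch]]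
    by (simp only: turning s_def c_def n_def D_def)
  have height_eq: "(s * c)\<^sup>2 * (\<epsilon> * \<kappa> * n\<^sup>2) * D + pitch * (\<kappa> * t) = A / \<kappa>"
    using \<kappa>_pos by (simp add: A_def pitch_def field_simps power2_eq_square)
  have "((\<lambda>x. \<zeta> (phase (x *\<^sub>R (p, q))) + pitch * angle (x *\<^sub>R (p, q))) has_real_derivative A / \<kappa>) (at x)"
    using height unfolding height_eq .
  from has_vector_derivative_scaleR[OF this has_vector_derivative_const[of "screw_axis 0"]]
  have 1: "((\<lambda>x. (\<zeta> (phase (x *\<^sub>R (p, q))) + pitch * angle (x *\<^sub>R (p, q))) *\<^sub>R screw_axis (x *\<^sub>R (p, q)))
      has_vector_derivative (A / \<kappa>) *\<^sub>R screw_axis v) (at x)"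
    by (simp add: axis_constant[of "x *\<^sub>R (p, q)" for x] axis_constant[of v] axis_constant[of "(x * p, x * q)" for x])
  have "((\<lambda>x. \<rho> (phase (x *\<^sub>R (p, q)))) has_real_derivative B) (at x)"
    using line_deriv[OF \<rho>_deriv v] by (simp only: B_def s_def c_def w_def n_def D_def)
  from has_vector_derivative_scaleR[OF this radial_deriv[OF v]]
  have 2: "((\<lambda>x. \<rho> (phase (x *\<^sub>R (p, q))) *\<^sub>R radial (x *\<^sub>R (p, q))) has_vector_derivative
      \<rho> (phase v) *\<^sub>R (\<kappa> * t) *\<^sub>R azimuthal v + B *\<^sub>R radial v) (at x)"
    by (simp only: turning v[symmetric])
  have az: "\<rho> (phase v) *\<^sub>R (\<kappa> * t) *\<^sub>R azimuthal v = frame_vector (t * (\<epsilon>\<^sup>2 * \<beta> * c) / \<kappa>\<^sup>2, t * (\<epsilon> * \<alpha> * (1 + \<epsilon>) * s) / \<kappa>\<^sup>2, t * (- \<epsilon> * \<alpha> * \<beta> * w) / \<kappa>\<^sup>2) v"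
  proof -
    have "\<rho> (phase v) * n = 1 / \<kappa>\<^sup>2"
      using \<nu>_sq[of "phase v"] by (simp add: \<rho>_eq n_def power2_eq_square mult.commute mult.left_commute)
    then have "\<rho> (phase v) * (\<kappa> * t * (y * n * z / \<kappa>)) = t * (y * z) / \<kappa>\<^sup>2" for y z
      using \<kappa>_pos by (simp add: field_simps power2_eq_square)
    from this[of "\<epsilon>\<^sup>2 * \<beta>" c] this[of "\<epsilon> * \<alpha> * (1 + \<epsilon>)" s] this[of "- \<epsilon> * \<alpha> * \<beta>" w]
    show ?thesis
      unfolding azimuthal_def s_def[symmetric] c_def[symmetric] w_def[symmetric] n_def[symmetric] scaleR_frame_vector by (simp only:)
  qed
  have comps: "\<kappa>\<^sup>2 * (p * c) - A * (\<alpha> * c) - t * (\<epsilon>\<^sup>2 * \<beta> * c) - \<kappa>\<^sup>2 * (B * (\<epsilon> * \<alpha> * (n * w * s))) = 0"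
    "\<kappa>\<^sup>2 * (- q * s) - A * (\<beta> * s) - t * (\<epsilon> * \<alpha> * (1 + \<epsilon>) * s) - \<kappa>\<^sup>2 * (B * (- \<epsilon> * \<beta> * (n * w * c))) = 0"
    unfolding A_def B_def t_def D_def using rel by algebra+
  have comp3: "\<kappa>\<^sup>2 * 0 - A * (\<epsilon> * w) - t * (- \<epsilon> * \<alpha> * \<beta> * w) - \<kappa>\<^sup>2 * (B * (- \<epsilon> * (n * s * c))) = 0"
    unfolding A_def B_def by (simp add: algebra_simps power2_eq_square)
  have cancel: "y - (A / \<kappa> * (b / \<kappa>) + (d / \<kappa>\<^sup>2 + e)) = 0" if "\<kappa>\<^sup>2 * y - A * b - d - \<kappa>\<^sup>2 * e = 0" for y b d e
  proof -
    have "\<kappa>\<^sup>2 * (y - (A / \<kappa> * (b / \<kappa>) + (d / \<kappa>\<^sup>2 + e))) = \<kappa>\<^sup>2 * y - A * b - d - \<kappa>\<^sup>2 * e"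
      using \<kappa>_pos by (simp add: field_simps power2_eq_square)
    then show ?thesis using that \<kappa>_pos by simp
  qed
  have "((\<lambda>x. centre (x *\<^sub>R (p, q))) has_vector_derivative
      frame_vector (p * c, - q * s, 0) v - (A / \<kappa>) *\<^sub>R screw_axis v - (\<rho> (phase v) *\<^sub>R (\<kappa> * t) *\<^sub>R azimuthal v + B *\<^sub>R radial v)) (at x)"
    unfolding centre_def by (rule has_vector_derivative_diff[OF has_vector_derivative_diff[OF f 1] 2])
  moreover have "frame_vector (p * c, - q * s, 0) v - (A / \<kappa>) *\<^sub>R screw_axis v - (\<rho> (phase v) *\<^sub>R (\<kappa> * t) *\<^sub>R azimuthal v + B *\<^sub>R radial v) = 0"
  proof -
    have "frame_vector (p * c, - q * s, 0) v - (A / \<kappa>) *\<^sub>R screw_axis v - (\<rho> (phase v) *\<^sub>R (\<kappa> * t) *\<^sub>R azimuthal v + B *\<^sub>R radial v) =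
      frame_vector (p * c - (A / \<kappa> * (\<alpha> * c / \<kappa>) + (t * (\<epsilon>\<^sup>2 * \<beta> * c) / \<kappa>\<^sup>2 + B * (\<epsilon> * \<alpha> * (n * w * s)))),
        - q * s - (A / \<kappa> * (\<beta> * s / \<kappa>) + (t * (\<epsilon> * \<alpha> * (1 + \<epsilon>) * s) / \<kappa>\<^sup>2 + B * (- \<epsilon> * \<beta> * (n * w * c)))),
        0 - (A / \<kappa> * (\<epsilon> * w / \<kappa>) + (t * (- \<epsilon> * \<alpha> * \<beta> * w) / \<kappa>\<^sup>2 + B * (- \<epsilon> * (n * s * c))))) v"
      unfolding az screw_axis_def radial_def s_def[symmetric] c_def[symmetric] w_def[symmetric] n_def[symmetric] scaleR_frame_vector
      by (simp only: frame_vector_def fst_conv snd_conv scaleR_left_diff_distrib scaleR_left_distrib) simp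
    also have "\<dots> = frame_vector (0, 0, 0) v"
      by (simp only: cancel[OF comps(1)] cancel[OF comps(2)] cancel[OF comp3])
    finally show ?thesis by (simp add: frame_vector_def)
  qed
  ultimately show "((\<lambda>x. centre (x *\<^sub>R (p, q))) has_vector_derivative 0) (at x)" by simp
qed

lemma surface_in_cylindrical_coordinates:
  "f z = centre 0 + (\<zeta> (phase z) + pitch * angle z) *\<^sub>R screw_axis 0 +
    \<rho> (phase z) *\<^sub>R (cos (angle z) *\<^sub>R reference 0 + sin (angle z) *\<^sub>R cross3 (screw_axis 0) (reference 0))"
proof -
  have "cross3 (screw_axis 0) (reference z) = cos (angle z) *\<^sub>R azimuthal z + sin (angle z) *\<^sub>R radial z"
    by (simp add: reference_def cross_mult_right Cross3.right_diff_distrib azimuthal_eq[symmetric] axis_cross_azimuthal)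
  then have "cos (angle z) *\<^sub>R reference z + sin (angle z) *\<^sub>R cross3 (screw_axis 0) (reference z) =
      (cos (angle z))\<^sup>2 *\<^sub>R radial z + (sin (angle z))\<^sup>2 *\<^sub>R radial z"
    by (simp add: reference_def algebra_simps power2_eq_square)
  also have "\<dots> = radial z"
    by (simp flip: scaleR_left_distrib)
  finally have "radial z = cos (angle z) *\<^sub>R reference 0 + sin (angle z) *\<^sub>R cross3 (screw_axis 0) (reference 0)"
    by (simp add: reference_constant[of z])
  then show ?thesis
    using centre_constant[of z] axis_constant[of z] by (simp add: centre_def algebra_simps)
qed

lemma reference_norm: "norm (reference 0) = 1" and axis_reference: "screw_axis 0 \<bullet> reference 0 = 0"
proof -
  have ra: "radial 0 \<bullet> azimuthal 0 = 0" and aa: "screw_axis 0 \<bullet> azimuthal 0 = 0"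
    by (simp_all add: azimuthal_eq dot_cross_self)
  have "azimuthal 0 \<bullet> azimuthal 0 = 1"
    using norm_cross_dot[of "screw_axis 0" "radial 0"] axis_norm[of 0] radial_norm[of 0] axis_radial[of 0]
    by (simp add: azimuthal_eq power2_norm_eq_inner)
  moreover have "radial 0 \<bullet> radial 0 = 1"
    using radial_norm[of 0] by (simp add: norm_eq_1)
  ultimately have "reference 0 \<bullet> reference 0 = (cos (angle 0))\<^sup>2 + (sin (angle 0))\<^sup>2"
    using ra by (simp add: reference_def inner_diff_left inner_diff_right inner_commute[of "azimuthal 0" "radial 0"]
        power2_eq_square del: sin_cos_squared_add sin_cos_squared_add2)
  then show "norm (reference 0) = 1" by (simp add: norm_eq_1)
  show "screw_axis 0 \<bullet> reference 0 = 0"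
    using axis_radial[of 0] aa by (simp add: reference_def inner_diff_right)
qed

lemma pitch_nz: "pitch \<noteq> 0"
  using \<alpha>\<beta> \<kappa>_pos by (simp add: pitch_def)

lemma screw_motion_profile:
  assumes "norm l = 1" "l \<bullet> n = 0"
  shows "screw_motion c l (2 * pi * \<bar>h\<bar>) (sgn h) v (c + a *\<^sub>R l + b *\<^sub>R n) =
    c + (a + h * (2 * pi * v)) *\<^sub>R l + b *\<^sub>R (cos (2 * pi * v) *\<^sub>R n + sin (2 * pi * v) *\<^sub>R cross3 l n)"
proof -
  have "l \<bullet> l = 1" using assms(1) by (simp add: norm_eq_1)
  then have "l \<bullet> (a *\<^sub>R l + b *\<^sub>R n) = a"
    using assms(2) by (simp add: inner_add_right)
  moreover have "sgn h * v * (2 * pi * \<bar>h\<bar>) = h * (2 * pi * v)"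
    by (simp add: sgn_if)
  ultimately show ?thesis
    by (simp add: screw_motion_def rotation_about_def cross_add_right cross_mult_right add.assoc)
      (simp add: algebra_simps)
qed

text \<open>A point of the surface with phase \<open>u\<close> and polar angle \<open>2 pi v\<close> is the image of the profile point with parameter \<open>u\<close> under
the screw motion with parameter \<open>v\<close>, and every pair \<open>(u, v)\<close> occurs because the polar angle is affine and nonconstant in \<open>t\<close> when
the phase is fixed.\<close>

lemma image_is_helicoid:
  "range f = helicoid (centre 0) (screw_axis 0) (2 * pi * \<bar>pitch\<bar>) (sgn pitch)
    (range (\<lambda>u. centre 0 + \<zeta> u *\<^sub>R screw_axis 0 + \<rho> u *\<^sub>R reference 0))"
proof -
  let ?E = "screw_motion (centre 0) (screw_axis 0) (2 * pi * \<bar>pitch\<bar>) (sgn pitch)"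
  let ?\<gamma> = "\<lambda>u. centre 0 + \<zeta> u *\<^sub>R screw_axis 0 + \<rho> u *\<^sub>R reference 0"
  have f: "f z = ?E (angle z / (2 * pi)) (?\<gamma> (phase z))" for z
    unfolding screw_motion_profile[OF axis_norm axis_reference]
    using surface_in_cylindrical_coordinates[of z] by simp
  have surj: "\<exists>z. phase z = u \<and> angle z / (2 * pi) = v" for u v
  proof -
    define t where "t = \<alpha> * (\<Psi> u - 2 * pi * v) / \<kappa>"
    have "phase ((u - \<beta> * t) / \<alpha>, t) = u" using \<alpha>\<beta>(1) by (simp add: phase_def)
    moreover from this have "angle ((u - \<beta> * t) / \<alpha>, t) / (2 * pi) = v"
      using \<alpha>\<beta>(1) \<kappa>_pos by (simp add: angle_def t_def)
    ultimately show ?thesis by blast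
  qed
  show ?thesis
    unfolding helicoid_def
  proof (intro equalityI subsetI)
    fix y assume "y \<in> range f"
    then show "y \<in> (\<Union>v. ?E v ` range ?\<gamma>)" using f by blast
  next
    fix y assume "y \<in> (\<Union>v. ?E v ` range ?\<gamma>)"
    then obtain u v where "y = ?E v (?\<gamma> u)" by blast
    moreover obtain z where "phase z = u" "angle z / (2 * pi) = v" using surj by blast
    ultimately have "y = f z" using f[of z] by simp
    then show "y \<in> range f" by blast
  qed
qed

lemma range_translational_kind:
  assumes "P > 0" and "\<And>u. (sin (\<theta> (u + P)))\<^sup>2 = (sin (\<theta> u))\<^sup>2"
  shows "helicoid_of_translational_kind (range f)"
proof -
  define c l n where "c = centre 0" and "l = screw_axis 0" and "n = reference 0"
  have ln: "norm l = 1" "norm n = 1" "l \<bullet> n = 0"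
    by (simp_all add: l_def n_def axis_norm reference_norm axis_reference)
  let ?\<gamma> = "\<lambda>u. c + \<zeta> u *\<^sub>R l + \<rho> u *\<^sub>R n"
  have "range ?\<gamma> \<subseteq> half_plane c l n"
    using \<rho>_pos by (auto simp: half_plane_def intro: less_imp_le)
  moreover have "range ?\<gamma> \<inter> axis_line c l = {}"
  proof -
    have "?\<gamma> u \<noteq> c + a *\<^sub>R l" for u a
    proof
      assume "?\<gamma> u = c + a *\<^sub>R l"
      then have "n \<bullet> (\<zeta> u *\<^sub>R l + \<rho> u *\<^sub>R n) = n \<bullet> (a *\<^sub>R l)"
        by (simp add: add.assoc)
      then have "\<rho> u = 0"
        using ln(3) ln(2)[unfolded norm_eq_1] by (simp add: inner_add_right inner_commute)
      then show False using \<rho>_pos[of u] by simp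
    qed
    then show ?thesis by (auto simp: axis_line_def)
  qed
  moreover have "2 * pi * \<bar>pitch\<bar> > 0" and "sgn pitch = 1 \<or> sgn pitch = -1"
    using pitch_nz by (auto simp: sgn_if)
  ultimately show ?thesis
    unfolding helicoid_of_translational_kind_def
    using ln image_is_helicoid[folded c_def l_def n_def]
      profile_symmetries[OF assms ln] simple_cuspidal_profile[OF assms ln]
    by (intro exI[of _ c] exI[of _ l] exI[of _ "2 * pi * \<bar>pitch\<bar>"] exI[of _ "sgn pitch"] exI[of _ n]
        exI[of _ ?\<gamma>] conjI)
qed

end

lemma pseudospherical_map_frame:
  assumes "pendulum_solution \<mu> \<theta> \<omega>" "\<mu> \<noteq> 0" "\<mu> \<noteq> 1"
    and "\<alpha> \<noteq> 0" "\<beta> \<noteq> 0" "\<alpha>\<^sup>2 - \<beta>\<^sup>2 = - (1 / \<mu>)"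
    and \<phi>: "\<And>z. \<phi> z = - 2 * \<theta> (\<alpha> * fst z + \<beta> * snd z)"
    and "pseudospherical_map \<phi> f"
  obtains e1 e2 e3 where "pseudospherical_frame \<mu> \<alpha> \<beta> \<theta> \<omega> f e1 e2 e3"
proof -
  have half: "\<phi> z / 2 = - \<theta> (\<alpha> * fst z + \<beta> * snd z)" for z
    by (simp add: \<phi>)
  obtain e1 e2 e3 where "smooth e1" "smooth e2" "smooth e3"
    and "\<And>z. norm (e1 z) = 1 \<and> norm (e2 z) = 1 \<and> norm (e3 z) = 1 \<and>
             e1 z \<bullet> e2 z = 0 \<and> e1 z \<bullet> e3 z = 0 \<and> e2 z \<bullet> e3 z = 0 \<and>
             det (vector [e1 z, e2 z, e3 z] :: real^3^3) > 0"
    and "\<And>z. frechet_derivative f (at z) (1, 0) = cos (\<phi> z / 2) *\<^sub>R e1 z \<and>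
             frechet_derivative f (at z) (0, 1) = sin (\<phi> z / 2) *\<^sub>R e2 z"
    and "\<And>z ds dt. second_fundamental_form f e3 z (ds, dt) =
             cos (\<phi> z / 2) * sin (\<phi> z / 2) * (ds\<^sup>2 - dt\<^sup>2)"
    and "smooth f"
    using assms(8) unfolding pseudospherical_map_def by blast
  then have "pseudospherical_frame \<mu> \<alpha> \<beta> \<theta> \<omega> f e1 e2 e3"
    using assms(1-6) unfolding half by unfold_locales auto
  then show ?thesis by (rule that)
qed

theorem theorem1:
  fixes \<mu> r :: real and S :: "(real^3) set"
  assumes "\<mu> \<noteq> 0" and "\<mu> \<noteq> 1" and "r \<noteq> 0"
    and "pseudospherical_helicoid \<mu> r S"
  shows "helicoid_of_translational_kind S"
proof -
  obtain f where f: "pseudospherical_map (traveling_wave \<mu> r) f" and S: "S = range f"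
    using assms(4) by (auto simp: pseudospherical_helicoid_def)
  obtain \<theta> \<omega> P where sol: "pendulum_solution \<mu> \<theta> \<omega>" and P: "P > 0" "\<And>u. (sin (\<theta> (u + P)))\<^sup>2 = (sin (\<theta> u))\<^sup>2"
    by (rule pendulum_exists[OF assms(2)]) (rule that)
  define \<alpha> where "\<alpha> = (if \<mu> < 0 then cosh r else sinh r) / sqrt \<bar>\<mu>\<bar>"
  define \<beta> where "\<beta> = (if \<mu> < 0 then sinh r else cosh r) / sqrt \<bar>\<mu>\<bar>"
  have nz: "cosh r \<noteq> 0" "sinh r \<noteq> 0"
    using cosh_real_pos[of r] assms(3) by auto
  have "\<alpha> \<noteq> 0" "\<beta> \<noteq> 0"
    using nz assms(1) by (auto simp: \<alpha>_def \<beta>_def)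
  moreover have "\<alpha>\<^sup>2 - \<beta>\<^sup>2 = - (1 / \<mu>)"
    using assms(1) cosh_square_eq[of r]
    by (auto simp: \<alpha>_def \<beta>_def power_divide field_simps)
  moreover have "traveling_wave \<mu> r z = - 2 * \<theta> (\<alpha> * fst z + \<beta> * snd z)" for z
    by (simp add: traveling_wave_def \<alpha>_def \<beta>_def jacobi_am_eq[OF sol] split_beta)
  ultimately obtain e1 e2 e3 where "pseudospherical_frame \<mu> \<alpha> \<beta> \<theta> \<omega> f e1 e2 e3"
    using pseudospherical_map_frame[OF sol assms(1,2) _ _ _ _ f] by blast
  then show ?thesis
    unfolding S using P by (rule pseudospherical_frame.range_translational_kind)
qed

end
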